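(* Let $d\ge1$ and let $A$ be a finite nonempty set. (a) For $M\subseteq A^{A^d}$: $({}^{d}\overline M)^{*_d}=\mathrm{Pol}\,{}^{d}\mathrm{GQuord}\,M$. (b) For a clone fragment $M\le A^{A^d}$ the following are equivalent: (i) $M$ is $\mathsf R_d$-closed; (i)$'$ $M^{*_d}$ is a clone; (i)$''$ $M\in{}^{d}\mathrm{GQuord}(A)$; (ii) $M=\mathrm{Pol}^{(d)}Q$ for some $Q\subseteq{}^{d}\mathrm{GQuord}(A)$; (iii) $M^{*_d}=\mathrm{Pol}\,Q$ for some $Q\subseteq{}^{d}\mathrm{GQuord}(A)$. Here the same $Q$ can be taken in (ii) and (iii). (c) For $Q\subseteq\mathrm{Rel}(A)$ the following are equivalent: (i) $\mathrm{Pol}^{(d)}Q$ is $\mathsf R_d$-closed; (i)$'$ $(\mathrm{Pol}^{(d)}Q)^{*_d}$ is a clone; (i)$''$ $\mathrm{Pol}^{(d)}Q\in{}^{d}\mathrm{GQuord}(A)$; (ii) there is $Q'\subseteq{}^{d}\mathrm{GQuord}(A)$ with $\mathrm{Pol}^{(d)}Q=\mathrm{Pol}^{(d)}Q'$; (ii)$'$ there is $Q'\subseteq{}^{d}\mathrm{GQuord}(A)$ with $d\text{-}\mathrm{LOC}\,[Q]_{\exists,\wedge,=}=d\text{-}\mathrm{LOC}\,[\mathring Q']_{\exists,\wedge,=}$; (iii) there is $Q'\subseteq{}^{d}\mathrm{GQuord}(A)$ with $(\mathrm{Pol}^{(d)}Q)^{*_d}=\mathrm{Pol}\,Q'$. Here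 the same $Q'$ can be taken in (ii) and (iii), and instead of "there is $Q'\subseteq{}^{d}\mathrm{GQuord}(A)$" one can take "there is $\rho\in{}^{d}\mathrm{GQuord}(A)$" with $Q'=\{\rho\}$.
   Context: Standing assumptions: $A$ is a finite nonempty set; all sets $B,B_i$ are finite and nonempty. $\mathrm{Op}(A)$ is the set of all operations $f:A^n\to A$, $n\ge1$; $\mathrm{Rel}(A)$ the set of all relations $\rho\subseteq A^m$, $m\ge1$. A clone is a subset of $\mathrm{Op}(A)$ containing all projections and closed under composition; $\langle F\rangle$ is the clone generated by $F$, $F^{(d)}$ the set of $d$-ary members of $F$. A $d$-ary clone fragment is a set $M\subseteq A^{A^d}$ with $M=\langle M\rangle^{(d)}$ (notation $M\le A^{A^d}$). $\mathrm{trl}_d(f)$, for $f:A^n\to A$, is the set of all $d$-ary operations obtained from $f$ by substituting constants from $A$ for some (possibly none, possibly all) of its variables, keeping the remaining $t\le d$ variables in their order, and then prepending $u$ and appending $v$ fictitious variables, $u+t+v=d$. For $N\subseteq A^{A^d}$, $N^{*_d}:=\{f\in\mathrm{Op}(A)\mid\mathrm{trl}_d(f)\subseteq N\}$. With $\mathcal C^{(d)}$ the set of $d$-ary constant operations, ${}^{d}\overline{M}:=\bigcap\{N\mid M\cup\mathcal C^{(d)}\subseteq N\le A^{A^d}\text{ and }N^{*_d}\text{ is a clone}\}$; a clone fragment $M$ is $\mathsf R_d$-closed if ${}^{d}\overline M=M$. R-relations. For $h:B^{n+1}\to A$, $\mathrm{ebtrl}(h)$ is the set of all $(x_0,\dots,x_{n-1})\mapsto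 h(x_0,\dots,x_{i-1},c,x_i,\dots,x_{n-1})$ with $0\le i\le n$, $c\in B$. For $g:B^n\to A$, $\mathrm{eftrl}(g)$ consists of $(x_0,\dots,x_n)\mapsto g(x_1,\dots,x_n)$ and $(x_0,\dots,x_n)\mapsto g(x_0,\dots,x_{n-1})$. For $\rho\subseteq A^{B^d}$: $\circledast(\rho):=\{h\in A^{B^{d+1}}\mid\mathrm{ebtrl}(h)\subseteq\rho\}$. For $h\in A^{B^{d+1}}$, $\mathbf\Delta(h)$ is the set of all $(x_0,\dots,x_{d-1})\mapsto h(x_0,\dots,x_{j-1},x_i,x_j,\dots,x_{d-1})$, $0\le i<j\le d$. (Extended to sets by unions.) $\rho\subseteq A^{B^d}$ is internally reflexive if $\mathrm{eftrl}(\rho)\subseteq\circledast(\rho)$, transitive if $\mathbf\Delta(\circledast(\rho))\subseteq\rho$. An R-relation of arity $\alpha=\alpha_1\times\dots\times\alpha_s$, $\alpha_j=B_j^{d_j}$, is a set $\rho\subseteq A^\alpha$ of functions $\alpha\to A$; its dimension is $d_1+\dots+d_s$. With $\alpha/\alpha_j$ the product with $j$-th factor deleted and $g^{(\alpha_j)}:\alpha_j\to A^{\alpha/\alpha_j}$ the currying $g^{(\alpha_j)}(X_j)(X_1,\dots,X_{j-1},X_{j+1},\dots,X_s)=g(X_1,\dots,X_s)$, put $\rho^{(\alpha_j)}:=\{g^{(\alpha_j)}\mid g\in\rho\}$, a relation of simple arity $B_j^{d_j}$ over base set $A^{\alpha/\alpha_j}$. $\rho$ is internally reflexive (transitive) if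 all $\rho^{(\alpha_j)}$ are; $\rho$ is a generalized quasiorder if it is internally reflexive, transitive and contains all constant functions $\alpha\to A$. ${}^{d}\mathrm{GQuord}(A)$ is the set of all $d$-dimensional generalized quasiorders on $A$ of canonical arity $m_1^{d_1}\times\dots\times m_s^{d_s}$, $m_i,d_i\ge1$, where $m_i=\{0,\dots,m_i-1\}$. $A$ is identified with the ordinal $|A|$, so that $A^d$ is canonical and any $M\subseteq A^{A^d}$ is an R-relation of simple arity $A^d$. $f:A^n\to A$ preserves $\rho\subseteq A^\alpha$ if for all $g_1,\dots,g_n\in\rho$ the function $b\mapsto f(g_1(b),\dots,g_n(b))$ is in $\rho$ (for $\rho\subseteq A^m$: the usual notion). ${}^{d}\mathrm{GQuord}\,M$ is the set of all $\rho\in{}^{d}\mathrm{GQuord}(A)$ preserved by all members of $M$; $\mathrm{Pol}\,T$ is the set of all $f\in\mathrm{Op}(A)$ preserving all members of $T$, $\mathrm{Pol}^{(d)}T$ its $d$-ary part. $\mathring\rho$ is the ordinary $|\alpha|$-ary relation obtained from an R-relation $\rho\subseteq A^\alpha$ via an arbitrary fixed bijection $|\alpha|\to\alpha$; $\mathring Q'=\{\mathring\rho\mid\rho\in Q'\}$. $[Q]_{\exists,\wedge,=}$ is the relational clone generated by $Q$: all relations definable from $Q$ by primitive positive formulas (the empty relation always included, so that $[Q]_{\exists,\wedge,=}=\mathrm{Inv}\,\mathrm{Pol}\,Q$, where $\mathrm{Inv}\,F$ is the set of relations in $\mathrm{Rel}(A)$ preserved by all $f\in F$). For $Q\subseteq\mathrm{Rel}(A)$,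 $d\text{-}\mathrm{LOC}\,Q:=\{\rho\in\mathrm{Rel}(A)\mid\forall S\subseteq\rho\text{ with }|S|\le d\ \exists\sigma\in Q: S\subseteq\sigma\subseteq\rho\}$. It is known that $\mathrm{Inv}\,\mathrm{Pol}^{(d)}Q=d\text{-}\mathrm{LOC}[Q]_{\exists,\wedge,=}$. *)

theory Defs
  imports "HOL-Library.FuncSet"
begin

section \<open>Operations, clones and clone fragments\<close>

text \<open>The elements of \<open>A\<^sup>n\<close> are lists.  A function defined on \<open>A\<^sup>n\<close> is extensional, i.e. it takes the
  value \<open>undefined\<close> on all other lists.  Since such a function does not always determine \<open>n\<close> (namely
  if \<open>A = {undefined}\<close>), an operation of unspecified arity is a pair \<open>(n, f)\<close>.  Sets of operations
  of one fixed arity \<open>d\<close>, such as subsets \<open>M\<close> of \<open>A\<^bsup>A\<^sup>d\<^esup>\<close>, are plain sets of functions.\<close>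

definition tuples :: "'a set \<Rightarrow> nat \<Rightarrow> 'a list set" where
  "tuples A n = {xs. set xs \<subseteq> A \<and> length xs = n}"

definition ops :: "'a set \<Rightarrow> nat \<Rightarrow> ('a list \<Rightarrow> 'a) set" where
  "ops A n = tuples A n \<rightarrow>\<^sub>E A"

definition Op :: "'a set \<Rightarrow> (nat \<times> ('a list \<Rightarrow> 'a)) set" where
  "Op A = {(n, f). 1 \<le> n \<and> f \<in> ops A n}"

definition ary_part :: "nat \<Rightarrow> (nat \<times> ('a list \<Rightarrow> 'a)) set \<Rightarrow> ('a list \<Rightarrow> 'a) set" where
  "ary_part d F = {f. (d, f) \<in> F}"

definition clone :: "'a set \<Rightarrow> (nat \<times> ('a list \<Rightarrow> 'a)) set \<Rightarrow> bool" where
  "clone A C \<longleftrightarrow> C \<subseteq> Op A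
     \<and> (\<forall>n\<ge>1. \<forall>i<n. (n, \<lambda>xs\<in>tuples A n. xs ! i) \<in> C)
     \<and> (\<forall>n m f gs. (n, f) \<in> C \<and> length gs = n \<and> (\<forall>g\<in>set gs. (m, g) \<in> C)
          \<longrightarrow> (m, \<lambda>xs\<in>tuples A m. f (map (\<lambda>g. g xs) gs)) \<in> C)"

definition clone_generated :: "'a set \<Rightarrow> (nat \<times> ('a list \<Rightarrow> 'a)) set \<Rightarrow> (nat \<times> ('a list \<Rightarrow> 'a)) set" where
  "clone_generated A F = \<Inter>{C. clone A C \<and> F \<subseteq> C}"

definition clone_fragment :: "'a set \<Rightarrow> nat \<Rightarrow> ('a list \<Rightarrow> 'a) set \<Rightarrow> bool" where
  "clone_fragment A d M \<longleftrightarrow> M \<subseteq> ops A d \<and> M = ary_part d (clone_generated A (Pair d ` M))"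


section \<open>Translations and the closure operator\<close>

text \<open>\<open>I\<close> is the set of (indices of) the variables that are kept; all others are replaced by the
  entries of \<open>cs\<close>.  The \<open>k\<close>-th variable kept becomes variable \<open>u + k\<close> of the new operation, which
  has \<open>u\<close> fictitious variables in front and the remaining \<open>d - (u + card I)\<close> ones at the end.\<close>

definition trl :: "'a set \<Rightarrow> nat \<Rightarrow> nat \<times> ('a list \<Rightarrow> 'a) \<Rightarrow> ('a list \<Rightarrow> 'a) set" where
  "trl A d = (\<lambda>(n, f).
     {\<lambda>xs\<in>tuples A d.
        f (map (\<lambda>i. if i \<in> I then xs ! (u + card {j\<in>I. j < i}) else cs ! i) [0..<n])
      | I cs u. I \<subseteq> {..<n} \<and> cs \<in> tuples A n \<and> u + card I \<le> d})"

definition star :: "'a set \<Rightarrow> nat \<Rightarrow> ('a list \<Rightarrow> 'a) set \<Rightarrow> (nat \<times> ('a list \<Rightarrow> 'a)) set" where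
  "star A d N = {F \<in> Op A. trl A d F \<subseteq> N}"

definition const_ops :: "'a set \<Rightarrow> nat \<Rightarrow> ('a list \<Rightarrow> 'a) set" where
  "const_ops A d = {\<lambda>xs\<in>tuples A d. a | a. a \<in> A}"

definition R_closure :: "'a set \<Rightarrow> nat \<Rightarrow> ('a list \<Rightarrow> 'a) set \<Rightarrow> ('a list \<Rightarrow> 'a) set" where
  "R_closure A d M =
     \<Inter>{N. M \<union> const_ops A d \<subseteq> N \<and> clone_fragment A d N \<and> clone A (star A d N)}"

definition R_closed :: "'a set \<Rightarrow> nat \<Rightarrow> ('a list \<Rightarrow> 'a) set \<Rightarrow> bool" where
  "R_closed A d M \<longleftrightarrow> clone_fragment A d M \<and> R_closure A d M = M"


section \<open>R-relations\<close>

definition ebtrl :: "'b set \<Rightarrow> nat \<Rightarrow> ('b list \<Rightarrow> 'a) \<Rightarrow> ('b list \<Rightarrow> 'a) set" where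
  "ebtrl B n h = {\<lambda>xs\<in>tuples B n. h (take i xs @ [c] @ drop i xs) | i c. i \<le> n \<and> c \<in> B}"

definition eftrl :: "'b set \<Rightarrow> nat \<Rightarrow> ('b list \<Rightarrow> 'a) \<Rightarrow> ('b list \<Rightarrow> 'a) set" where
  "eftrl B n g = {\<lambda>xs\<in>tuples B (Suc n). g (tl xs), \<lambda>xs\<in>tuples B (Suc n). g (butlast xs)}"

definition circledast :: "'a set \<Rightarrow> 'b set \<Rightarrow> nat \<Rightarrow> ('b list \<Rightarrow> 'a) set \<Rightarrow> ('b list \<Rightarrow> 'a) set" where
  "circledast A B d \<rho> = {h \<in> tuples B (Suc d) \<rightarrow>\<^sub>E A. ebtrl B d h \<subseteq> \<rho>}"

definition Delta :: "'b set \<Rightarrow> nat \<Rightarrow> ('b list \<Rightarrow> 'a) \<Rightarrow> ('b list \<Rightarrow> 'a) set" where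
  "Delta B d h =
     {\<lambda>xs\<in>tuples B d. h (take j xs @ [xs ! i] @ drop j xs) | i j. i < j \<and> j \<le> d}"

definition simple_int_reflexive :: "'a set \<Rightarrow> 'b set \<Rightarrow> nat \<Rightarrow> ('b list \<Rightarrow> 'a) set \<Rightarrow> bool" where
  "simple_int_reflexive A B d \<rho> \<longleftrightarrow> (\<Union>g\<in>\<rho>. eftrl B d g) \<subseteq> circledast A B d \<rho>"

definition simple_transitive :: "'a set \<Rightarrow> 'b set \<Rightarrow> nat \<Rightarrow> ('b list \<Rightarrow> 'a) set \<Rightarrow> bool" where
  "simple_transitive A B d \<rho> \<longleftrightarrow> (\<Union>h\<in>circledast A B d \<rho>. Delta B d h) \<subseteq> \<rho>"

text \<open>The arity \<open>B\<^sub>1\<^bsup>d\<^sub>1\<^esup> \<times> \<dots> \<times> B\<^sub>s\<^bsup>d\<^sub>s\<^esup>\<close> is represented by the list \<open>[(B\<^sub>1, d\<^sub>1), \<dots>, (B\<^sub>s, d\<^sub>s)]\<close>, its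
  elements by lists of length \<open>s\<close> whose \<open>j\<close>-th entry is a tuple in \<open>B\<^sub>j\<^bsup>d\<^sub>j\<^esup>\<close>.\<close>

type_synonym 'b arity = "('b set \<times> nat) list"

type_synonym ('b, 'a) rrel = "'b arity \<times> ('b list list \<Rightarrow> 'a) set"

definition points :: "'b arity \<Rightarrow> 'b list list set" where
  "points \<alpha> = {X. list_all2 (\<lambda>x (B, n). x \<in> tuples B n) X \<alpha>}"

definition dimension :: "'b arity \<Rightarrow> nat" where
  "dimension \<alpha> = sum_list (map snd \<alpha>)"

definition delete_at :: "nat \<Rightarrow> 'c list \<Rightarrow> 'c list" where
  "delete_at j xs = take j xs @ drop (Suc j) xs"

definition insert_at :: "nat \<Rightarrow> 'c \<Rightarrow> 'c list \<Rightarrow> 'c list" where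
  "insert_at j x xs = take j xs @ [x] @ drop j xs"

definition curry_at :: "'b arity \<Rightarrow> nat \<Rightarrow> ('b list list \<Rightarrow> 'a) \<Rightarrow> 'b list \<Rightarrow> 'b list list \<Rightarrow> 'a" where
  "curry_at \<alpha> j g =
     (\<lambda>x\<in>tuples (fst (\<alpha> ! j)) (snd (\<alpha> ! j)). \<lambda>Y\<in>points (delete_at j \<alpha>). g (insert_at j x Y))"

definition int_reflexive :: "'a set \<Rightarrow> 'b arity \<Rightarrow> ('b list list \<Rightarrow> 'a) set \<Rightarrow> bool" where
  "int_reflexive A \<alpha> \<rho> \<longleftrightarrow>
     (\<forall>j<length \<alpha>. simple_int_reflexive (points (delete_at j \<alpha>) \<rightarrow>\<^sub>E A)
                      (fst (\<alpha> ! j)) (snd (\<alpha> ! j)) (curry_at \<alpha> j ` \<rho>))"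

definition transitive :: "'a set \<Rightarrow> 'b arity \<Rightarrow> ('b list list \<Rightarrow> 'a) set \<Rightarrow> bool" where
  "transitive A \<alpha> \<rho> \<longleftrightarrow>
     (\<forall>j<length \<alpha>. simple_transitive (points (delete_at j \<alpha>) \<rightarrow>\<^sub>E A)
                      (fst (\<alpha> ! j)) (snd (\<alpha> ! j)) (curry_at \<alpha> j ` \<rho>))"

definition generalized_quasiorder :: "'a set \<Rightarrow> 'b arity \<Rightarrow> ('b list list \<Rightarrow> 'a) set \<Rightarrow> bool" where
  "generalized_quasiorder A \<alpha> \<rho> \<longleftrightarrow> \<rho> \<subseteq> points \<alpha> \<rightarrow>\<^sub>E A
     \<and> int_reflexive A \<alpha> \<rho> \<and> transitive A \<alpha> \<rho> \<and> (\<forall>a\<in>A. (\<lambda>X\<in>points \<alpha>. a) \<in> \<rho>)"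

definition canonical :: "nat arity \<Rightarrow> bool" where
  "canonical \<alpha> \<longleftrightarrow> (\<forall>(B, n)\<in>set \<alpha>. (\<exists>m\<ge>1. B = {..<m}) \<and> 1 \<le> n)"

definition GQuord :: "'a set \<Rightarrow> nat \<Rightarrow> (nat, 'a) rrel set" where
  "GQuord A d = {(\<alpha>, \<rho>). canonical \<alpha> \<and> dimension \<alpha> = d \<and> generalized_quasiorder A \<alpha> \<rho>}"

definition preserves_rrel :: "nat \<times> ('a list \<Rightarrow> 'a) \<Rightarrow> ('b, 'a) rrel \<Rightarrow> bool" where
  "preserves_rrel = (\<lambda>(n, f) (\<alpha>, \<rho>).
     \<forall>gs. length gs = n \<and> set gs \<subseteq> \<rho> \<longrightarrow> (\<lambda>X\<in>points \<alpha>. f (map (\<lambda>g. g X) gs)) \<in> \<rho>)"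

definition GQuord_inv :: "'a set \<Rightarrow> nat \<Rightarrow> (nat \<times> ('a list \<Rightarrow> 'a)) set \<Rightarrow> (nat, 'a) rrel set" where
  "GQuord_inv A d F = {T \<in> GQuord A d. \<forall>f\<in>F. preserves_rrel f T}"

definition Pol_rrel :: "'a set \<Rightarrow> ('b, 'a) rrel set \<Rightarrow> (nat \<times> ('a list \<Rightarrow> 'a)) set" where
  "Pol_rrel A Q = {f \<in> Op A. \<forall>T\<in>Q. preserves_rrel f T}"

text \<open>A set \<open>M\<close> of \<open>d\<close>-ary operations as an R-relation of canonical simple arity \<open>k\<^sup>d\<close>, \<open>k = |A|\<close>,
  where the argument set \<open>A\<close> is identified with the ordinal \<open>k\<close> by means of a bijection \<open>e\<close>.\<close>

definition fragment_rrel :: "'a set \<Rightarrow> ('a \<Rightarrow> nat) \<Rightarrow> nat \<Rightarrow> ('a list \<Rightarrow> 'a) set \<Rightarrow> (nat, 'a) rrel" where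
  "fragment_rrel A e d M =
     (let \<alpha> = [({..<card A}, d)]
      in (\<alpha>, (\<lambda>f. \<lambda>X\<in>points \<alpha>. f (map (inv_into A e) (hd X))) ` M))"


section \<open>Ordinary relations\<close>

text \<open>An ordinary relation is a set of lists of the same length, so that there is only one empty
  relation.\<close>

definition Rel :: "'a set \<Rightarrow> 'a list set set" where
  "Rel A = {\<rho>. \<exists>m\<ge>1. \<rho> \<subseteq> tuples A m}"

definition preserves :: "nat \<times> ('a list \<Rightarrow> 'a) \<Rightarrow> 'a list set \<Rightarrow> bool" where
  "preserves = (\<lambda>(n, f) \<rho>. \<forall>rs. length rs = n \<and> set rs \<subseteq> \<rho>
     \<longrightarrow> map (\<lambda>i. f (map (\<lambda>r. r ! i) rs)) [0..<length (hd rs)] \<in> \<rho>)"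

definition Pol :: "'a set \<Rightarrow> 'a list set set \<Rightarrow> (nat \<times> ('a list \<Rightarrow> 'a)) set" where
  "Pol A Q = {f \<in> Op A. \<forall>\<rho>\<in>Q. preserves f \<rho>}"

text \<open>Primitive positive formulas with variables \<open>0, 1, 2, \<dots>\<close>, where relations serve as their own
  relation symbols.\<close>

datatype 'a pp = PRel "'a list set" "nat list" | PEq nat nat | PAnd "'a pp" "'a pp" | PEx nat "'a pp"

primrec pp_over :: "'a set \<Rightarrow> 'a list set set \<Rightarrow> 'a pp \<Rightarrow> bool" where
  "pp_over A Q (PRel \<sigma> is) \<longleftrightarrow> \<sigma> \<in> Q \<and> \<sigma> \<subseteq> tuples A (length is)"
| "pp_over A Q (PEq i j) \<longleftrightarrow> True"
| "pp_over A Q (PAnd \<phi> \<psi>) \<longleftrightarrow> pp_over A Q \<phi> \<and> pp_over A Q \<psi>"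
| "pp_over A Q (PEx i \<phi>) \<longleftrightarrow> pp_over A Q \<phi>"

primrec free_vars :: "'a pp \<Rightarrow> nat set" where
  "free_vars (PRel \<sigma> is) = set is"
| "free_vars (PEq i j) = {i, j}"
| "free_vars (PAnd \<phi> \<psi>) = free_vars \<phi> \<union> free_vars \<psi>"
| "free_vars (PEx i \<phi>) = free_vars \<phi> - {i}"

primrec sat :: "'a set \<Rightarrow> (nat \<Rightarrow> 'a) \<Rightarrow> 'a pp \<Rightarrow> bool" where
  "sat A v (PRel \<sigma> is) \<longleftrightarrow> map v is \<in> \<sigma>"
| "sat A v (PEq i j) \<longleftrightarrow> v i = v j"
| "sat A v (PAnd \<phi> \<psi>) \<longleftrightarrow> sat A v \<phi> \<and> sat A v \<psi>"
| "sat A v (PEx i \<phi>) \<longleftrightarrow> (\<exists>a\<in>A. sat A (v(i := a)) \<phi>)"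

definition rel_clone :: "'a set \<Rightarrow> 'a list set set \<Rightarrow> 'a list set set" where
  "rel_clone A Q = insert {}
     {{xs \<in> tuples A m. sat A (\<lambda>i. xs ! i) \<phi>} | m \<phi>.
        1 \<le> m \<and> pp_over A Q \<phi> \<and> free_vars \<phi> \<subseteq> {..<m}}"

definition LOC :: "'a set \<Rightarrow> nat \<Rightarrow> 'a list set set \<Rightarrow> 'a list set set" where
  "LOC A d Q = {\<rho> \<in> Rel A. \<forall>S\<subseteq>\<rho>. finite S \<and> card S \<le> d \<longrightarrow> (\<exists>\<sigma>\<in>Q. S \<subseteq> \<sigma> \<and> \<sigma> \<subseteq> \<rho>)}"

text \<open>The ordinary relation \<open>\<rho>\<degree>\<close> (a ring accent in the literature) of an R-relation \<open>\<rho>\<close> of arity \<open>\<alpha>\<close>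
  with respect to an enumeration \<open>b \<alpha>\<close> of the elements of \<open>\<alpha>\<close>.\<close>

definition ordinary_rel :: "('b arity \<Rightarrow> nat \<Rightarrow> 'b list list) \<Rightarrow> ('b, 'a) rrel \<Rightarrow> 'a list set" where
  "ordinary_rel b = (\<lambda>(\<alpha>, \<rho>). (\<lambda>g. map (\<lambda>i. g (b \<alpha> i)) [0..<card (points \<alpha>)]) ` \<rho>)"

end

theory Submission
  imports Defs
begin

text \<open>The heart of the matter is that \<open>(Pol\<^bsup>(d)\<^esup> Q)\<^bsup>*\<^esup> = Pol Q\<close> for sets \<open>Q\<close> of \<open>d\<close>-dimensional generalized
  quasiorders, where \<open>*\<close> stands for \<open>*\<^sub>d\<close>.  Let all \<open>d\<close>-ary translations of \<open>f\<close> preserve \<open>\<rho>\<close> and let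
  \<open>g\<^sub>1, \<dots>, g\<^sub>n \<in> \<rho>\<close>.  In a coordinate of arity \<open>B\<^bsup>k\<^esup>\<close> give each \<open>g\<^sub>i\<close> its own \<open>k\<close> variables and consider
  the function \<open>f(g\<^sub>1, \<dots>, g\<^sub>n)\<close> of \<open>n k\<close> variables.  If all its translations to \<open>k\<close> variables lie in \<open>\<rho>\<close>,
  then transitivity allows the last variable to be identified with an earlier one, again and again,
  until the original \<open>f(g\<^sub>1, \<dots>, g\<^sub>n)\<close> is reached.  In such a translation at most \<open>k\<close> of the \<open>g\<^sub>i\<close> still
  depend on the coordinate, and internal reflexivity keeps them in \<open>\<rho>\<close>.  Doing this in each
  coordinate leaves at most \<open>d\<close> nonconstant functions \<open>g\<^sub>i\<close>, to which a \<open>d\<close>-ary translation of \<open>f\<close> applies.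

  Conversely, if \<open>M\<^bsup>*\<^esup>\<close> is a clone, then the members of \<open>\<circledast>(M)\<close> lie in it because their \<open>d\<close>-ary translations
  substitute at least one constant; hence \<open>M\<close> is transitive, and \<open>M = Pol\<^bsup>(d)\<^esup> {M}\<close>.\<close>

section \<open>Translations and simple R-relations\<close>

text \<open>Transitivity identifies one variable at a time, whereas in
  \<open>f(g_1, ..., g_n)\<close> all arguments already share their variables; hence the detour
  through separate blocks. The value set \<open>V\<close> has to stay arbitrary, since currying one
  coordinate turns the values into functions of the remaining ones. What one coordinate leaves open,
  the case of few nonconstant functions, is settled by treating the next coordinate. This does not
  undo earlier work: the new functions arise from the old ones by changing the argument in that
  coordinate alone, so no dependence on other coordinates is created. The bounds d_1, ..., d_s add
  up to the dimension, which is why d-dimensional relations match d-ary translations. A single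
  relation can replace Q because an operation applied to the projections returns itself, so a
  fragment is recovered from its own coding. As to \<open>LOC\<close>, the d-LOC closure of a
  relational clone consists of the relations invariant under the d-ary polymorphisms, so two such
  closures agree iff these polymorphisms do.\<close>

fun fill :: "'b option list \<Rightarrow> 'b list \<Rightarrow> 'b list" where
  "fill [] ys = []"
| "fill (Some c # ps) ys = c # fill ps ys"
| "fill (None # ps) ys = hd ys # fill ps (tl ys)"

abbreviation holes :: "'b option list \<Rightarrow> nat" where
  "holes ps \<equiv> count_list ps None"

definition patterns :: "'b set \<Rightarrow> nat \<Rightarrow> 'b option list set" where
  "patterns B n = {ps. length ps = n \<and> (\<forall>c. Some c \<in> set ps \<longrightarrow> c \<in> B)}"

lemma length_fill [simp]: "length (fill ps ys) = length ps"
  by (induction ps ys rule: fill.induct) auto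

lemma fill_append: "fill (ps @ qs) ys = fill ps ys @ fill qs (drop (holes ps) ys)"
  by (induction ps ys rule: fill.induct) (auto simp: drop_Suc)

text \<open>Surplus arguments are never read; they model the fictitious variables at the end of a
  translation.\<close>

lemma fill_append_args: "holes ps \<le> length ys \<Longrightarrow> fill ps (ys @ zs) = fill ps ys"
proof (induction ps ys rule: fill.induct)
  case (3 ps ys)
  then show ?case by (cases ys) auto
qed auto

lemma fill_take: "holes ps \<le> length ys \<Longrightarrow> fill ps (take (holes ps) ys @ zs) = fill ps ys"
  using fill_append_args[of ps "take (holes ps) ys" zs]
    fill_append_args[of ps "take (holes ps) ys" "drop (holes ps) ys"] by simp

lemma fill_replicate_None: "fill (replicate n None) ys = take n ys" if "n \<le> length ys"
  using that
proof (induction n arbitrary: ys)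
  case (Suc n)
  then show ?case by (cases ys) auto
qed auto

lemma holes_full_iff: "holes ps = length ps \<longleftrightarrow> (\<forall>p\<in>set ps. p = None)"
proof (induction ps)
  case (Cons p ps)
  then show ?case using count_le_length[of ps None] by auto
qed simp

lemma holes_full: "holes ps = length ps \<Longrightarrow> ps = replicate (length ps) None"
  by (simp add: holes_full_iff replicate_length_same)

lemma holes_replicate: "holes (replicate n None) = n"
  by (induction n) auto

lemma fill_in_tuples:
  assumes "ps \<in> patterns B n" "set ys \<subseteq> B" "holes ps \<le> length ys"
  shows "fill ps ys \<in> tuples B n"
proof -
  have "set (fill ps ys) \<subseteq> B" 
    using assms unfolding patterns_def mem_Collect_eq
  proof (induction ps ys arbitrary: n rule: fill.induct)
    case (3 ps ys)
    then show ?case by (cases ys) auto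
  qed auto
  then show ?thesis using assms(1) by (auto simp: tuples_def patterns_def)
qed

lemma holes_split:
  "k < holes ps \<Longrightarrow> \<exists>as bs. ps = as @ None # bs \<and> holes as = k"
proof (induction ps arbitrary: k)
  case (Cons p ps)
  show ?case
  proof (cases "p = None")
    case True
    show ?thesis
    proof (cases k)
      case 0
      then show ?thesis using True by (intro exI[of _ "[]"] exI[of _ ps]) auto
    next
      case (Suc k')
      then obtain as bs where "ps = as @ None # bs" "holes as = k'"
        using Cons True by fastforce
      then show ?thesis using True Suc by (intro exI[of _ "p # as"] exI[of _ bs]) auto
    qed
  next
    case False
    then obtain as bs where "ps = as @ None # bs" "holes as = k"
      using Cons by fastforce
    then show ?thesis using False by (intro exI[of _ "p # as"] exI[of _ bs]) auto
  qed
qed simp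

text \<open>This exchange links \<open>ebtrl\<close>, which inserts constants among the arguments,
  with patterns, which carry constants as entries.\<close>

lemma fill_hole:
  assumes "holes as \<le> length ys"
  shows "fill (as @ None # bs) (take (holes as) ys @ c # drop (holes as) ys) = fill (as @ Some c # bs) ys"
  using assms by (simp add: fill_append fill_take)

lemma patterns_hole:
  "as @ None # bs \<in> patterns B n \<Longrightarrow> c \<in> B \<Longrightarrow> as @ Some c # bs \<in> patterns B n"
  by (auto simp: patterns_def)

lemma fill_nth_Some: "i < length ps \<Longrightarrow> ps ! i = Some c \<Longrightarrow> fill ps ys ! i = c"
proof (induction ps ys arbitrary: i rule: fill.induct)
  case (2 c ps ys)
  then show ?case by (cases i) auto
next
  case (3 ps ys)
  then show ?case by (cases i) auto
qed auto

text \<open>The strict inequality later provides the condition \<open>i < j\<close> in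
  \<open>Delta\<close>.\<close>

lemma fill_nth_None:
  "i < length ps \<Longrightarrow> ps ! i = None \<Longrightarrow> holes ps \<le> length ys \<Longrightarrow> fill ps ys ! i = ys ! holes (take i ps)
    \<and> holes (take i ps) < holes ps"
proof (induction ps ys arbitrary: i rule: fill.induct)
  case (2 c ps ys)
  then show ?case by (cases i) auto
next
  case (3 ps ys)
  then show ?case by (cases i; cases ys) auto
qed auto

section \<open>Internal reflexivity and translations of members\<close>

lemma tuples_insert: "xs \<in> tuples B d \<Longrightarrow> c \<in> B \<Longrightarrow> take i xs @ c # drop i xs \<in> tuples B (Suc d)"
  by (auto simp: tuples_def dest: in_set_takeD in_set_dropD)

lemma tuples_tl: "xs \<in> tuples B (Suc d) \<Longrightarrow> tl xs \<in> tuples B d"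
  by (cases xs) (auto simp: tuples_def)

lemma tuples_butlast: "xs \<in> tuples B (Suc d) \<Longrightarrow> butlast xs \<in> tuples B d"
  by (auto simp: tuples_def dest: in_set_butlastD)

lemma ebtrlI:
  "i \<le> n \<Longrightarrow> c \<in> B \<Longrightarrow> (\<lambda>xs\<in>tuples B n. h (take i xs @ [c] @ drop i xs)) \<in> ebtrl B n h"
  unfolding ebtrl_def by blast

lemma DeltaI:
  "i < j \<Longrightarrow> j \<le> d \<Longrightarrow> (\<lambda>xs\<in>tuples B d. h (take j xs @ [xs ! i] @ drop j xs)) \<in> Delta B d h"
  unfolding Delta_def by blast

text \<open>A pattern turns a function of \<open>n\<close> arguments into one of its translations; dropping \<open>u\<close> arguments
  accounts for the fictitious variables in front.\<close>

definition translate :: "'b set \<Rightarrow> nat \<Rightarrow> 'b option list \<Rightarrow> nat \<Rightarrow> ('b list \<Rightarrow> 'v) \<Rightarrow> 'b list \<Rightarrow> 'v" where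
  "translate B d ps u H = (\<lambda>xs\<in>tuples B d. H (fill ps (drop u xs)))"

text \<open>One constant enters and one variable is lost. With \<open>butlast\<close> the last
  variable becomes fictitious (for \<open>i < d\<close>), with \<open>tl\<close> the first one (for
  \<open>i > 0\<close>); at the extreme positions \<open>g\<close> itself comes back.\<close>

lemma simple_int_reflexiveD:
  assumes "simple_int_reflexive V B d \<rho>" "g \<in> \<rho>" "i \<le> d" "c \<in> B"
  shows "(\<lambda>xs\<in>tuples B d. g (tl (take i xs @ c # drop i xs))) \<in> \<rho>"
    and "(\<lambda>xs\<in>tuples B d. g (butlast (take i xs @ c # drop i xs))) \<in> \<rho>"
proof -
  have ft: "\<And>h. h \<in> eftrl B d g \<Longrightarrow> ebtrl B d h \<subseteq> \<rho>"
    using assms(1,2) by (auto simp: simple_int_reflexive_def circledast_def)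
  have "(\<lambda>xs\<in>tuples B d. (\<lambda>xs\<in>tuples B (Suc d). g (tl xs)) (take i xs @ [c] @ drop i xs)) \<in> \<rho>"
    by (rule subsetD[OF ft ebtrlI]) (use assms(3,4) in \<open>auto simp: eftrl_def\<close>)
  then show "(\<lambda>xs\<in>tuples B d. g (tl (take i xs @ c # drop i xs))) \<in> \<rho>"
    using assms(4) by (simp add: tuples_insert cong: restrict_cong)
  have "(\<lambda>xs\<in>tuples B d. (\<lambda>xs\<in>tuples B (Suc d). g (butlast xs)) (take i xs @ [c] @ drop i xs)) \<in> \<rho>"
    by (rule subsetD[OF ft ebtrlI]) (use assms(3,4) in \<open>auto simp: eftrl_def\<close>)
  then show "(\<lambda>xs\<in>tuples B d. g (butlast (take i xs @ c # drop i xs))) \<in> \<rho>"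
    using assms(4) by (simp add: tuples_insert cong: restrict_cong)
qed

lemma fill_butlast:
  assumes "z \<in> tuples B (Suc d)" "u + holes ps \<le> d"
  shows "fill ps (drop u z) = fill ps (drop u (butlast z))"
proof (cases z rule: rev_cases)
  case (snoc ys y)
  then show ?thesis using assms fill_append_args[of ps "drop u ys" "[y]"] by (simp add: tuples_def)
qed (use assms in \<open>simp add: tuples_def\<close>)

text \<open>The variable replaced by a constant reappears as a fictitious one, at the end or in front.\<close>

lemma translate_hole:
  assumes "simple_int_reflexive V B d \<rho>" "c \<in> B" and le: "u + holes (as @ None # bs) \<le> d"
    and mem: "translate B d (as @ None # bs) u g \<in> \<rho>"
    and pat: "as @ None # bs \<in> patterns B d"
  shows "translate B d (as @ Some c # bs) u g \<in> \<rho>" "translate B d (as @ Some c # bs) (Suc u) g \<in> \<rho>"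
proof -
  let ?i = "u + holes as"
  have i: "?i \<le> d" "Suc ?i \<le> d" using le by auto
  have "translate B d (as @ None # bs) u g (butlast (take ?i xs @ c # drop ?i xs))
      = g (fill (as @ Some c # bs) (drop u xs))" if xs: "xs \<in> tuples B d" for xs
  proof -
    have len: "length xs = d" using xs by (simp add: tuples_def)
    have 1: "take ?i xs @ c # drop ?i xs \<in> tuples B (Suc d)"
      using xs assms(2) by (rule tuples_insert)
    then have 2: "butlast (take ?i xs @ c # drop ?i xs) \<in> tuples B d"
      by (rule tuples_butlast)
    have "drop u (take ?i xs @ c # drop ?i xs) = take (holes as) (drop u xs) @ c # drop (holes as) (drop u xs)"
      using i len by (simp add: drop_take add.commute)
    then have 3: "fill (as @ None # bs) (drop u (take ?i xs @ c # drop ?i xs))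
        = fill (as @ Some c # bs) (drop u xs)"
      using i len fill_hole[of as "drop u xs" bs c] by (simp del: drop_append)
    have "fill (as @ None # bs) (drop u (take ?i xs @ c # drop ?i xs))
        = fill (as @ None # bs) (drop u (butlast (take ?i xs @ c # drop ?i xs)))"
      by (rule fill_butlast[OF 1 le])
    then have "translate B d (as @ None # bs) u g (butlast (take ?i xs @ c # drop ?i xs))
        = g (fill (as @ None # bs) (drop u (take ?i xs @ c # drop ?i xs)))"
      using 2 by (simp only: translate_def restrict_apply if_True)
    then show ?thesis by (simp only: 3)
  qed
  then show "translate B d (as @ Some c # bs) u g \<in> \<rho>"
    using simple_int_reflexiveD(2)[OF assms(1) mem i(1) assms(2)]
    by (simp add: translate_def[of B d "as @ Some c # bs"] cong: restrict_cong)
  \<comment> \<open>The constant goes one place further right than before: \<open>tl\<close> shifts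
    all positions down by one, and losing the first argument raises \<open>u\<close> to
    \<open>Suc u\<close>.\<close>
  have "translate B d (as @ None # bs) u g (tl (take (Suc ?i) xs @ c # drop (Suc ?i) xs))
      = g (fill (as @ Some c # bs) (drop (Suc u) xs))" if xs: "xs \<in> tuples B d" for xs
  proof -
    have len: "length xs = d" using xs by (simp add: tuples_def)
    have 1: "take (Suc ?i) xs @ c # drop (Suc ?i) xs \<in> tuples B (Suc d)"
      using xs assms(2) by (rule tuples_insert)
    then have 2: "tl (take (Suc ?i) xs @ c # drop (Suc ?i) xs) \<in> tuples B d"
      by (rule tuples_tl)
    have "drop (Suc u) (take (Suc ?i) xs @ c # drop (Suc ?i) xs)
        = take (holes as) (drop (Suc u) xs) @ c # drop (holes as) (drop (Suc u) xs)"
      using i len by (simp add: drop_take add.commute)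
    then have 3: "fill (as @ None # bs) (drop (Suc u) (take (Suc ?i) xs @ c # drop (Suc ?i) xs))
        = fill (as @ Some c # bs) (drop (Suc u) xs)"
      using i len fill_hole[of as "drop (Suc u) xs" bs c] by (simp del: drop_append)
    have "drop u (tl zs) = drop (Suc u) zs" for zs :: "'b list"
      by (simp only: drop_Suc)
    then have "translate B d (as @ None # bs) u g (tl (take (Suc ?i) xs @ c # drop (Suc ?i) xs))
        = g (fill (as @ None # bs) (drop (Suc u) (take (Suc ?i) xs @ c # drop (Suc ?i) xs)))"
      using 2 by (simp only: translate_def restrict_apply if_True)
    then show ?thesis by (simp only: 3)
  qed
  then show "translate B d (as @ Some c # bs) (Suc u) g \<in> \<rho>"
    using simple_int_reflexiveD(1)[OF assms(1) mem i(2) assms(2)]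
    by (simp add: translate_def[of B d "as @ Some c # bs"] cong: restrict_cong)
qed

text \<open>Induction on the number of constants in the pattern, which is
  \<open>d - holes ps\<close>. Reopening one constant to a hole gives a translation covered by the
  induction hypothesis, and \<open>translate_hole\<close> puts the constant back; the freed variable
  is used up in front if \<open>u > 0\<close>, at the end otherwise. Without constants the
  translation is \<open>g\<close> itself.\<close>

lemma translate_mem:
  assumes refl: "simple_int_reflexive V B d \<rho>" and \<rho>: "\<rho> \<subseteq> tuples B d \<rightarrow>\<^sub>E V" and g: "g \<in> \<rho>"
  shows "ps \<in> patterns B d \<Longrightarrow> u + holes ps \<le> d \<Longrightarrow> translate B d ps u g \<in> \<rho>"
proof (induction "d - holes ps" arbitrary: ps u)
  case 0
  then have len: "length ps = d" "u = 0" and h: "holes ps = length ps"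
    by (auto simp: patterns_def)
  have "ps = replicate d None"
    using h len(1) holes_full by metis
  then have "translate B d ps u g = restrict g (tuples B d)"
    using len(2) unfolding translate_def
    by (intro restrict_ext) (auto simp: fill_replicate_None tuples_def)
  then have "translate B d ps u g = g"
    using g \<rho> by (auto simp: PiE_def extensional_restrict)
  then show ?case using g by simp
next
  case (Suc k)
  then have "holes ps < length ps" by (auto simp: patterns_def)
  then have "\<exists>c. Some c \<in> set ps"
    by (metis holes_full_iff less_irrefl option.exhaust)
  then obtain c as bs where ps: "ps = as @ Some c # bs" by (metis in_set_conv_decomp)
  let ?ps = "as @ None # bs"
  have c: "c \<in> B" and pat: "?ps \<in> patterns B d" using Suc.prems(1) ps by (auto simp: patterns_def)
  have holes: "holes ?ps = Suc (holes ps)" using ps by simp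
  show ?case
  proof (cases u)
    case 0
    have le: "0 + holes ?ps \<le> d" using Suc holes by simp
    have "translate B d ?ps 0 g \<in> \<rho>"
      by (rule Suc.hyps(1)) (use Suc.hyps(2) holes le pat in auto)
    then show ?thesis using translate_hole(1)[OF refl c le _ pat] ps 0 by simp
  next
    case (Suc v)
    have le: "v + holes ?ps \<le> d" using Suc Suc.prems holes by simp
    have "translate B d ?ps v g \<in> \<rho>"
      by (rule Suc.hyps(1)) (use Suc.hyps(2) holes le pat in auto)
    then show ?thesis using translate_hole(2)[OF refl c le _ pat] ps Suc by simp
  qed
qed

section \<open>Transitivity and the identification of variables\<close>

definition all_translations_in :: "'b set \<Rightarrow> nat \<Rightarrow> ('b list \<Rightarrow> 'v) set \<Rightarrow> nat \<Rightarrow> ('b list \<Rightarrow> 'v) \<Rightarrow> bool" where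
  "all_translations_in B d \<rho> N H \<longleftrightarrow>
     (\<forall>ps\<in>patterns B N. \<forall>u. u + holes ps \<le> d \<longrightarrow> translate B d ps u H \<in> \<rho>)"

text \<open>A translation of the identified function may need \<open>d + 1\<close> variables of
  \<open>H\<close>, one more than the hypothesis covers. But it is enough to control the function
  \<open>h\<close> of \<open>d + 1\<close> variables after one further constant has been
  substituted, for this places \<open>h\<close> in \<open>circledast\<close>, and transitivity does
  the rest.\<close>

lemma all_translations_identify:
  assumes trans: "simple_transitive V B d \<rho>" and good: "all_translations_in B d \<rho> (Suc N) H" and i: "i < N"
    and H: "H \<in> tuples B (Suc N) \<rightarrow> V"
  shows "all_translations_in B d \<rho> N (\<lambda>xs. H (xs @ [xs ! i]))"
  unfolding all_translations_in_def
proof (intro ballI allI impI)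
  fix ps u assume pat: "ps \<in> patterns B N" and le: "u + holes ps \<le> d"
  have len: "length ps = N" using pat by (simp add: patterns_def)
  show "translate B d ps u (\<lambda>xs. H (xs @ [xs ! i])) \<in> \<rho>"
  proof (cases "ps ! i")
    \<comment> \<open>Variable \<open>i\<close> has been replaced by \<open>c\<close>, so the last
      variable, identified with it, receives the same constant and no transitivity is
      required.\<close>
    case (Some c)
    let ?ps = "ps @ [Some c]"
    have "c \<in> B" using Some pat i len by (metis (mono_tags, lifting) patterns_def mem_Collect_eq nth_mem)
    then have "?ps \<in> patterns B (Suc N)" using pat by (auto simp: patterns_def)
    then have "translate B d ?ps u H \<in> \<rho>" using good le by (auto simp: all_translations_in_def)
    moreover have "translate B d ?ps u H = translate B d ps u (\<lambda>xs. H (xs @ [xs ! i]))"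
      using Some i len by (simp add: translate_def fill_append fill_nth_Some cong: restrict_cong)
    ultimately show ?thesis by simp
  next
    case None
    let ?ps = "ps @ [None]"
    have pat': "?ps \<in> patterns B (Suc N)" using pat by (auto simp: patterns_def)
    \<comment> \<open>The last variable of \<open>H\<close> is kept as well; a member of \<open>\<Delta>(h)\<close> then performs the identification.\<close>
    define h where "h = (\<lambda>xs\<in>tuples B (Suc d). H (fill ?ps (drop u xs)))"
    have tr: "translate B d qs v H \<in> \<rho>" if "qs \<in> patterns B (Suc N)" "v + holes qs \<le> d" for qs v
      using good that by (auto simp: all_translations_in_def)
    have "(\<lambda>xs\<in>tuples B d. h (take k xs @ [c] @ drop k xs)) \<in> \<rho>" if "k \<le> d" "c \<in> B" for k c
    proof -
      have eq: "(\<lambda>xs\<in>tuples B d. h (take k xs @ [c] @ drop k xs)) =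
          (\<lambda>xs\<in>tuples B d. H (fill ?ps (drop u (take k xs @ c # drop k xs))))"
        using that by (simp add: h_def tuples_insert cong: restrict_cong)
      \<comment> \<open>A constant put at place \<open>k\<close> uses up a fictitious variable in
        front, fills one of the \<open>holes ps + 1\<close> holes, or uses up a fictitious variable
        at the end. In each case what remains is a translation to \<open>d\<close>
        variables.\<close>
      consider "k < u" | "u \<le> k" "k - u \<le> holes ps" | "u + holes ps < k" by linarith
      then show ?thesis
      proof cases
        case 1
        then obtain v where "u = Suc (k + v)" using less_imp_Suc_add by blast
        then have "drop u (take k xs @ c # drop k xs) = drop (u - 1) xs" if "xs \<in> tuples B d" for xs
          using that \<open>k \<le> d\<close> by (auto simp: tuples_def add.commute)
        then have "(\<lambda>xs\<in>tuples B d. h (take k xs @ [c] @ drop k xs)) = translate B d ?ps (u - 1) H"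
          unfolding eq translate_def by (simp cong: restrict_cong)
        then show ?thesis using tr[OF pat', of "u - 1"] 1 le by simp
      next
        case 2
        then obtain as bs where ab: "?ps = as @ None # bs" "holes as = k - u"
          using holes_split[of "k - u" ?ps] by auto
        let ?qs = "as @ Some c # bs"
        have "fill ?ps (drop u (take k xs @ c # drop k xs)) = fill ?qs (drop u xs)" if "xs \<in> tuples B d" for xs
        proof -
          have "drop u (take k xs @ c # drop k xs) = take (holes as) (drop u xs) @ c # drop (holes as) (drop u xs)"
            using that \<open>k \<le> d\<close> 2 ab(2) by (simp add: tuples_def drop_take)
          then show ?thesis
            using fill_hole[of as "drop u xs" bs c] that \<open>k \<le> d\<close> 2 ab by (simp add: tuples_def)
        qed
        then have "(\<lambda>xs\<in>tuples B d. h (take k xs @ [c] @ drop k xs)) = translate B d ?qs u H"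
          unfolding eq translate_def by (simp cong: restrict_cong)
        moreover have "holes ?qs = holes ps" using arg_cong[OF ab(1), of holes] by simp
        ultimately show ?thesis using tr[of ?qs u] patterns_hole[of as bs B "Suc N" c] pat' ab(1) le that(2) by simp
      next
        case 3
        have "fill ?ps (drop u (take k xs @ c # drop k xs)) = fill ?ps (drop u xs)" if "xs \<in> tuples B d" for xs
        proof -
          have "fill ?ps (drop u (take k xs) @ zs) = fill ?ps (drop u (take k xs))" for zs
            by (rule fill_append_args) (use 3 that \<open>k \<le> d\<close> in \<open>auto simp: tuples_def\<close>)
          moreover have "drop u xs = drop u (take k xs) @ drop k xs"
            using drop_append[of u "take k xs" "drop k xs"] 3 that \<open>k \<le> d\<close> by (simp add: tuples_def)
          ultimately show ?thesis using 3 that \<open>k \<le> d\<close> by (simp add: tuples_def)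
        qed
        then have "(\<lambda>xs\<in>tuples B d. h (take k xs @ [c] @ drop k xs)) = translate B d ?ps u H"
          unfolding eq translate_def by (simp cong: restrict_cong)
        then show ?thesis using tr[OF pat', of u] 3 \<open>k \<le> d\<close> by simp
      qed
    qed
    then have "ebtrl B d h \<subseteq> \<rho>" by (auto simp: ebtrl_def)
    moreover have "h \<in> tuples B (Suc d) \<rightarrow>\<^sub>E V"
    proof -
      have "fill ?ps (drop u xs) \<in> tuples B (Suc N)" if "xs \<in> tuples B (Suc d)" for xs
        by (rule fill_in_tuples[OF pat']) (use that le in \<open>auto simp: tuples_def dest: in_set_dropD\<close>)
      then show ?thesis using H by (auto simp: h_def)
    qed
    ultimately have h: "h \<in> circledast V B d \<rho>" by (simp add: circledast_def)
    \<comment> \<open>\<open>?i\<close> is the argument that feeds entry \<open>i\<close> of the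
      pattern, \<open>?j\<close> the one that feeds the appended last hole.\<close>
    let ?i = "u + holes (take i ps)" and ?j = "u + holes ps"
    have ij: "?i < ?j" using fill_nth_None[of i ps "replicate (holes ps) undefined"] i len None by simp
    have "(\<lambda>xs\<in>tuples B d. h (take ?j xs @ [xs ! ?i] @ drop ?j xs)) \<in> Delta B d h"
      by (rule DeltaI[OF ij]) (use le in simp)
    then have "(\<lambda>xs\<in>tuples B d. h (take ?j xs @ [xs ! ?i] @ drop ?j xs)) \<in> \<rho>"
      using trans h by (auto simp: simple_transitive_def)
    moreover have "h (take ?j xs @ [xs ! ?i] @ drop ?j xs)
        = H (fill ps (drop u xs) @ [fill ps (drop u xs) ! i])" if xs: "xs \<in> tuples B d" for xs
    proof -
      have lx: "length xs = d" "set xs \<subseteq> B" using xs by (auto simp: tuples_def)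
      then have "xs ! ?i \<in> B" using ij le by (simp add: subset_iff)
      then have 1: "take ?j xs @ [xs ! ?i] @ drop ?j xs \<in> tuples B (Suc d)"
        using tuples_insert[OF xs] by simp
      have 2: "drop u (take ?j xs @ [xs ! ?i] @ drop ?j xs)
          = take (holes ps) (drop u xs) @ [xs ! ?i] @ drop ?j xs"
        using lx le by (simp add: drop_take)
      have 3: "fill ps (take (holes ps) (drop u xs) @ zs) = fill ps (drop u xs)" for zs
        by (rule fill_take) (use le lx in simp)
      have 4: "xs ! ?i = fill ps (drop u xs) ! i"
        using fill_nth_None[of i ps "drop u xs"] i len None le lx by simp
      show ?thesis unfolding h_def using 1 2 3 4 le lx by (simp add: fill_append)
    qed
    ultimately show ?thesis by (simp add: translate_def cong: restrict_cong)
  qed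
qed

text \<open>Variables are removed from the end of the list, since only the last variable can be
  identified. All targets are among the first \<open>d\<close> variables, which are never
  removed.\<close>

lemma all_translations_identify_list:
  assumes trans: "simple_transitive V B d \<rho>"
  shows "all_translations_in B d \<rho> (d + length is) H \<Longrightarrow> H \<in> tuples B (d + length is) \<rightarrow> V \<Longrightarrow> set is \<subseteq> {..<d}
    \<Longrightarrow> all_translations_in B d \<rho> d (\<lambda>xs. H (xs @ map (nth xs) is))"
proof (induction "is" arbitrary: H rule: rev_induct)
  case (snoc i "is")
  let ?H = "\<lambda>xs. H (xs @ [xs ! i])"
  have "all_translations_in B d \<rho> (d + length is) ?H"
    using snoc.prems by (intro all_translations_identify[OF trans]) auto
  moreover have "?H \<in> tuples B (d + length is) \<rightarrow> V"
    using snoc.prems by (auto simp: tuples_def Pi_iff subset_iff)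
  ultimately have *: "all_translations_in B d \<rho> d (\<lambda>xs. ?H (xs @ map (nth xs) is))"
    using snoc.prems by (intro snoc.IH) auto
  have "translate B d ps u (\<lambda>xs. H (xs @ map (nth xs) (is @ [i]))) = translate B d ps u (\<lambda>xs. ?H (xs @ map (nth xs) is))"
    if "ps \<in> patterns B d" for ps u
    using that snoc.prems(3) by (simp add: translate_def patterns_def nth_append cong: restrict_cong)
  then show ?case using * by (simp add: all_translations_in_def)
qed simp

section \<open>Functions with separate blocks of variables\<close>

primrec eval_blocks :: "nat \<Rightarrow> ('b list \<Rightarrow> 'v) list \<Rightarrow> 'b list \<Rightarrow> 'v list" where
  "eval_blocks d [] xs = []"
| "eval_blocks d (g # gs) xs = g (take d xs) # eval_blocks d gs (drop d xs)"

definition nonconstant :: "'b set \<Rightarrow> nat \<Rightarrow> ('b list \<Rightarrow> 'v) \<Rightarrow> bool" where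
  "nonconstant B d g \<longleftrightarrow> (\<exists>xs\<in>tuples B d. \<exists>ys\<in>tuples B d. g xs \<noteq> g ys)"

text \<open>Keeps track of the fact that only arguments have been changed. When \<open>g\<close> is
  a curried function, this guarantees that no dependence on the other coordinates arises.\<close>

definition reparametrized :: "'b set \<Rightarrow> nat \<Rightarrow> ('b list \<Rightarrow> 'v) \<Rightarrow> ('b list \<Rightarrow> 'v) \<Rightarrow> bool" where
  "reparametrized B d g g' \<longleftrightarrow>
     (\<exists>\<sigma>\<in>tuples B d \<rightarrow> tuples B d. g' = (\<lambda>xs\<in>tuples B d. g (\<sigma> xs)))"

lemma translate_reparametrized:
  assumes "ps \<in> patterns B d" "u + holes ps \<le> d"
  shows "reparametrized B d g (translate B d ps u g)"
proof -
  have "fill ps (drop u xs) \<in> tuples B d" if "xs \<in> tuples B d" for xs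
    by (rule fill_in_tuples[OF assms(1)]) (use that assms(2) in \<open>auto simp: tuples_def dest: in_set_dropD\<close>)
  then show ?thesis unfolding reparametrized_def translate_def
    by (intro bexI[of _ "\<lambda>xs. fill ps (drop u xs)"]) auto
qed

lemma nonconstant_translate:
  assumes "nonconstant B d (translate B d ps u g)"
  shows "1 \<le> holes ps"
proof (rule ccontr)
  assume "\<not> 1 \<le> holes ps"
  then have "translate B d ps u g xs = g (fill ps [])" if "xs \<in> tuples B d" for xs
    using that fill_append_args[of ps "[]" "drop u xs"] by (simp add: translate_def)
  then show False using assms by (auto simp: nonconstant_def)
qed

text \<open>Cutting the pattern into blocks of length \<open>d\<close> distributes its holes among
  the functions. A function whose block has no hole becomes constant, so the nonconstant ones number
  at most \<open>holes ps\<close>. The arguments read by earlier blocks act as fictitious variables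
  in front, whence the growing offset \<open>u + holes qs\<close>.\<close>

lemma eval_blocks_fill:
  assumes refl: "simple_int_reflexive V B d \<rho>" and \<rho>: "\<rho> \<subseteq> tuples B d \<rightarrow>\<^sub>E V"
  shows "set gs \<subseteq> \<rho> \<Longrightarrow> ps \<in> patterns B (length gs * d) \<Longrightarrow> u + holes ps \<le> d \<Longrightarrow>
    \<exists>gs'. list_all2 (reparametrized B d) gs gs' \<and> set gs' \<subseteq> \<rho>
      \<and> length (filter (nonconstant B d) gs') \<le> holes ps
      \<and> (\<forall>xs\<in>tuples B d. eval_blocks d gs (fill ps (drop u xs)) = map (\<lambda>g. g xs) gs')"
proof (induction gs arbitrary: ps u)
  case (Cons g gs)
  define qs rs where "qs = take d ps" and "rs = drop d ps"
  have ps: "ps = qs @ rs" by (simp add: qs_def rs_def)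
  have qs: "qs \<in> patterns B d" and rs: "rs \<in> patterns B (length gs * d)"
    using Cons.prems(2) by (auto simp: qs_def rs_def patterns_def dest: in_set_takeD in_set_dropD)
  have holes: "holes ps = holes qs + holes rs" using ps by simp
  obtain gs' where gs': "list_all2 (reparametrized B d) gs gs'" "set gs' \<subseteq> \<rho>"
      "length (filter (nonconstant B d) gs') \<le> holes rs"
      "\<forall>xs\<in>tuples B d. eval_blocks d gs (fill rs (drop (u + holes qs) xs)) = map (\<lambda>g. g xs) gs'"
    using Cons.IH[of rs "u + holes qs"] Cons.prems rs holes by auto
  let ?g = "translate B d qs u g"
  have u: "u + holes qs \<le> d" using Cons.prems(3) holes by simp
  have "reparametrized B d g ?g" using translate_reparametrized qs u by blast
  moreover have "?g \<in> \<rho>" using translate_mem[OF refl \<rho> _ qs u] Cons.prems by simp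
  moreover have "length (filter (nonconstant B d) (?g # gs')) \<le> holes ps"
    using nonconstant_translate[of B d qs u g] gs'(3) holes by auto
  moreover have "eval_blocks d (g # gs) (fill ps (drop u xs)) = map (\<lambda>g. g xs) (?g # gs')"
    if "xs \<in> tuples B d" for xs
    using that gs'(4) qs by (simp add: ps fill_append translate_def patterns_def add.commute)
  ultimately show ?case using gs' by (intro exI[of _ "?g # gs'"]) auto
qed auto

lemma eval_blocks_replicate:
  "length xs = d \<Longrightarrow> eval_blocks d gs (concat (replicate (length gs) xs)) = map (\<lambda>g. g xs) gs"
  by (induction gs) auto

lemma eval_blocks_mem:
  "set gs \<subseteq> tuples B d \<rightarrow> V \<Longrightarrow> xs \<in> tuples B (length gs * d) \<Longrightarrow> 
    set (eval_blocks d gs xs) \<subseteq> V \<and> length (eval_blocks d gs xs) = length gs"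
proof (induction gs arbitrary: xs)
  case (Cons g gs)
  then have "take d xs \<in> tuples B d" "drop d xs \<in> tuples B (length gs * d)"
    by (auto simp: tuples_def dest: in_set_takeD in_set_dropD)
  then show ?case using Cons by auto
qed simp

text \<open>\<open>\<Phi>\<close> stands for \<open>f\<close> acting on values in \<open>V\<close>,
  which will be functions of the other coordinates. The hypothesis \<open>step\<close> is left
  abstract because those coordinates must be treated before a translation of \<open>f\<close> can be
  applied.\<close>

lemma simple_preserved:
  assumes refl: "simple_int_reflexive V B d \<rho>" and trans: "simple_transitive V B d \<rho>"
    and \<rho>: "\<rho> \<subseteq> tuples B d \<rightarrow>\<^sub>E V" and gs: "set gs \<subseteq> \<rho>" "gs \<noteq> []"
    and \<Phi>: "\<And>vs. set vs \<subseteq> V \<Longrightarrow> length vs = length gs \<Longrightarrow> \<Phi> vs \<in> V"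
    and step: "\<And>gs'. list_all2 (reparametrized B d) gs gs' \<Longrightarrow> set gs' \<subseteq> \<rho> \<Longrightarrow>
      length (filter (nonconstant B d) gs') \<le> d \<Longrightarrow> (\<lambda>xs\<in>tuples B d. \<Phi> (map (\<lambda>g. g xs) gs')) \<in> \<rho>"
  shows "(\<lambda>xs\<in>tuples B d. \<Phi> (map (\<lambda>g. g xs) gs)) \<in> \<rho>"
proof -
  define H where "H = (\<lambda>xs. \<Phi> (eval_blocks d gs xs))"
  \<comment> \<open>The first block supplies the \<open>d\<close> variables that remain; each later
    block is identified with it variable by variable.\<close>
  define "is" where "is = concat (replicate (length gs - 1) [0..<d])"
  have N: "d + length is = length gs * d"
    using gs(2) by (cases gs) (simp_all add: is_def length_concat sum_list_replicate)
  have "set gs \<subseteq> tuples B d \<rightarrow> V" using gs \<rho> by (auto simp: PiE_def)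
  then have H: "H \<in> tuples B (d + length is) \<rightarrow> V"
    unfolding H_def N using eval_blocks_mem[of gs B d V] \<Phi> by blast
  have "all_translations_in B d \<rho> (d + length is) H"
    unfolding all_translations_in_def N
  proof (intro ballI allI impI)
    fix ps u assume "ps \<in> patterns B (length gs * d)" "u + holes ps \<le> d"
    then obtain gs' where gs': "list_all2 (reparametrized B d) gs gs'" "set gs' \<subseteq> \<rho>"
      "length (filter (nonconstant B d) gs') \<le> holes ps"
      "\<forall>xs\<in>tuples B d. eval_blocks d gs (fill ps (drop u xs)) = map (\<lambda>g. g xs) gs'" and le: "holes ps \<le> d"
      using eval_blocks_fill[OF refl \<rho> gs(1)] by (meson add_leD2)
    then have "translate B d ps u H = (\<lambda>xs\<in>tuples B d. \<Phi> (map (\<lambda>g. g xs) gs'))"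
      by (simp add: translate_def H_def cong: restrict_cong)
    then show "translate B d ps u H \<in> \<rho>" using step gs' le by simp
  qed
  then have "all_translations_in B d \<rho> d (\<lambda>xs. H (xs @ map (nth xs) is))"
    by (rule all_translations_identify_list[OF trans _ H]) (auto simp: is_def)
  \<comment> \<open>The pattern consisting of \<open>d\<close> holes substitutes nothing, so the
    identified function itself belongs to \<rho>.\<close>
  then have "translate B d (replicate d None) 0 (\<lambda>xs. H (xs @ map (nth xs) is)) \<in> \<rho>"
    unfolding all_translations_in_def by (auto simp: patterns_def holes_replicate)
  moreover have "translate B d (replicate d None) 0 (\<lambda>xs. H (xs @ map (nth xs) is))
      = (\<lambda>xs\<in>tuples B d. \<Phi> (map (\<lambda>g. g xs) gs))"
    unfolding translate_def
  proof (rule restrict_ext)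
    fix xs assume "xs \<in> tuples B d"
    then have len: "length xs = d" by (simp add: tuples_def)
    then have "xs @ map (nth xs) is = concat (replicate (length gs) xs)"
      using gs(2) map_nth[of xs] by (cases gs) (auto simp: is_def map_concat)
    then show "H (fill (replicate d None) (drop 0 xs) @ map ((!) (fill (replicate d None) (drop 0 xs))) is)
        = \<Phi> (map (\<lambda>g. g xs) gs)"
      using eval_blocks_replicate[OF len, of gs] len by (simp add: fill_replicate_None H_def)
  qed
  ultimately show ?thesis by simp
qed

section \<open>R-relations with several coordinates\<close>

abbreviation coordinate :: "'b arity \<Rightarrow> nat \<Rightarrow> 'b list set" where
  "coordinate \<alpha> j \<equiv> tuples (fst (\<alpha> ! j)) (snd (\<alpha> ! j))"

lemma points_iff:
  "X \<in> points \<alpha> \<longleftrightarrow> length X = length \<alpha> \<and> (\<forall>j<length \<alpha>. X ! j \<in> coordinate \<alpha> j)"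
  by (auto simp: points_def list_all2_conv_all_nth case_prod_beta)

lemma points_update: "X \<in> points \<alpha> \<Longrightarrow> x \<in> coordinate \<alpha> j \<Longrightarrow> X[j := x] \<in> points \<alpha>"
  by (auto simp: points_iff) (metis nth_list_update_eq nth_list_update_neq)

lemma delete_at_in_points: "X \<in> points \<alpha> \<Longrightarrow> delete_at j X \<in> points (delete_at j \<alpha>)"
  unfolding points_def delete_at_def
  by (auto intro!: list_all2_appendI list_all2_takeI list_all2_dropI)

lemma insert_at_in_points:
  assumes "j < length \<alpha>" "x \<in> coordinate \<alpha> j" "Y \<in> points (delete_at j \<alpha>)"
  shows "insert_at j x Y \<in> points \<alpha>"
proof -
  let ?P = "\<lambda>x (B, n). x \<in> tuples B n"
  have Y: "list_all2 ?P Y (delete_at j \<alpha>)" using assms(3) by (simp add: points_def)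
  have "take j (delete_at j \<alpha>) = take j \<alpha>" "drop j (delete_at j \<alpha>) = drop (Suc j) \<alpha>"
    using assms(1) by (auto simp: delete_at_def)
  then have "list_all2 ?P (take j Y) (take j \<alpha>)" "list_all2 ?P (drop j Y) (drop (Suc j) \<alpha>)"
    using list_all2_takeI[OF Y, of j] list_all2_dropI[OF Y, of j] by simp_all
  then have "list_all2 ?P (take j Y @ [x] @ drop j Y) (take j \<alpha> @ [\<alpha> ! j] @ drop (Suc j) \<alpha>)"
    using assms(2) by (intro list_all2_appendI) (auto simp: case_prod_beta)
  then show ?thesis using assms(1) by (simp add: points_def insert_at_def id_take_nth_drop[symmetric])
qed

lemma insert_at_delete_at: "j < length X \<Longrightarrow> insert_at j x (delete_at j X) = X[j := x]"
  by (simp add: insert_at_def delete_at_def upd_conv_take_nth_drop)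

lemma curry_at_apply:
  assumes "j < length \<alpha>" "X \<in> points \<alpha>" "x \<in> coordinate \<alpha> j"
  shows "curry_at \<alpha> j g x (delete_at j X) = g (X[j := x])"
  using assms delete_at_in_points[OF assms(2)] insert_at_delete_at[of j X]
  by (simp add: curry_at_def points_iff)

lemma curry_at_nth:
  assumes "j < length \<alpha>" "X \<in> points \<alpha>"
  shows "curry_at \<alpha> j g (X ! j) (delete_at j X) = g X"
  using curry_at_apply[OF assms, of "X ! j"] assms by (simp add: points_iff)

text \<open>Allows membership in the curried relation to be pulled back to \<rho>.\<close>

lemma curry_at_inj:
  assumes "j < length \<alpha>" "g \<in> points \<alpha> \<rightarrow>\<^sub>E A" "g' \<in> points \<alpha> \<rightarrow>\<^sub>E A" "curry_at \<alpha> j g = curry_at \<alpha> j g'"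
  shows "g = g'"
  by (rule PiE_ext[OF assms(2,3)]) (metis curry_at_nth assms(1,4))

lemma curry_at_mem:
  assumes "j < length \<alpha>" "g \<in> points \<alpha> \<rightarrow>\<^sub>E A"
  shows "curry_at \<alpha> j g \<in> coordinate \<alpha> j \<rightarrow>\<^sub>E (points (delete_at j \<alpha>) \<rightarrow>\<^sub>E A)"
  using assms insert_at_in_points[of j \<alpha>] by (auto simp: curry_at_def)

definition pointwise :: "'b arity \<Rightarrow> ('a list \<Rightarrow> 'a) \<Rightarrow> ('b list list \<Rightarrow> 'a) list \<Rightarrow> 'b list list \<Rightarrow> 'a" where
  "pointwise \<alpha> f gs = (\<lambda>X\<in>points \<alpha>. f (map (\<lambda>g. g X) gs))"

lemma preserves_rrel_iff:
  "preserves_rrel (n, f) (\<alpha>, \<rho>) \<longleftrightarrow> (\<forall>gs. length gs = n \<and> set gs \<subseteq> \<rho> \<longrightarrow> pointwise \<alpha> f gs \<in> \<rho>)"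
  by (simp add: preserves_rrel_def pointwise_def)

lemma map_app_in_tuples:
  "set gs \<subseteq> S \<rightarrow>\<^sub>E A \<Longrightarrow> X \<in> S \<Longrightarrow> length gs = n \<Longrightarrow> map (\<lambda>g. g X) gs \<in> tuples A n"
  by (auto simp: tuples_def)

lemma pointwise_mem:
  "f \<in> ops A n \<Longrightarrow> length gs = n \<Longrightarrow> set gs \<subseteq> points \<alpha> \<rightarrow>\<^sub>E A \<Longrightarrow> pointwise \<alpha> f gs \<in> points \<alpha> \<rightarrow>\<^sub>E A"
  using map_app_in_tuples[of gs "points \<alpha>" A _ n] by (auto simp: pointwise_def ops_def)

section \<open>Reducing dependence one coordinate at a time\<close>

definition depends :: "'b arity \<Rightarrow> nat \<Rightarrow> ('b list list \<Rightarrow> 'a) \<Rightarrow> bool" where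
  "depends \<alpha> j g \<longleftrightarrow> (\<exists>X\<in>points \<alpha>. \<exists>x\<in>coordinate \<alpha> j. g (X[j := x]) \<noteq> g X)"

definition reparametrized_at :: "'b arity \<Rightarrow> nat \<Rightarrow> ('b list list \<Rightarrow> 'a) \<Rightarrow> ('b list list \<Rightarrow> 'a) \<Rightarrow> bool" where
  "reparametrized_at \<alpha> j g g' \<longleftrightarrow>
     (\<exists>\<sigma>\<in>coordinate \<alpha> j \<rightarrow> coordinate \<alpha> j. g' = (\<lambda>X\<in>points \<alpha>. g (X[j := \<sigma> (X ! j)])))"

lemma reparametrized_curry_at:
  assumes j: "j < length \<alpha>" and g': "g' \<in> points \<alpha> \<rightarrow>\<^sub>E A"
    and rep: "reparametrized (fst (\<alpha> ! j)) (snd (\<alpha> ! j)) (curry_at \<alpha> j g) (curry_at \<alpha> j g')"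
  shows "reparametrized_at \<alpha> j g g'"
proof -
  obtain \<sigma> where \<sigma>: "\<sigma> \<in> coordinate \<alpha> j \<rightarrow> coordinate \<alpha> j"
    "curry_at \<alpha> j g' = (\<lambda>x\<in>coordinate \<alpha> j. curry_at \<alpha> j g (\<sigma> x))"
    using rep by (auto simp: reparametrized_def)
  have "g' X = g (X[j := \<sigma> (X ! j)])" if X: "X \<in> points \<alpha>" for X
  proof -
    have x: "X ! j \<in> coordinate \<alpha> j" using X j by (simp add: points_iff)
    have "g' X = curry_at \<alpha> j g' (X ! j) (delete_at j X)" by (rule curry_at_nth[OF j X, symmetric])
    also have "\<dots> = curry_at \<alpha> j g (\<sigma> (X ! j)) (delete_at j X)" using \<sigma>(2) x by simp
    also have "\<dots> = g (X[j := \<sigma> (X ! j)])" using \<sigma>(1) x by (intro curry_at_apply j X) auto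
    finally show ?thesis .
  qed
  then have "g' = (\<lambda>X\<in>points \<alpha>. g (X[j := \<sigma> (X ! j)]))"
    using g' by (auto simp: fun_eq_iff restrict_def PiE_def extensional_def)
  then show ?thesis using \<sigma>(1) unfolding reparametrized_at_def by blast
qed

lemma nonconstant_curry_at:
  assumes "j < length \<alpha>" "depends \<alpha> j g"
  shows "nonconstant (fst (\<alpha> ! j)) (snd (\<alpha> ! j)) (curry_at \<alpha> j g)"
proof -
  obtain X x where X: "X \<in> points \<alpha>" and x: "x \<in> coordinate \<alpha> j" and ne: "g (X[j := x]) \<noteq> g X"
    using assms(2) by (auto simp: depends_def)
  have "curry_at \<alpha> j g x \<noteq> curry_at \<alpha> j g (X ! j)"
    using curry_at_apply[OF assms(1) X x, of g] curry_at_nth[OF assms(1) X, of g] ne by auto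
  moreover have "X ! j \<in> coordinate \<alpha> j" using X assms(1) by (simp add: points_iff)
  ultimately show ?thesis using x by (auto simp: nonconstant_def)
qed

text \<open>A change of entry \<open>j\<close> commutes with the reparametrization of entry
  \<open>k\<close>. Hence the bounds reached in coordinates treated earlier survive the treatment of
  coordinate \<open>k\<close>.\<close>

lemma depends_reparametrized_at:
  assumes "reparametrized_at \<alpha> k g g'" "depends \<alpha> j g'" "j \<noteq> k" "k < length \<alpha>"
  shows "depends \<alpha> j g"
proof -
  obtain \<sigma> where \<sigma>: "\<sigma> \<in> coordinate \<alpha> k \<rightarrow> coordinate \<alpha> k" "g' = (\<lambda>X\<in>points \<alpha>. g (X[k := \<sigma> (X ! k)]))"
    using assms(1) by (auto simp: reparametrized_at_def)
  obtain X x where X: "X \<in> points \<alpha>" and x: "x \<in> coordinate \<alpha> j" and ne: "g' (X[j := x]) \<noteq> g' X"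
    using assms(2) by (auto simp: depends_def)
  let ?X = "X[k := \<sigma> (X ! k)]"
  have "X ! k \<in> coordinate \<alpha> k" using X assms(4) by (simp add: points_iff)
  then have "?X \<in> points \<alpha>" using \<sigma>(1) X by (auto intro: points_update)
  moreover have "g (?X[j := x]) \<noteq> g ?X"
    using ne \<sigma>(2) X points_update[OF X x] assms(3) by (simp add: list_update_swap)
  ultimately show ?thesis using x by (auto simp: depends_def)
qed

lemma length_filter_list_all2:
  "list_all2 R xs ys \<Longrightarrow> (\<And>x y. R x y \<Longrightarrow> P y \<Longrightarrow> P x) \<Longrightarrow> length (filter P ys) \<le> length (filter P xs)"
  by (induction rule: list_all2_induct) auto

text \<open>This is \<open>simple_preserved\<close> for the curried relation, whose values are
  functions on the arity with coordinate \<open>j\<close> deleted. Curried nonconstancy is implied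
  by dependence on \<open>j\<close>, so the bound on nonconstant functions bounds the dependent
  ones.\<close>

lemma coordinate_step:
  assumes gq: "generalized_quasiorder A \<alpha> \<rho>" and j: "j < length \<alpha>"
    and f: "f \<in> ops A (length gs)" and gs: "set gs \<subseteq> \<rho>" "gs \<noteq> []"
    and step: "\<And>gs'. list_all2 (reparametrized_at \<alpha> j) gs gs' \<Longrightarrow> set gs' \<subseteq> \<rho> \<Longrightarrow>
      length (filter (depends \<alpha> j) gs') \<le> snd (\<alpha> ! j) \<Longrightarrow> pointwise \<alpha> f gs' \<in> \<rho>"
  shows "pointwise \<alpha> f gs \<in> \<rho>"
proof -
  let ?B = "fst (\<alpha> ! j)" and ?d = "snd (\<alpha> ! j)" and ?V = "points (delete_at j \<alpha>) \<rightarrow>\<^sub>E A"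
  let ?c = "curry_at \<alpha> j"
  \<comment> \<open>\<open>f\<close> acting pointwise on values that are themselves functions of the
    other coordinates, so that currying commutes with the application of \<open>f\<close>.\<close>
  define \<Phi> where "\<Phi> = (\<lambda>vs. \<lambda>Y\<in>points (delete_at j \<alpha>). f (map (\<lambda>v. v Y) vs))"
  have \<rho>: "\<rho> \<subseteq> points \<alpha> \<rightarrow>\<^sub>E A" using gq by (simp add: generalized_quasiorder_def)
  have curry: "?c (pointwise \<alpha> f hs) = (\<lambda>x\<in>coordinate \<alpha> j. \<Phi> (map (\<lambda>G. G x) (map ?c hs)))" for hs
    unfolding \<Phi>_def pointwise_def curry_at_def
    using insert_at_in_points[OF j]
    by (intro restrict_ext) (simp add: comp_def)
  have "(\<lambda>x\<in>coordinate \<alpha> j. \<Phi> (map (\<lambda>G. G x) (map ?c gs))) \<in> ?c ` \<rho>"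
  proof (rule simple_preserved[where V = ?V])
    show "simple_int_reflexive ?V ?B ?d (?c ` \<rho>)" "simple_transitive ?V ?B ?d (?c ` \<rho>)"
      using gq j by (auto simp: generalized_quasiorder_def int_reflexive_def transitive_def)
    show "?c ` \<rho> \<subseteq> coordinate \<alpha> j \<rightarrow>\<^sub>E ?V" 
      by (rule image_subsetI, rule curry_at_mem[OF j], rule subsetD[OF \<rho>])
    show "set (map ?c gs) \<subseteq> ?c ` \<rho>" "map ?c gs \<noteq> []" using gs by auto
    show "\<Phi> vs \<in> ?V" if "set vs \<subseteq> ?V" "length vs = length (map ?c gs)" for vs
      using map_app_in_tuples[OF that(1)] that(2) f unfolding \<Phi>_def ops_def by auto
    fix Gs' assume Gs': "list_all2 (reparametrized ?B ?d) (map ?c gs) Gs'" "set Gs' \<subseteq> ?c ` \<rho>"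
      "length (filter (nonconstant ?B ?d) Gs') \<le> ?d"
    obtain gs' where gs': "Gs' = map ?c gs'" "set gs' \<subseteq> \<rho>"
    proof -
      have "Gs' \<in> map ?c ` lists \<rho>" using Gs'(2) by (simp add: lists_image[symmetric] in_lists_conv_set subset_iff)
      then show thesis using that by auto
    qed
    have "reparametrized_at \<alpha> j g g'"
      if "g' \<in> set gs'" "reparametrized ?B ?d (?c g) (?c g')" for g g'
      by (rule reparametrized_curry_at[OF j _ that(2)]) (use that(1) gs'(2) \<rho> in blast)
    then have "list_all2 (reparametrized_at \<alpha> j) gs gs'"
      using Gs'(1) unfolding gs'(1) by (auto simp: list.rel_map elim: list.rel_mono_strong)
    moreover have "length (filter (depends \<alpha> j) gs') \<le> length (filter (nonconstant ?B ?d) Gs')"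
      unfolding gs'(1) by (induction gs') (auto dest: nonconstant_curry_at[OF j])
    ultimately have "pointwise \<alpha> f gs' \<in> \<rho>" using step gs'(2) Gs'(3) by simp
    then show "(\<lambda>x\<in>coordinate \<alpha> j. \<Phi> (map (\<lambda>G. G x) Gs')) \<in> ?c ` \<rho>"
      using curry[of gs'] gs'(1) by (metis imageI)
  qed
  then have "?c (pointwise \<alpha> f gs) \<in> ?c ` \<rho>" using curry[of gs] by simp
  moreover have "pointwise \<alpha> f gs \<in> points \<alpha> \<rightarrow>\<^sub>E A" using pointwise_mem[OF f] gs \<rho> by blast
  ultimately show ?thesis using curry_at_inj[OF j] \<rho> by blast
qed

text \<open>Move from \<open>X\<close> to \<open>Y\<close> by replacing one coordinate at a time; if
  \<open>g\<close> depended on no coordinate, its value would never change along the way.\<close>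

lemma depends_on_some_coordinate:
  assumes X: "X \<in> points \<alpha>" and Y: "Y \<in> points \<alpha>" and ne: "g X \<noteq> g Y"
  shows "\<exists>j<length \<alpha>. depends \<alpha> j g"
proof (rule ccontr)
  assume *: "\<not> ?thesis"
  have len: "length X = length \<alpha>" "length Y = length \<alpha>" using X Y by (auto simp: points_iff)
  have "take k Y @ drop k X \<in> points \<alpha> \<and> g (take k Y @ drop k X) = g X" if "k \<le> length \<alpha>" for k
    using that
  proof (induction k)
    case (Suc k)
    let ?Z = "take k Y @ drop k X"
    have "take (Suc k) Y @ drop (Suc k) X = ?Z[k := Y ! k]"
      using Suc.prems len by (simp add: take_Suc_conv_app_nth list_update_append Cons_nth_drop_Suc[symmetric])
    moreover have "Y ! k \<in> coordinate \<alpha> k" using Y Suc.prems by (auto simp: points_iff)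
    ultimately show ?case using Suc * points_update[of ?Z \<alpha> "Y ! k" k] by (auto simp: depends_def)
  qed (use X in simp)
  from this[of "length \<alpha>"] show False using len ne by simp
qed

text \<open>The union bound, with multiplicities counted in a list.\<close>

lemma length_filter_ex_le:
  fixes s :: nat
  shows "length (filter (\<lambda>x. \<exists>j<s. P j x) xs) \<le> (\<Sum>j<s. length (filter (P j) xs))"
proof (induction xs)
  case (Cons x xs)
  have "(\<Sum>j<s. length (filter (P j) (x # xs))) = (\<Sum>j<s. (if P j x then 1 else 0) + length (filter (P j) xs))"
    by (intro sum.cong) auto
  also have "\<dots> = (\<Sum>j<s. if P j x then 1 else 0) + (\<Sum>j<s. length (filter (P j) xs))"
    by (rule sum.distrib)
  finally have "(\<Sum>j<s. length (filter (P j) (x # xs)))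
      = (\<Sum>j<s. if P j x then 1 else 0) + (\<Sum>j<s. length (filter (P j) xs))" .
  moreover have "(1::nat) \<le> (\<Sum>j<s. if P j x then 1 else 0)" if ex: "\<exists>j<s. P j x"
  proof -
    obtain j where "j < s" "P j x" using ex by blast
    then show ?thesis using member_le_sum[of j "{..<s}" "\<lambda>j. if P j x then 1 else 0 :: nat"] by auto
  qed
  moreover have "length (filter (\<lambda>x. \<exists>j<s. P j x) (x # xs))
      = (if \<exists>j<s. P j x then 1 else 0) + length (filter (\<lambda>x. \<exists>j<s. P j x) xs)"
    by simp
  moreover have "(if \<exists>j<s. P j x then 1 else 0) \<le> (\<Sum>j<s. if P j x then 1 else 0 :: nat)"
    using calculation(2) by simp
  ultimately show ?case using Cons by linarith
qed simp

text \<open>The cardinality is the rank of \<open>i\<close> in \<open>I\<close>, by which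
  \<open>trl\<close> assigns positions to the kept variables; distinct kept variables thus get
  distinct positions.\<close>

lemma card_less_inj_on: "finite I \<Longrightarrow> inj_on (\<lambda>i::nat. card {j\<in>I. j < i}) I"
proof (rule inj_onI)
  fix x y assume I: "finite I" and xy: "x \<in> I" "y \<in> I" "card {j\<in>I. j < x} = card {j\<in>I. j < y}"
  have "card {j\<in>I. j < a} < card {j\<in>I. j < b}" if "a \<in> I" "a < b" for a b
    using that I by (intro psubset_card_mono) auto
  from this[of x y] this[of y x] xy show "x = y" by linarith
qed

text \<open>The constant functions among \<open>gs\<close> can be substituted into \<open>f\<close>
  as constants. This leaves a \<open>d\<close>-ary translation \<open>h\<close>, applied to the
  nonconstant functions and padded with constant ones.\<close>

lemma few_nonconstant_preserved:
  assumes trl: "\<And>h. h \<in> trl A d (length gs, f) \<Longrightarrow> preserves_rrel (d, h) (\<alpha>, \<rho>)"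
    and \<rho>: "\<rho> \<subseteq> points \<alpha> \<rightarrow>\<^sub>E A" and const: "\<And>a. a \<in> A \<Longrightarrow> (\<lambda>X\<in>points \<alpha>. a) \<in> \<rho>" "A \<noteq> {}"
    and gs: "set gs \<subseteq> \<rho>" and X0: "X0 \<in> points \<alpha>"
    and few: "length (filter (\<lambda>g. \<exists>X\<in>points \<alpha>. \<exists>Y\<in>points \<alpha>. g X \<noteq> g Y) gs) \<le> d"
  shows "pointwise \<alpha> f gs \<in> \<rho>"
proof -
  let ?n = "length gs"
  define I where "I = {i. i < ?n \<and> (\<exists>X\<in>points \<alpha>. \<exists>Y\<in>points \<alpha>. (gs ! i) X \<noteq> (gs ! i) Y)}"
  define c where "c i = card {j\<in>I. j < i}" for i
  obtain a where a: "a \<in> A" using const(2) by blast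
  have fin: "finite I" and card: "card I \<le> d"
    using few by (simp_all add: I_def length_filter_conv_card)
  have inj: "inj_on c I" unfolding c_def by (rule card_less_inj_on[OF fin])
  have c_less: "c i < d" if "i \<in> I" for i
  proof -
    have "c i < card I" unfolding c_def using that fin by (intro psubset_card_mono) auto
    then show ?thesis using card by simp
  qed
  \<comment> \<open>At \<open>X0\<close> the constant functions reveal their values.\<close>
  define cs where "cs = map (\<lambda>g. g X0) gs"
  have cs: "cs \<in> tuples A ?n" unfolding cs_def using gs \<rho> X0 by (intro map_app_in_tuples) auto
  define h where "h = (\<lambda>xs\<in>tuples A d. f (map (\<lambda>i. if i \<in> I then xs ! (0 + c i) else cs ! i) [0..<?n]))"
  \<comment> \<open>Place \<open>c i\<close> receives the nonconstant function
    \<open>gs ! i\<close>. The remaining places belong to fictitious variables of \<open>h\<close>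
    and are filled with a constant function, which lies in \<rho>.\<close>
  define hs where "hs = map (\<lambda>k. if k \<in> c ` I then gs ! inv_into I c k else (\<lambda>X\<in>points \<alpha>. a)) [0..<d]"
  have "h \<in> trl A d (?n, f)"
    unfolding trl_def h_def c_def using cs card
    by (auto simp: I_def intro!: exI[of _ I] exI[of _ cs] exI[of _ 0])
  then have "preserves_rrel (d, h) (\<alpha>, \<rho>)" by (rule trl)
  moreover have hs: "set hs \<subseteq> \<rho>" "length hs = d"
  proof -
    have "gs ! i \<in> \<rho>" if "i \<in> I" for i using that gs by (auto simp: I_def)
    then show "set hs \<subseteq> \<rho>" using inj const(1)[OF a] by (auto simp: hs_def inv_into_f_f)
  qed (simp add: hs_def)
  ultimately have "pointwise \<alpha> h hs \<in> \<rho>" by (simp add: preserves_rrel_iff)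
  moreover have "pointwise \<alpha> h hs = pointwise \<alpha> f gs"
    unfolding pointwise_def
  proof (rule restrict_ext)
    fix X assume X: "X \<in> points \<alpha>"
    have "(if i \<in> I then map (\<lambda>g. g X) hs ! c i else cs ! i) = (gs ! i) X" if i: "i < ?n" for i
    proof (cases "i \<in> I")
      case True
      then show ?thesis using c_less[OF True] inj by (simp add: hs_def inv_into_f_f)
    next
      case False
      then have "(gs ! i) X0 = (gs ! i) X" using i X X0 unfolding I_def by blast
      then show ?thesis using i False by (simp add: cs_def)
    qed
    then have "map (\<lambda>i. if i \<in> I then map (\<lambda>g. g X) hs ! c i else cs ! i) [0..<?n] = map (\<lambda>i. (gs ! i) X) [0..<?n]"
      by (intro map_cong refl) (simp only: set_upt atLeastLessThan_iff)
    also have "\<dots> = map (\<lambda>g. g X) gs" by (intro nth_equalityI) auto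
    finally have "map (\<lambda>i. if i \<in> I then map (\<lambda>g. g X) hs ! c i else cs ! i) [0..<?n] = map (\<lambda>g. g X) gs" .
    moreover have "map (\<lambda>g. g X) hs \<in> tuples A d"
      using hs \<rho> X by (intro map_app_in_tuples) auto
    ultimately show "h (map (\<lambda>g. g X) hs) = f (map (\<lambda>g. g X) gs)" by (simp add: h_def cong: if_cong)
  qed
  ultimately show ?thesis by simp
qed

lemma generalized_quasiorder_preserved:
  assumes gq: "generalized_quasiorder A \<alpha> \<rho>" and dim: "dimension \<alpha> = d"
    and ne: "A \<noteq> {}" "points \<alpha> \<noteq> {}" and f: "f \<in> ops A n" "1 \<le> n"
    and trl: "\<And>h. h \<in> trl A d (n, f) \<Longrightarrow> preserves_rrel (d, h) (\<alpha>, \<rho>)"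
  shows "preserves_rrel (n, f) (\<alpha>, \<rho>)"
proof -
  have \<rho>: "\<rho> \<subseteq> points \<alpha> \<rightarrow>\<^sub>E A" and const: "\<And>a. a \<in> A \<Longrightarrow> (\<lambda>X\<in>points \<alpha>. a) \<in> \<rho>"
    using gq by (auto simp: generalized_quasiorder_def)
  obtain X0 where X0: "X0 \<in> points \<alpha>" using ne(2) by blast
  \<comment> \<open>Downward induction on the number \<open>k\<close> of coordinates on which few of the functions depend.\<close>
  have "\<forall>gs. set gs \<subseteq> \<rho> \<and> length gs = n \<and> (\<forall>j<k. length (filter (depends \<alpha> j) gs) \<le> snd (\<alpha> ! j))
      \<longrightarrow> pointwise \<alpha> f gs \<in> \<rho>" if "k \<le> length \<alpha>" for k
    using that
  proof (induction rule: inc_induct)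
    case base
    show ?case
    proof (intro allI impI, elim conjE)
      fix gs assume gs: "set gs \<subseteq> \<rho>" "length gs = n"
        and le: "\<forall>j<length \<alpha>. length (filter (depends \<alpha> j) gs) \<le> snd (\<alpha> ! j)"
      \<comment> \<open>This is where the dimension enters: a nonconstant function depends on some
        coordinate, so the bounds of the single coordinates add up to \<open>d\<close>.\<close>
      have "length (filter (\<lambda>g. \<exists>X\<in>points \<alpha>. \<exists>Y\<in>points \<alpha>. g X \<noteq> g Y) gs)
          \<le> length (filter (\<lambda>g. \<exists>j<length \<alpha>. depends \<alpha> j g) gs)"
        by (induction gs) (auto dest: depends_on_some_coordinate)
      also have "\<dots> \<le> (\<Sum>j<length \<alpha>. length (filter (depends \<alpha> j) gs))"
        by (rule length_filter_ex_le)
      also have "\<dots> \<le> (\<Sum>j<length \<alpha>. snd (\<alpha> ! j))"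
        using le by (intro sum_mono) auto
      also have "\<dots> = d"
        using dim by (simp add: dimension_def sum_list_sum_nth atLeast0LessThan)
      finally show "pointwise \<alpha> f gs \<in> \<rho>"
        using few_nonconstant_preserved[OF _ \<rho> const ne(1) gs(1) X0] trl gs(2) by blast
    qed
  next
    case (step k)
    show ?case
    proof (intro allI impI, elim conjE)
      fix gs assume gs: "set gs \<subseteq> \<rho>" "length gs = n"
        and le: "\<forall>j<k. length (filter (depends \<alpha> j) gs) \<le> snd (\<alpha> ! j)"
      show "pointwise \<alpha> f gs \<in> \<rho>"
      proof (rule coordinate_step[OF gq step.hyps(2)])
        show "f \<in> ops A (length gs)" "set gs \<subseteq> \<rho>" "gs \<noteq> []" using gs f by auto
        fix gs' assume gs': "list_all2 (reparametrized_at \<alpha> k) gs gs'" "set gs' \<subseteq> \<rho>"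
          "length (filter (depends \<alpha> k) gs') \<le> snd (\<alpha> ! k)"
        have "length (filter (depends \<alpha> j) gs') \<le> snd (\<alpha> ! j)" if "j < k" for j
          using length_filter_list_all2[OF gs'(1), of "depends \<alpha> j"] le that
            depends_reparametrized_at[of \<alpha> k _ _ j] step.hyps(2) by fastforce
        then have "\<forall>j<Suc k. length (filter (depends \<alpha> j) gs') \<le> snd (\<alpha> ! j)"
          using gs'(3) by (auto simp: less_Suc_eq)
        then show "pointwise \<alpha> f gs' \<in> \<rho>"
          using step.IH gs' gs(2) by (auto dest: list_all2_lengthD)
      qed
    qed
  qed
  from this[of 0] show ?thesis by (simp add: preserves_rrel_iff)
qed

section \<open>Clones, clone fragments and polymorphisms\<close>

lemma clone_projection: "clone A C \<Longrightarrow> i < n \<Longrightarrow> (n, \<lambda>xs\<in>tuples A n. xs ! i) \<in> C"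
  by (auto simp: clone_def)

lemma clone_compose:
  assumes "clone A C" "(length gs, f) \<in> C" "\<And>g. g \<in> set gs \<Longrightarrow> (m, g) \<in> C"
  shows "(m, \<lambda>xs\<in>tuples A m. f (map (\<lambda>g. g xs) gs)) \<in> C"
proof -
  have "\<forall>n m f gs. (n, f) \<in> C \<and> length gs = n \<and> (\<forall>g\<in>set gs. (m, g) \<in> C)
      \<longrightarrow> (m, \<lambda>xs\<in>tuples A m. f (map (\<lambda>g. g xs) gs)) \<in> C"
    using assms(1) by (simp add: clone_def)
  from this[rule_format, of "length gs" f gs m] show ?thesis using assms(2,3) by simp
qed

lemma cloneI:
  assumes "C \<subseteq> Op A" "\<And>n i. i < n \<Longrightarrow> (n, \<lambda>xs\<in>tuples A n. xs ! i) \<in> C"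
    "\<And>m f gs. (length gs, f) \<in> C \<Longrightarrow> (\<And>g. g \<in> set gs \<Longrightarrow> (m, g) \<in> C) \<Longrightarrow> gs \<noteq> [] \<Longrightarrow>
      (m, \<lambda>xs\<in>tuples A m. f (map (\<lambda>g. g xs) gs)) \<in> C"
  shows "clone A C"
  unfolding clone_def
proof (intro conjI allI impI)
  show "C \<subseteq> Op A" by fact
  show "(n, \<lambda>xs\<in>tuples A n. xs ! i) \<in> C" if "i < n" for n i using assms(2) that .
  fix n m f gs assume *: "(n, f) \<in> C \<and> length gs = n \<and> (\<forall>g\<in>set gs. (m, g) \<in> C)"
  then have "gs \<noteq> []" using assms(1) by (auto simp: Op_def)
  then show "(m, \<lambda>xs\<in>tuples A m. f (map (\<lambda>g. g xs) gs)) \<in> C" using * assms(3) by blast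
qed

lemma clone_arity: "clone A C \<Longrightarrow> (n, f) \<in> C \<Longrightarrow> 1 \<le> n \<and> f \<in> ops A n"
  by (auto simp: clone_def Op_def)

lemma clone_Op: "clone A (Op A)"
proof (rule cloneI)
  fix m f and gs :: "('a list \<Rightarrow> 'a) list"
  assume f: "(length gs, f) \<in> Op A" and gs: "\<And>g. g \<in> set gs \<Longrightarrow> (m, g) \<in> Op A" and "gs \<noteq> []"
  then have "1 \<le> m" by (cases gs) (auto simp: Op_def)
  moreover have "set gs \<subseteq> tuples A m \<rightarrow>\<^sub>E A" using gs by (auto simp: Op_def ops_def)
  then have "map (\<lambda>g. g xs) gs \<in> tuples A (length gs)" if "xs \<in> tuples A m" for xs
    using that by (intro map_app_in_tuples) auto
  ultimately show "(m, \<lambda>xs\<in>tuples A m. f (map (\<lambda>g. g xs) gs)) \<in> Op A"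
    using f by (auto simp: Op_def ops_def)
qed (auto simp: Op_def ops_def tuples_def)

lemma clone_Inter:
  assumes "\<And>C. C \<in> \<C> \<Longrightarrow> clone A C" "\<C> \<noteq> {}"
  shows "clone A (\<Inter>\<C>)"
proof (rule cloneI)
  show "\<Inter>\<C> \<subseteq> Op A" using assms unfolding clone_def by blast
  show "(n, \<lambda>xs\<in>tuples A n. xs ! i) \<in> \<Inter>\<C>" if "i < n" for n i
    using clone_projection[OF assms(1) that] by blast
  show "(m, \<lambda>xs\<in>tuples A m. f (map (\<lambda>g. g xs) gs)) \<in> \<Inter>\<C>"
    if "(length gs, f) \<in> \<Inter>\<C>" "\<And>g. g \<in> set gs \<Longrightarrow> (m, g) \<in> \<Inter>\<C>" for m f gs
    using clone_compose[OF assms(1)] that by blast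
qed

lemma clone_generated_clone: "F \<subseteq> Op A \<Longrightarrow> clone A (clone_generated A F)"
  unfolding clone_generated_def using clone_Op by (intro clone_Inter) auto

lemma clone_generated_least: "clone A C \<Longrightarrow> F \<subseteq> C \<Longrightarrow> clone_generated A F \<subseteq> C"
  unfolding clone_generated_def by blast

lemma clone_fragment_ary_part: "clone A C \<Longrightarrow> clone_fragment A d (ary_part d C)"
proof -
  assume C: "clone A C"
  have "clone_generated A (Pair d ` ary_part d C) \<subseteq> C"
    by (rule clone_generated_least[OF C]) (auto simp: ary_part_def)
  moreover have "Pair d ` ary_part d C \<subseteq> clone_generated A (Pair d ` ary_part d C)"
    by (auto simp: clone_generated_def)
  moreover have "ary_part d C \<subseteq> ops A d" using clone_arity[OF C] by (auto simp: ary_part_def)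
  ultimately show ?thesis unfolding clone_fragment_def ary_part_def by blast
qed

text \<open>The working form of the definition: closure under composition and the presence of the
  projections are inherited from the witnessing clone.\<close>

lemma clone_fragment_iff:
  assumes "1 \<le> d"
  shows "clone_fragment A d M \<longleftrightarrow> (\<exists>C. clone A C \<and> M = ary_part d C)"
proof
  assume M: "clone_fragment A d M"
  then have "Pair d ` M \<subseteq> Op A" using assms by (auto simp: clone_fragment_def Op_def)
  then show "\<exists>C. clone A C \<and> M = ary_part d C"
    using M clone_generated_clone unfolding clone_fragment_def by blast
qed (auto intro: clone_fragment_ary_part)

section \<open>Projections, translations and constants\<close>

definition projections :: "'a set \<Rightarrow> nat \<Rightarrow> ('a list \<Rightarrow> 'a) list" where
  "projections A d = map (\<lambda>i. \<lambda>xs\<in>tuples A d. xs ! i) [0..<d]"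

lemma length_projections [simp]: "length (projections A d) = d"
  by (simp add: projections_def)

lemma map_projections: "xs \<in> tuples A d \<Longrightarrow> map (\<lambda>p. p xs) (projections A d) = xs"
  by (auto simp: projections_def tuples_def intro: nth_equalityI)

lemma clone_projections: "clone A C \<Longrightarrow> p \<in> set (projections A d) \<Longrightarrow> (d, p) \<in> C"
  by (auto simp: projections_def intro: clone_projection)

text \<open>A translation is \<open>f\<close> composed with projections (for the variables kept) and
  constant operations (for the others).\<close>

lemma trl_subset:
  assumes C: "clone A C" and f: "(n, f) \<in> C" and const: "const_ops A d \<subseteq> ary_part d C"
  shows "trl A d (n, f) \<subseteq> ary_part d C"
proof
  fix h assume "h \<in> trl A d (n, f)"
  then obtain I cs u where h: "h = (\<lambda>xs\<in>tuples A d.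
      f (map (\<lambda>i. if i \<in> I then xs ! (u + card {j\<in>I. j < i}) else cs ! i) [0..<n]))"
    and I: "I \<subseteq> {..<n}" "cs \<in> tuples A n" "u + card I \<le> d"
    by (auto simp: trl_def)
  define gs where "gs = map (\<lambda>i. if i \<in> I then (\<lambda>xs\<in>tuples A d. xs ! (u + card {j\<in>I. j < i}))
    else (\<lambda>xs\<in>tuples A d. cs ! i)) [0..<n]"
  have "(d, g) \<in> C" if g: "g \<in> set gs" for g
  proof -
    obtain i where i: "i < n" and gi: "g = (if i \<in> I then (\<lambda>xs\<in>tuples A d. xs ! (u + card {j\<in>I. j < i}))
        else (\<lambda>xs\<in>tuples A d. cs ! i))"
      using g by (auto simp: gs_def)
    show ?thesis
    proof (cases "i \<in> I")
      case True
      \<comment> \<open>The rank is strictly below \<open>card I\<close>, so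
        \<open>u + card I \<le> d\<close> makes the index of the projection smaller than
        \<open>d\<close>.\<close>
      have "card {j\<in>I. j < i} < card I"
        using True I(1) by (intro psubset_card_mono) (auto intro: finite_subset)
      then show ?thesis using True gi I(3) clone_projection[OF C] by simp
    next
      case False
      have "cs ! i \<in> A" using I(2) i by (auto simp: tuples_def subset_iff)
      then show ?thesis using False gi const by (auto simp: const_ops_def ary_part_def)
    qed
  qed
  moreover have "length gs = n" by (simp add: gs_def)
  ultimately have "(d, \<lambda>xs\<in>tuples A d. f (map (\<lambda>g. g xs) gs)) \<in> C"
    using clone_compose[OF C, of gs f d] f by simp
  moreover have "(\<lambda>xs\<in>tuples A d. f (map (\<lambda>g. g xs) gs)) = h"
    unfolding h gs_def by (intro restrict_ext arg_cong[of _ _ f]) simp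
  ultimately show "h \<in> ary_part d C" by (simp add: ary_part_def)
qed

lemma star_mono: "N \<subseteq> N' \<Longrightarrow> star A d N \<subseteq> star A d N'"
  by (auto simp: star_def)

lemma star_Inter: "\<N> \<noteq> {} \<Longrightarrow> star A d (\<Inter>\<N>) = \<Inter>(star A d ` \<N>)"
  by (auto simp: star_def)

text \<open>The constants come from the unary projection: substituting \<open>a\<close> for its only
  variable leaves the \<open>d\<close>-ary constant operation \<open>a\<close>.\<close>

lemma const_ops_subset_of_clone_star:
  assumes "clone A (star A d M)"
  shows "const_ops A d \<subseteq> M"
proof
  fix g assume "g \<in> const_ops A d"
  then obtain a where a: "a \<in> A" "g = (\<lambda>xs\<in>tuples A d. a)" by (auto simp: const_ops_def)
  let ?p = "\<lambda>xs\<in>tuples A 1. xs ! 0"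
  have "(1, ?p) \<in> star A d M" using clone_projection[OF assms, of 0 1] by simp
  then have "trl A d (1, ?p) \<subseteq> M" by (simp add: star_def)
  moreover have "g \<in> trl A d (1, ?p)"
  proof -
    have "g = (\<lambda>xs\<in>tuples A d. ?p (map (\<lambda>i. if i \<in> {} then xs ! (0 + card {j\<in>{}. j < i}) else [a] ! i) [0..<1]))"
      using a by (simp add: tuples_def)
    moreover have "[a] \<in> tuples A 1" "{} \<subseteq> {..<1::nat}" "0 + card ({}::nat set) \<le> d"
      using a by (auto simp: tuples_def)
    ultimately show ?thesis unfolding trl_def by blast
  qed
  ultimately show "g \<in> M" by blast
qed

text \<open>A \<open>d\<close>-ary operation is one of its own translations, namely the one that
  keeps all variables. Even this one requires a tuple of constants over \<open>A\<close>, which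
  exists because \<open>A\<close> is nonempty.\<close>

lemma ary_part_star_subset:
  assumes "A \<noteq> {}"
  shows "ary_part d (star A d M) \<subseteq> M"
proof
  fix f assume "f \<in> ary_part d (star A d M)"
  then have f: "f \<in> ops A d" "trl A d (d, f) \<subseteq> M" by (auto simp: ary_part_def star_def Op_def)
  obtain a where "a \<in> A" using assms by blast
  then have "replicate d a \<in> tuples A d" by (auto simp: tuples_def)
  moreover have "f = (\<lambda>xs\<in>tuples A d. f (map (\<lambda>i. if i \<in> {..<d} then xs ! (0 + card {j\<in>{..<d}. j < i})
      else replicate d a ! i) [0..<d]))"
  proof -
    have "{j. j < d \<and> j < i} = {..<i}" if "i < d" for i :: nat using that by auto
    then have "map (\<lambda>i. if i \<in> {..<d} then xs ! (0 + card {j\<in>{..<d}. j < i})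
      else replicate d a ! i) [0..<d] = xs" if "xs \<in> tuples A d" for xs
      using that by (intro nth_equalityI) (auto simp: tuples_def)
    then have "(\<lambda>xs\<in>tuples A d. f (map (\<lambda>i. if i \<in> {..<d} then xs ! (0 + card {j\<in>{..<d}. j < i})
      else replicate d a ! i) [0..<d])) = restrict f (tuples A d)"
      by (intro restrict_ext) (simp only:)
    then show ?thesis using f(1) by (simp add: ops_def PiE_def extensional_restrict)
  qed
  moreover have "{..<d} \<subseteq> {..<d}" "0 + card {..<d} \<le> d" by auto
  ultimately have "f \<in> trl A d (d, f)" unfolding trl_def by blast
  then show "f \<in> M" using f(2) by blast
qed

lemma ary_part_star:
  assumes M: "clone_fragment A d M" and const: "const_ops A d \<subseteq> M" and "A \<noteq> {}" "1 \<le> d"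
  shows "ary_part d (star A d M) = M"
proof
  show "ary_part d (star A d M) \<subseteq> M" by (rule ary_part_star_subset) fact
  obtain C where C: "clone A C" "M = ary_part d C" using M assms(4) clone_fragment_iff by blast
  then show "M \<subseteq> ary_part d (star A d M)"
    using trl_subset[OF C(1)] const assms(4) by (auto simp: ary_part_def star_def clone_def)
qed

lemma ops_eq_ary_part: "1 \<le> d \<Longrightarrow> ops A d = ary_part d (Op A)"
  by (auto simp: ary_part_def Op_def)

lemma const_ops_subset_ops: "const_ops A d \<subseteq> ops A d"
  by (auto simp: const_ops_def ops_def)

lemma star_ops: "1 \<le> d \<Longrightarrow> star A d (ops A d) = Op A"
  using trl_subset[OF clone_Op] const_ops_subset_ops ops_eq_ary_part by (fastforce simp: star_def)

section \<open>The closure operator\<close>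

abbreviation R_closed_supersets :: "'a set \<Rightarrow> nat \<Rightarrow> ('a list \<Rightarrow> 'a) set \<Rightarrow> ('a list \<Rightarrow> 'a) set set" where
  "R_closed_supersets A d M \<equiv>
     {N. M \<union> const_ops A d \<subseteq> N \<and> clone_fragment A d N \<and> clone A (star A d N)}"

text \<open>A fragment can be the \<open>d\<close>-ary part of several clones. Intersecting all of
  them avoids a choice, and intersections commute with \<open>ary_part\<close>.\<close>

lemma clone_fragment_Inter:
  assumes "\<And>N. N \<in> \<N> \<Longrightarrow> clone_fragment A d N" "\<N> \<noteq> {}" "1 \<le> d"
  shows "clone_fragment A d (\<Inter>\<N>)"
proof -
  let ?\<C> = "{C. clone A C \<and> ary_part d C \<in> \<N>}"
  have \<N>: "\<exists>C. clone A C \<and> N = ary_part d C" if "N \<in> \<N>" for N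
    using assms(1)[OF that] clone_fragment_iff[OF assms(3)] by blast
  have "\<Inter>\<N> = \<Inter>(ary_part d ` ?\<C>)" using \<N> by blast
  also have "\<dots> = ary_part d (\<Inter>?\<C>)" by (auto simp: ary_part_def)
  finally have "\<Inter>\<N> = ary_part d (\<Inter>?\<C>)" .
  moreover have "clone A (\<Inter>?\<C>)"
  proof (rule clone_Inter)
    show "?\<C> \<noteq> {}" using \<N> assms(2) by blast
  qed auto
  ultimately show ?thesis using clone_fragment_ary_part[of A "\<Inter>?\<C>" d] by simp
qed

text \<open>The set of all \<open>d\<close>-ary operations belongs to the family, so the
  intersection is not over the empty family. Since \<open>star\<close> commutes with nonempty
  intersections, the clone property passes to the closure.\<close>

lemma R_closure_properties:
  assumes "M \<subseteq> ops A d" "1 \<le> d"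
  shows "M \<subseteq> R_closure A d M" "const_ops A d \<subseteq> R_closure A d M"
    "clone_fragment A d (R_closure A d M)" "clone A (star A d (R_closure A d M))"
proof -
  have "clone_fragment A d (ops A d)"
    using clone_fragment_ary_part[OF clone_Op, of A d] ops_eq_ary_part[OF assms(2), of A] by simp
  then have "ops A d \<in> R_closed_supersets A d M"
    using assms const_ops_subset_ops[of A d] star_ops[OF assms(2), of A] clone_Op[of A] by simp
  then have ne: "R_closed_supersets A d M \<noteq> {}" by blast
  show "M \<subseteq> R_closure A d M" "const_ops A d \<subseteq> R_closure A d M" by (auto simp: R_closure_def)
  show "clone_fragment A d (R_closure A d M)"
    unfolding R_closure_def by (rule clone_fragment_Inter[OF _ ne assms(2)]) simp
  show "clone A (star A d (R_closure A d M))"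
    unfolding R_closure_def star_Inter[OF ne] by (rule clone_Inter) (use ne in auto)
qed

text \<open>The constants demanded of a member of the family are supplied by
  \<open>const_ops_subset_of_clone_star\<close>.\<close>

lemma R_closure_least:
  "M \<subseteq> N \<Longrightarrow> clone_fragment A d N \<Longrightarrow> clone A (star A d N) \<Longrightarrow> R_closure A d M \<subseteq> N"
  using const_ops_subset_of_clone_star[of A d N] unfolding R_closure_def by blast

lemma R_closed_iff_clone_star:
  assumes "clone_fragment A d M" "1 \<le> d"
  shows "R_closed A d M \<longleftrightarrow> clone A (star A d M)"
proof
  have "M \<subseteq> ops A d" using assms by (simp add: clone_fragment_def)
  note * = R_closure_properties[OF this assms(2)]
  show "clone A (star A d M)" if "R_closed A d M" using *(4) that by (simp add: R_closed_def)
  show "R_closed A d M" if "clone A (star A d M)"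
    using R_closure_least[OF order_refl assms(1) that] *(1) assms(1) by (auto simp: R_closed_def)
qed

section \<open>Polymorphisms of R-relations\<close>

lemma Pol_rrel_clone:
  fixes A :: "'a set"
  assumes "\<And>\<alpha> \<rho>. (\<alpha>, \<rho>) \<in> Q \<Longrightarrow> \<rho> \<subseteq> points \<alpha> \<rightarrow>\<^sub>E A"
  shows "clone A (Pol_rrel A Q)"
proof (rule cloneI)
  show "Pol_rrel A Q \<subseteq> Op A" by (auto simp: Pol_rrel_def)
next
  fix n i :: nat assume i: "i < n"
  have "pointwise \<alpha> (\<lambda>xs\<in>tuples A n. xs ! i) gs \<in> \<rho>"
    if T: "(\<alpha>, \<rho>) \<in> Q" and gs: "length gs = n" "set gs \<subseteq> \<rho>" for \<alpha> \<rho> gs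
  proof -
    have sub: "set gs \<subseteq> points \<alpha> \<rightarrow>\<^sub>E A" using gs assms T by blast
    then have "pointwise \<alpha> (\<lambda>xs\<in>tuples A n. xs ! i) gs = restrict (gs ! i) (points \<alpha>)"
      unfolding pointwise_def using map_app_in_tuples[OF sub _ gs(1)] i gs(1)
      by (intro restrict_ext) simp
    moreover have "gs ! i \<in> \<rho>" using i gs by auto
    ultimately show ?thesis using assms[OF T] by (auto simp: PiE_def extensional_restrict)
  qed
  moreover have "(n, \<lambda>xs\<in>tuples A n. xs ! i) \<in> Op A" using clone_projection[OF clone_Op i] .
  ultimately show "(n, \<lambda>xs\<in>tuples A n. xs ! i) \<in> Pol_rrel A Q"
    by (auto simp: Pol_rrel_def preserves_rrel_iff)
next
  fix m f and gs :: "('a list \<Rightarrow> 'a) list"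
  assume f: "(length gs, f) \<in> Pol_rrel A Q" and g: "\<And>g. g \<in> set gs \<Longrightarrow> (m, g) \<in> Pol_rrel A Q"
  let ?h = "\<lambda>xs\<in>tuples A m. f (map (\<lambda>g. g xs) gs)"
  have "pointwise \<alpha> ?h hs \<in> \<rho>"
    if T: "(\<alpha>, \<rho>) \<in> Q" and hs: "length hs = m" "set hs \<subseteq> \<rho>" for \<alpha> \<rho> hs
  proof -
    have sub: "set hs \<subseteq> points \<alpha> \<rightarrow>\<^sub>E A" using hs assms T by blast
    have "pointwise \<alpha> g hs \<in> \<rho>" if "g \<in> set gs" for g
      using g[OF that] T hs by (auto simp: Pol_rrel_def preserves_rrel_iff)
    then have "pointwise \<alpha> f (map (\<lambda>g. pointwise \<alpha> g hs) gs) \<in> \<rho>"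
      using f T by (auto simp: Pol_rrel_def preserves_rrel_iff image_subset_iff)
    moreover have "pointwise \<alpha> f (map (\<lambda>g. pointwise \<alpha> g hs) gs) = pointwise \<alpha> ?h hs"
      unfolding pointwise_def using map_app_in_tuples[OF sub _ hs(1)]
      by (intro restrict_ext) (simp add: comp_def)
    ultimately show ?thesis by simp
  qed
  moreover have "(m, ?h) \<in> Op A"
    by (rule clone_compose[OF clone_Op]) (use f g in \<open>auto simp: Pol_rrel_def\<close>)
  ultimately show "(m, ?h) \<in> Pol_rrel A Q"
    by (auto simp: Pol_rrel_def preserves_rrel_iff)
qed

lemma GQuordD:
  assumes "(\<alpha>, \<rho>) \<in> GQuord A d"
  shows "canonical \<alpha>" "dimension \<alpha> = d" "generalized_quasiorder A \<alpha> \<rho>" "\<rho> \<subseteq> points \<alpha> \<rightarrow>\<^sub>E A"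
  using assms by (auto simp: GQuord_def generalized_quasiorder_def)

lemma clone_Pol_GQuord: "Q \<subseteq> GQuord A d \<Longrightarrow> clone A (Pol_rrel A Q)"
  using GQuordD(4) by (intro Pol_rrel_clone) blast

text \<open>A constant operation turns any arguments into a constant function on \<alpha>, and these
  belong to every generalized quasiorder.\<close>

lemma const_ops_subset_Pol_GQuord:
  assumes Q: "Q \<subseteq> GQuord A d" and d: "1 \<le> d"
  shows "const_ops A d \<subseteq> ary_part d (Pol_rrel A Q)"
proof
  fix h assume h: "h \<in> const_ops A d"
  then obtain a where a: "a \<in> A" "h = (\<lambda>xs\<in>tuples A d. a)" by (auto simp: const_ops_def)
  have "pointwise \<alpha> h gs \<in> \<rho>" if T: "(\<alpha>, \<rho>) \<in> Q" and gs: "length gs = d" "set gs \<subseteq> \<rho>" for \<alpha> \<rho> gs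
  proof -
    have T: "(\<alpha>, \<rho>) \<in> GQuord A d" using Q T by blast
    have sub: "set gs \<subseteq> points \<alpha> \<rightarrow>\<^sub>E A" using gs GQuordD(4)[OF T] by blast
    have "pointwise \<alpha> h gs = (\<lambda>X\<in>points \<alpha>. a)"
      unfolding pointwise_def a(2) using map_app_in_tuples[OF sub _ gs(1)] by (intro restrict_ext) simp
    then show ?thesis using GQuordD(3)[OF T] a(1) by (simp add: generalized_quasiorder_def)
  qed
  then show "h \<in> ary_part d (Pol_rrel A Q)"
    using d h const_ops_subset_ops[of A d] by (auto simp: ary_part_def Pol_rrel_def preserves_rrel_iff Op_def)
qed

lemma points_nonempty: "canonical \<alpha> \<Longrightarrow> points \<alpha> \<noteq> {}"
proof -
  assume can: "canonical \<alpha>"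
  have "map (\<lambda>(B, n). replicate n 0) \<alpha> \<in> points \<alpha>"
    unfolding points_iff
  proof (intro conjI allI impI)
    fix j assume j: "j < length \<alpha>"
    obtain B n where Bn: "\<alpha> ! j = (B, n)" by fastforce
    then have "(B, n) \<in> set \<alpha>" using j nth_mem by metis
    then have "0 \<in> B" using can by (auto simp: canonical_def)
    then show "map (\<lambda>(B, n). replicate n 0) \<alpha> ! j \<in> coordinate \<alpha> j"
      using j Bn by (auto simp: tuples_def)
  qed simp
  then show ?thesis by blast
qed

text \<open>One inclusion holds because a clone whose \<open>d\<close>-ary part contains the
  constants is closed under \<open>d\<close>-ary translations; the other is
  \<open>generalized_quasiorder_preserved\<close>, applied to each relation in
  \<open>Q\<close>.\<close>

theorem star_ary_part_Pol_GQuord: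
  assumes Q: "Q \<subseteq> GQuord A d" and d: "1 \<le> d" and A: "A \<noteq> {}"
  shows "star A d (ary_part d (Pol_rrel A Q)) = Pol_rrel A Q"
proof
  show "Pol_rrel A Q \<subseteq> star A d (ary_part d (Pol_rrel A Q))"
    using trl_subset[OF clone_Pol_GQuord[OF Q] _ const_ops_subset_Pol_GQuord[OF Q d]]
    by (auto simp: star_def Pol_rrel_def)
  show "star A d (ary_part d (Pol_rrel A Q)) \<subseteq> Pol_rrel A Q"
  proof
    fix F assume F: "F \<in> star A d (ary_part d (Pol_rrel A Q))"
    obtain n f where nf: "F = (n, f)" by (cases F)
    have f: "f \<in> ops A n" "1 \<le> n" using F nf by (auto simp: star_def Op_def)
    have "preserves_rrel (n, f) (\<alpha>, \<rho>)" if T: "(\<alpha>, \<rho>) \<in> Q" for \<alpha> \<rho>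
    proof -
      have T': "(\<alpha>, \<rho>) \<in> GQuord A d" using Q T by blast
      show ?thesis
      proof (rule generalized_quasiorder_preserved[OF GQuordD(3,2)[OF T'] A _ f])
        show "points \<alpha> \<noteq> {}" using GQuordD(1)[OF T'] points_nonempty by blast
        show "preserves_rrel (d, h) (\<alpha>, \<rho>)" if "h \<in> trl A d (n, f)" for h
          using that F nf T by (auto simp: star_def ary_part_def Pol_rrel_def)
      qed
    qed
    then show "F \<in> Pol_rrel A Q" using F nf by (auto simp: star_def Pol_rrel_def)
  qed
qed

section \<open>Clone fragments as R-relations\<close>

lemma fragment_compose:
  assumes "clone A C" "f \<in> ary_part d C" "length gs = d" "set gs \<subseteq> ary_part d C"
  shows "(\<lambda>xs\<in>tuples A d. f (map (\<lambda>g. g xs) gs)) \<in> ary_part d C"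
  using clone_compose[OF assms(1), of gs f d] assms(2-4) by (auto simp: ary_part_def)

text \<open>A \<open>d\<close>-ary translation of an operation of arity \<open>d + 1\<close> substitutes at least one constant.\<close>

lemma circledast_subset_star:
  assumes M: "clone_fragment A d M" and const: "const_ops A d \<subseteq> M" and d: "1 \<le> d"
    and h: "h \<in> circledast A A d M"
  shows "(Suc d, h) \<in> star A d M"
proof -
  obtain C where C: "clone A C" and MC: "M = ary_part d C" using M clone_fragment_iff[OF d] by blast
  have h_ops: "h \<in> ops A (Suc d)" and eb: "ebtrl A d h \<subseteq> M"
    using h by (auto simp: circledast_def ops_def)
  have "f \<in> M" if f: "f \<in> trl A d (Suc d, h)" for f
  proof -
    obtain I cs u where f: "f = (\<lambda>xs\<in>tuples A d.
        h (map (\<lambda>i. if i \<in> I then xs ! (u + card {j\<in>I. j < i}) else cs ! i) [0..<Suc d]))"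
      and I: "I \<subseteq> {..<Suc d}" "cs \<in> tuples A (Suc d)" "u + card I \<le> d"
      using f by (auto simp: trl_def)
    define gs where "gs = map (\<lambda>i. if i \<in> I then (\<lambda>xs\<in>tuples A d. xs ! (u + card {j\<in>I. j < i}))
      else (\<lambda>xs\<in>tuples A d. cs ! i)) [0..<Suc d]"
    have gs_nth: "gs ! i = (if i \<in> I then (\<lambda>xs\<in>tuples A d. xs ! (u + card {j\<in>I. j < i}))
      else (\<lambda>xs\<in>tuples A d. cs ! i))" if "i < Suc d" for i
      using that by (simp add: gs_def del: upt_Suc)
    have len: "length gs = Suc d" by (simp add: gs_def)
    have gsM: "g \<in> M" if g: "g \<in> set gs" for g
    proof -
      obtain i where i: "i < Suc d" and gi: "g = gs ! i" using g len by (metis in_set_conv_nth)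
      show ?thesis
      proof (cases "i \<in> I")
        case True
        have "card {j\<in>I. j < i} < card I"
          using True I(1) by (intro psubset_card_mono) (auto intro: finite_subset)
        then show ?thesis using True gi gs_nth[OF i] I(3) clone_projection[OF C] MC by (simp add: ary_part_def)
      next
        case False
        have "cs ! i \<in> A" using I(2) i by (auto simp: tuples_def subset_iff)
        then show ?thesis using False gi gs_nth[OF i] const by (auto simp: const_ops_def)
      qed
    qed
    obtain k where k: "k < Suc d" "k \<notin> I"
    proof -
      have "card I < card {..<Suc d}" using I(3) by simp
      then have "I \<noteq> {..<Suc d}" by blast
      then show thesis using that I(1) by auto
    qed
    have "cs ! k \<in> A" using I(2) k by (auto simp: tuples_def subset_iff)
    \<comment> \<open>\<open>f0\<close> substitutes only the constant at place \<open>k\<close> and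
      lies in \<open>M\<close> because \<open>h\<close> is in \<open>circledast\<close>. Composing
      it with the remaining projections and constants gives \<open>f\<close>.\<close>
    define f0 where "f0 = (\<lambda>xs\<in>tuples A d. h (take k xs @ [cs ! k] @ drop k xs))"
    have "f0 \<in> M" unfolding f0_def using eb ebtrlI[of k d "cs ! k" A h] k \<open>cs ! k \<in> A\<close> by auto
    moreover have del: "length (delete_at k gs) = d" "set (delete_at k gs) \<subseteq> M"
      using len k gsM by (auto simp: delete_at_def dest: in_set_takeD in_set_dropD)
    ultimately have "(\<lambda>xs\<in>tuples A d. f0 (map (\<lambda>g. g xs) (delete_at k gs))) \<in> M"
      using fragment_compose[OF C, of f0 d "delete_at k gs"] MC by simp
    moreover have "(\<lambda>xs\<in>tuples A d. f0 (map (\<lambda>g. g xs) (delete_at k gs))) = f"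
      unfolding f
    proof (rule restrict_ext)
      fix xs assume xs: "xs \<in> tuples A d"
      define zs where "zs = map (\<lambda>g. g xs) gs"
      have zs: "zs = map (\<lambda>i. if i \<in> I then xs ! (u + card {j\<in>I. j < i}) else cs ! i) [0..<Suc d]"
        unfolding zs_def gs_def map_map using xs by (intro map_cong) auto
      have zk: "zs ! k = cs ! k" using zs k by (simp del: upt_Suc)
      have lz: "length zs = Suc d" using len by (simp add: zs_def)
      have del_zs: "map (\<lambda>g. g xs) (delete_at k gs) = delete_at k zs"
        by (simp add: zs_def delete_at_def take_map drop_map)
      have "M \<subseteq> tuples A d \<rightarrow>\<^sub>E A" using M by (auto simp: clone_fragment_def ops_def)
      then have "map (\<lambda>g. g xs) (delete_at k gs) \<in> tuples A d"
        using del xs by (intro map_app_in_tuples) auto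
      then have "f0 (map (\<lambda>g. g xs) (delete_at k gs)) = h (insert_at k (cs ! k) (delete_at k zs))"
        using del_zs by (simp add: f0_def insert_at_def)
      also have "\<dots> = h zs" using insert_at_delete_at[of k zs "cs ! k"] zk k lz
        by (metis list_update_id)
      finally show "f0 (map (\<lambda>g. g xs) (delete_at k gs))
          = h (map (\<lambda>i. if i \<in> I then xs ! (u + card {j\<in>I. j < i}) else cs ! i) [0..<Suc d])"
        by (simp only: zs)
    qed
    ultimately show "f \<in> M" by simp
  qed
  then show ?thesis using h_ops by (auto simp: star_def Op_def)
qed

text \<open>A member of \<open>Delta\<close> is \<open>h\<close> composed with the projections, the
  \<open>i\<close>-th of which is inserted once more at place \<open>j\<close>. So it lies in the
  clone \<open>star A d M\<close>, whose \<open>d\<close>-ary part is contained in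
  \<open>M\<close>.\<close>

lemma simple_transitive_of_clone_star:
  assumes M: "clone_fragment A d M" and C: "clone A (star A d M)" and d: "1 \<le> d" and A: "A \<noteq> {}"
  shows "simple_transitive A A d M"
  unfolding simple_transitive_def
proof (intro UN_least subsetI)
  fix h f assume h: "h \<in> circledast A A d M" and "f \<in> Delta A d h"
  then obtain i j where f: "f = (\<lambda>xs\<in>tuples A d. h (take j xs @ [xs ! i] @ drop j xs))" and ij: "i < j" "j \<le> d"
    by (auto simp: Delta_def)
  let ?P = "projections A d"
  let ?gs = "take j ?P @ [?P ! i] @ drop j ?P"
  have const: "const_ops A d \<subseteq> M" using const_ops_subset_of_clone_star[OF C] .
  have "(length ?gs, h) \<in> star A d M"
    using circledast_subset_star[OF M const d h] ij by simp
  moreover have "(d, g) \<in> star A d M" if "g \<in> set ?gs" for g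
    using that ij by (intro clone_projections[OF C]) (auto dest: in_set_takeD in_set_dropD)
  ultimately have "(d, \<lambda>xs\<in>tuples A d. h (map (\<lambda>g. g xs) ?gs)) \<in> star A d M"
    by (rule clone_compose[OF C])
  moreover have "(\<lambda>xs\<in>tuples A d. h (map (\<lambda>g. g xs) ?gs)) = f"
    unfolding f
  proof (rule restrict_ext)
    fix xs assume xs: "xs \<in> tuples A d"
    have "(?P ! i) xs = xs ! i" using ij xs by (simp add: projections_def)
    then have "map (\<lambda>g. g xs) ?gs = take j xs @ [xs ! i] @ drop j xs"
      using map_projections[OF xs] by (simp add: take_map[symmetric] drop_map[symmetric])
    then show "h (map (\<lambda>g. g xs) ?gs) = h (take j xs @ [xs ! i] @ drop j xs)" by (simp only:)
  qed
  ultimately have "f \<in> ary_part d (star A d M)" by (simp add: ary_part_def)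
  then show "f \<in> M" using ary_part_star_subset[OF A] by blast
qed

lemma set_tl_subset: "set (tl xs) \<subseteq> set xs"
  by (cases xs) auto

text \<open>Adding a fictitious variable to \<open>f\<close> and then substituting a constant
  amounts to composing \<open>f\<close> with projections and at most one constant operation.\<close>

lemma simple_int_reflexive_of_fragment:
  assumes M: "clone_fragment A d M" and const: "const_ops A d \<subseteq> M" and d: "1 \<le> d"
  shows "simple_int_reflexive A A d M"
  unfolding simple_int_reflexive_def
proof (intro UN_least subsetI)
  obtain C where C: "clone A C" and MC: "M = ary_part d C" using M clone_fragment_iff[OF d] by blast
  fix f h assume f: "f \<in> M" and h: "h \<in> eftrl A d f"
  \<comment> \<open>Treats \<open>tl\<close> and \<open>butlast\<close> uniformly. Two copies are
    needed because the deletion acts on tuples as well as on lists of operations, and an obtained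
    function has only one type.\<close>
  then obtain del :: "'a list \<Rightarrow> 'a list" and Del :: "('a list \<Rightarrow> 'a) list \<Rightarrow> ('a list \<Rightarrow> 'a) list"
    where h: "h = (\<lambda>xs\<in>tuples A (Suc d). f (del xs))"
      and del: "\<And>xs. xs \<in> tuples A (Suc d) \<Longrightarrow> del xs \<in> tuples A d"
      and Del: "\<And>gs. set (Del gs) \<subseteq> set gs" "\<And>gs. length (Del gs) = length gs - 1"
        "\<And>xs gs. map (\<lambda>g. g xs) (Del gs) = del (map (\<lambda>g. g xs) gs)"
  proof -
    have "h = (\<lambda>xs\<in>tuples A (Suc d). f (tl xs)) \<or> h = (\<lambda>xs\<in>tuples A (Suc d). f (butlast xs))"
      using h by (auto simp: eftrl_def)
    then show thesis
    proof
      assume "h = (\<lambda>xs\<in>tuples A (Suc d). f (tl xs))"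
      then show thesis
        by (rule that[of tl tl]) (auto simp: map_tl tuples_tl dest: subsetD[OF set_tl_subset])
    next
      assume "h = (\<lambda>xs\<in>tuples A (Suc d). f (butlast xs))"
      then show thesis
        by (rule that[of butlast butlast]) (auto simp: map_butlast tuples_butlast dest: in_set_butlastD)
    qed
  qed
  have "(\<lambda>xs\<in>tuples A d. h (take i xs @ [c] @ drop i xs)) \<in> M" if i: "i \<le> d" and c: "c \<in> A" for i c
  proof -
    let ?P = "projections A d"
    let ?gs = "take i ?P @ [\<lambda>xs\<in>tuples A d. c] @ drop i ?P"
    have "set ?P \<subseteq> M" using clone_projections[OF C] MC by (auto simp: ary_part_def)
    moreover have "(\<lambda>xs\<in>tuples A d. c) \<in> M" using const c by (auto simp: const_ops_def)
    ultimately have "set ?gs \<subseteq> M" using set_take_subset[of i ?P] set_drop_subset[of i ?P] by auto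
    then have "set (Del ?gs) \<subseteq> ary_part d C" using Del(1)[of ?gs] MC by blast
    moreover have "length (Del ?gs) = d" using Del(2) by simp
    ultimately have "(\<lambda>xs\<in>tuples A d. f (map (\<lambda>g. g xs) (Del ?gs))) \<in> M"
      using fragment_compose[OF C] f MC by blast
    moreover have "(\<lambda>xs\<in>tuples A d. f (map (\<lambda>g. g xs) (Del ?gs)))
        = (\<lambda>xs\<in>tuples A d. h (take i xs @ [c] @ drop i xs))"
    proof (rule restrict_ext)
      fix xs assume xs: "xs \<in> tuples A d"
      have "map (\<lambda>g. g xs) ?gs = take i xs @ [c] @ drop i xs"
        using map_projections[OF xs] xs by (simp add: take_map[symmetric] drop_map[symmetric])
      then show "f (map (\<lambda>g. g xs) (Del ?gs)) = h (take i xs @ [c] @ drop i xs)"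
        using tuples_insert[OF xs c, of i] by (simp add: Del(3) h)
    qed
    ultimately show ?thesis by simp
  qed
  then have "ebtrl A d h \<subseteq> M" by (auto simp: ebtrl_def)
  moreover have "f \<in> tuples A d \<rightarrow>\<^sub>E A" using M f by (auto simp: clone_fragment_def ops_def)
  then have "h \<in> tuples A (Suc d) \<rightarrow>\<^sub>E A" using del by (auto simp: h)
  ultimately show "h \<in> circledast A A d M" by (simp add: circledast_def)
qed

section \<open>Transport of a fragment to an arity over a copy of its base set\<close>

lemma points_Nil [simp]: "points [] = {[]}"
  by (auto simp: points_def)

lemma points_single: "points [(B, d)] = (\<lambda>x. [x]) ` tuples B d"
  by (auto simp: points_def list_all2_Cons2)

definition recode :: "'b set \<Rightarrow> ('b \<Rightarrow> 'a) \<Rightarrow> nat \<Rightarrow> ('a list \<Rightarrow> 'a) \<Rightarrow> 'b list list \<Rightarrow> 'a" where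
  "recode B e' d f = (\<lambda>X\<in>points [(B, d)]. f (map e' (hd X)))"

text \<open>The curried form of \<open>recode\<close>. Deleting the only coordinate leaves the empty
  arity, whose single point is \<open>[]\<close>; hence the values are functions on a singleton
  instead of elements of \<open>A\<close>.\<close>

definition recode_simple :: "'b set \<Rightarrow> ('b \<Rightarrow> 'a) \<Rightarrow> nat \<Rightarrow> ('a list \<Rightarrow> 'a) \<Rightarrow> 'b list \<Rightarrow> 'b list list \<Rightarrow> 'a" where
  "recode_simple B e' d f = (\<lambda>x\<in>tuples B d. \<lambda>Y\<in>{[]}. f (map e' x))"

context
  fixes A :: "'a set" and B :: "'b set" and e :: "'a \<Rightarrow> 'b" and e' :: "'b \<Rightarrow> 'a"
  assumes e: "\<And>a. a \<in> A \<Longrightarrow> e a \<in> B \<and> e' (e a) = a"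
    and e': "\<And>b. b \<in> B \<Longrightarrow> e' b \<in> A \<and> e (e' b) = b"
begin

lemma map_e'_in_tuples: "x \<in> tuples B d \<Longrightarrow> map e' x \<in> tuples A d"
  using e' by (auto simp: tuples_def)

lemma map_e_in_tuples: "x \<in> tuples A d \<Longrightarrow> map e x \<in> tuples B d"
  using e by (auto simp: tuples_def)

lemma map_e'_e: "x \<in> tuples A d \<Longrightarrow> map e' (map e x) = x"
  using e by (auto simp: tuples_def intro!: map_idI)

lemma map_e_e': "x \<in> tuples B d \<Longrightarrow> map e (map e' x) = x"
  using e' by (auto simp: tuples_def intro!: map_idI)

lemma curry_at_recode: "curry_at [(B, d)] 0 (recode B e' d f) = recode_simple B e' d f"
  by (auto simp: curry_at_def recode_def recode_simple_def delete_at_def insert_at_def points_single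
      intro!: restrict_ext)

lemma recode_mem: "f \<in> ops A d \<Longrightarrow> recode B e' d f \<in> points [(B, d)] \<rightarrow>\<^sub>E A"
  using map_e'_in_tuples by (auto simp: recode_def ops_def points_single)

lemma recode_inj:
  assumes "f \<in> ops A d" "g \<in> ops A d" "recode B e' d f = recode B e' d g"
  shows "f = g"
proof (rule PiE_ext)
  show "f \<in> tuples A d \<rightarrow>\<^sub>E A" "g \<in> tuples A d \<rightarrow>\<^sub>E A" using assms by (auto simp: ops_def)
  fix x assume x: "x \<in> tuples A d"
  then have "[map e x] \<in> points [(B, d)]" using map_e_in_tuples by (auto simp: points_single)
  then show "f x = g x"
    using fun_cong[OF assms(3), of "[map e x]"] map_e'_e[OF x] by (simp add: recode_def)
qed

lemma simple_int_reflexive_recode: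
  assumes M: "M \<subseteq> ops A d" and refl: "simple_int_reflexive A A d M"
  shows "simple_int_reflexive ({[]} \<rightarrow>\<^sub>E A) B d (recode_simple B e' d ` M)"
  unfolding simple_int_reflexive_def
proof (intro UN_least subsetI)
  fix k h assume "k \<in> recode_simple B e' d ` M" and h: "h \<in> eftrl B d k"
  then obtain f where f: "f \<in> M" and k: "k = recode_simple B e' d f" by blast
  have fA: "f \<in> tuples A d \<rightarrow> A" using M f by (auto simp: ops_def)
  obtain del :: "'b list \<Rightarrow> 'b list" and del' :: "'a list \<Rightarrow> 'a list"
    where h: "h = (\<lambda>xs\<in>tuples B (Suc d). k (del xs))"
      and del: "\<And>xs. xs \<in> tuples B (Suc d) \<Longrightarrow> del xs \<in> tuples B d"
      and map_del: "\<And>xs. map e' (del xs) = del' (map e' xs)"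
      and M': "\<And>i c. i \<le> d \<Longrightarrow> c \<in> A \<Longrightarrow> (\<lambda>xs\<in>tuples A d. f (del' (take i xs @ c # drop i xs))) \<in> M"
  proof -
    have "h = (\<lambda>xs\<in>tuples B (Suc d). k (tl xs)) \<or> h = (\<lambda>xs\<in>tuples B (Suc d). k (butlast xs))"
      using h by (auto simp: eftrl_def)
    then show thesis
    proof
      assume "h = (\<lambda>xs\<in>tuples B (Suc d). k (tl xs))"
      then show thesis
        by (rule that[of tl tl]) (auto simp: map_tl tuples_tl simple_int_reflexiveD(1)[OF refl f])
    next
      assume "h = (\<lambda>xs\<in>tuples B (Suc d). k (butlast xs))"
      then show thesis
        by (rule that[of butlast butlast])
          (auto simp: map_butlast tuples_butlast simple_int_reflexiveD(2)[OF refl f])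
    qed
  qed
  have "(\<lambda>xs\<in>tuples B d. h (take i xs @ [c] @ drop i xs)) \<in> recode_simple B e' d ` M" if "i \<le> d" "c \<in> B" for i c
  proof (rule image_eqI)
    show "(\<lambda>xs\<in>tuples A d. f (del' (take i xs @ e' c # drop i xs))) \<in> M"
      using M' that e' by blast
    show "(\<lambda>xs\<in>tuples B d. h (take i xs @ [c] @ drop i xs))
        = recode_simple B e' d (\<lambda>xs\<in>tuples A d. f (del' (take i xs @ e' c # drop i xs)))"
      unfolding recode_simple_def
    proof (rule restrict_ext)
      fix xs assume xs: "xs \<in> tuples B d"
      then have 1: "take i xs @ c # drop i xs \<in> tuples B (Suc d)" using that(2) by (rule tuples_insert)
      then show "h (take i xs @ [c] @ drop i xs) = (\<lambda>Y\<in>{[]}. (\<lambda>xs\<in>tuples A d. f (del' (take i xs @ e' c # drop i xs))) (map e' xs))"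
        using del[OF 1] map_e'_in_tuples[OF xs] map_del[of "take i xs @ c # drop i xs"]
        by (simp add: h k recode_simple_def take_map drop_map)
    qed
  qed
  then have "ebtrl B d h \<subseteq> recode_simple B e' d ` M" by (auto simp: ebtrl_def)
  moreover have "h \<in> tuples B (Suc d) \<rightarrow>\<^sub>E ({[]} \<rightarrow>\<^sub>E A)"
    using del map_e'_in_tuples fA by (auto simp: h k recode_simple_def split: if_splits)
  ultimately show "h \<in> circledast ({[]} \<rightarrow>\<^sub>E A) B d (recode_simple B e' d ` M)" by (simp add: circledast_def)
qed

lemma simple_transitive_recode:
  assumes M: "M \<subseteq> ops A d" and trans: "simple_transitive A A d M"
  shows "simple_transitive ({[]} \<rightarrow>\<^sub>E A) B d (recode_simple B e' d ` M)"
  unfolding simple_transitive_def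
proof (intro UN_least subsetI)
  fix h k assume h: "h \<in> circledast ({[]} \<rightarrow>\<^sub>E A) B d (recode_simple B e' d ` M)" and k: "k \<in> Delta B d h"
  have hV: "h \<in> tuples B (Suc d) \<rightarrow>\<^sub>E ({[]} \<rightarrow>\<^sub>E A)" and eb: "ebtrl B d h \<subseteq> recode_simple B e' d ` M"
    using h by (auto simp: circledast_def)
  \<comment> \<open>The function over \<open>A\<close> that corresponds to \<open>h\<close>:
    arguments are transported along \<open>e\<close>, and values are evaluated at the only point
    \<open>[]\<close>.\<close>
  define h' where "h' = (\<lambda>xs\<in>tuples A (Suc d). h (map e xs) [])"
  have "(\<lambda>xs\<in>tuples A d. h' (take i xs @ [c] @ drop i xs)) \<in> M" if i: "i \<le> d" and c: "c \<in> A" for i c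
  proof -
    have "(\<lambda>xs\<in>tuples B d. h (take i xs @ [e c] @ drop i xs)) \<in> recode_simple B e' d ` M"
      using eb ebtrlI[of i d "e c" B h] e[OF c] i by blast
    then obtain f where f: "f \<in> M" "(\<lambda>xs\<in>tuples B d. h (take i xs @ [e c] @ drop i xs)) = recode_simple B e' d f"
      by blast
    have "h' (take i xs @ [c] @ drop i xs) = f xs" if xs: "xs \<in> tuples A d" for xs
      using fun_cong[OF fun_cong[OF f(2), of "map e xs"], of "[]"] xs c
      by (simp add: h'_def recode_simple_def map_e_in_tuples map_e'_e tuples_insert take_map drop_map del: map_map)
    then have "(\<lambda>xs\<in>tuples A d. h' (take i xs @ [c] @ drop i xs)) = restrict f (tuples A d)"
      by (intro restrict_ext)
    moreover have "restrict f (tuples A d) = f"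
      using f(1) M by (intro extensional_restrict) (auto simp: ops_def PiE_def)
    ultimately show ?thesis using f(1) by simp
  qed
  then have "ebtrl A d h' \<subseteq> M" by (auto simp: ebtrl_def)
  moreover have "h' \<in> tuples A (Suc d) \<rightarrow>\<^sub>E A"
    using hV map_e_in_tuples[of _ "Suc d"] by (fastforce simp: h'_def)
  ultimately have h': "h' \<in> circledast A A d M" by (simp add: circledast_def)
  obtain i j where k: "k = (\<lambda>xs\<in>tuples B d. h (take j xs @ [xs ! i] @ drop j xs))" and ij: "i < j" "j \<le> d"
    using k by (auto simp: Delta_def)
  let ?f = "\<lambda>xs\<in>tuples A d. h' (take j xs @ [xs ! i] @ drop j xs)"
  have "Delta A d h' \<subseteq> M"
    by (rule UN_subset_iff[THEN iffD1, rule_format, OF trans[unfolded simple_transitive_def] h'])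
  then have "?f \<in> M" by (rule subsetD) (rule DeltaI[OF ij])
  moreover have "k = recode_simple B e' d ?f"
    unfolding k recode_simple_def
  proof (rule restrict_ext)
    fix xs assume xs: "xs \<in> tuples B d"
    have xi: "xs ! i \<in> B" "i < length xs" using xs ij by (auto simp: tuples_def subset_iff)
    have 1: "take j xs @ xs ! i # drop j xs \<in> tuples B (Suc d)" by (rule tuples_insert[OF xs xi(1)])
    have 2: "h (take j xs @ xs ! i # drop j xs) \<in> {[]} \<rightarrow>\<^sub>E A" by (rule PiE_mem[OF hV 1])
    have 3: "map e' (take j xs @ xs ! i # drop j xs)
        = take j (map e' xs) @ (map e' xs) ! i # drop j (map e' xs)"
      using xi(2) by (simp add: take_map drop_map)
    have "?f (map e' xs) = h' (map e' (take j xs @ xs ! i # drop j xs))"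
      using map_e'_in_tuples[OF xs] by (simp only: 3 restrict_apply append_Cons append_Nil if_True)
    also have "\<dots> = h (take j xs @ xs ! i # drop j xs) []"
      unfolding h'_def using map_e'_in_tuples[OF 1] map_e_e'[OF 1] by (simp only: restrict_apply if_True)
    finally have 4: "?f (map e' xs) = h (take j xs @ xs ! i # drop j xs) []" .
    have "h (take j xs @ xs ! i # drop j xs) = (\<lambda>Y\<in>{[]}. ?f (map e' xs))"
    proof (rule extensionalityI)
      show "h (take j xs @ xs ! i # drop j xs) \<in> extensional {[]}" using 2 by (simp only: PiE_iff)
      show "(\<lambda>Y\<in>{[]}. ?f (map e' xs)) \<in> extensional {[]}" by (rule restrict_extensional)
      show "h (take j xs @ xs ! i # drop j xs) Y = (\<lambda>Y\<in>{[]}. ?f (map e' xs)) Y" if "Y \<in> {[]}" for Y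
        using that 4 by (simp only: singleton_iff restrict_apply simp_thms if_True)
    qed
    then show "h (take j xs @ [xs ! i] @ drop j xs) = (\<lambda>Y\<in>{[]}. ?f (map e' xs))"
      by (simp only: append_Cons append_Nil)
  qed
  ultimately show "k \<in> recode_simple B e' d ` M" by blast
qed

lemma generalized_quasiorder_recode:
  assumes M: "clone_fragment A d M" and C: "clone A (star A d M)" and d: "1 \<le> d" and A: "A \<noteq> {}"
  shows "generalized_quasiorder A [(B, d)] (recode B e' d ` M)"
proof -
  have sub: "M \<subseteq> ops A d" using M by (simp add: clone_fragment_def)
  have const: "const_ops A d \<subseteq> M" using const_ops_subset_of_clone_star[OF C] .
  have img: "curry_at [(B, d)] 0 ` recode B e' d ` M = recode_simple B e' d ` M"
    by (simp add: image_image curry_at_recode)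
  have "int_reflexive A [(B, d)] (recode B e' d ` M)"
    using simple_int_reflexive_recode[OF sub simple_int_reflexive_of_fragment[OF M const d]]
    by (simp add: int_reflexive_def img delete_at_def)
  moreover have "transitive A [(B, d)] (recode B e' d ` M)"
    using simple_transitive_recode[OF sub simple_transitive_of_clone_star[OF M C d A]]
    by (simp add: transitive_def img delete_at_def)
  moreover have "(\<lambda>X\<in>points [(B, d)]. a) \<in> recode B e' d ` M" if "a \<in> A" for a
  proof (rule image_eqI)
    show "(\<lambda>xs\<in>tuples A d. a) \<in> M" using const that by (auto simp: const_ops_def)
    show "(\<lambda>X\<in>points [(B, d)]. a) = recode B e' d (\<lambda>xs\<in>tuples A d. a)"
      unfolding recode_def by (rule restrict_ext) (auto simp: points_single map_e'_in_tuples)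
  qed
  ultimately show ?thesis using recode_mem sub by (auto simp: generalized_quasiorder_def)
qed

text \<open>Preservation of the coded fragment thereby becomes closure of the fragment under
  composition.\<close>

lemma pointwise_recode:
  assumes gs: "set gs \<subseteq> ops A d"
  shows "pointwise [(B, d)] f (map (recode B e' d) gs) = recode B e' d (\<lambda>xs\<in>tuples A d. f (map (\<lambda>g. g xs) gs))"
  unfolding pointwise_def recode_def
proof (rule restrict_ext)
  fix X assume X: "X \<in> points [(B, d)]"
  then have "map e' (hd X) \<in> tuples A d" using map_e'_in_tuples by (auto simp: points_single)
  then show "f (map (\<lambda>g. g X) (map (\<lambda>f. \<lambda>X\<in>points [(B, d)]. f (map e' (hd X))) gs))
      = (\<lambda>xs\<in>tuples A d. f (map (\<lambda>g. g xs) gs)) (map e' (hd X))"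
    using X by (simp add: comp_def)
qed

text \<open>Members of \<open>M\<close> preserve the coding because \<open>M\<close> is closed under
  composition. Conversely, an operation that preserves it is applied to the coded projections; the
  result is its own code, so it belongs to \<open>M\<close>.\<close>

lemma Pol_recode:
  assumes M: "clone_fragment A d M" and d: "1 \<le> d"
  shows "ary_part d (Pol_rrel A {([(B, d)], recode B e' d ` M)}) = M"
proof
  obtain C where C: "clone A C" and MC: "M = ary_part d C" using M clone_fragment_iff[OF d] by blast
  have sub: "M \<subseteq> ops A d" using M by (simp add: clone_fragment_def)
  show "M \<subseteq> ary_part d (Pol_rrel A {([(B, d)], recode B e' d ` M)})"
  proof
    fix f assume f: "f \<in> M"
    have "pointwise [(B, d)] f hs \<in> recode B e' d ` M" if "length hs = d" "set hs \<subseteq> recode B e' d ` M" for hs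
    proof -
      have "hs \<in> map (recode B e' d) ` lists M"
        using that(2) by (simp add: lists_image[symmetric] in_lists_conv_set subset_iff)
      then obtain gs where gs: "hs = map (recode B e' d) gs" "set gs \<subseteq> M" by auto
      then have "(\<lambda>xs\<in>tuples A d. f (map (\<lambda>g. g xs) gs)) \<in> M"
        using fragment_compose[OF C, of f d gs] f MC that(1) by simp
      then show ?thesis using pointwise_recode[of gs d f] gs sub by auto
    qed
    then show "f \<in> ary_part d (Pol_rrel A {([(B, d)], recode B e' d ` M)})"
      using f sub d by (auto simp: ary_part_def Pol_rrel_def preserves_rrel_iff Op_def)
  qed
  show "ary_part d (Pol_rrel A {([(B, d)], recode B e' d ` M)}) \<subseteq> M"
  proof
    fix f assume "f \<in> ary_part d (Pol_rrel A {([(B, d)], recode B e' d ` M)})"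
    then have f: "f \<in> ops A d" and pres: "\<And>hs. length hs = d \<Longrightarrow> set hs \<subseteq> recode B e' d ` M \<Longrightarrow>
        pointwise [(B, d)] f hs \<in> recode B e' d ` M"
      by (auto simp: ary_part_def Pol_rrel_def preserves_rrel_iff Op_def)
    let ?P = "projections A d"
    have P: "set ?P \<subseteq> M" using clone_projections[OF C] MC by (auto simp: ary_part_def)
    then have "pointwise [(B, d)] f (map (recode B e' d) ?P) \<in> recode B e' d ` M" by (intro pres) auto
    moreover have "(\<lambda>xs\<in>tuples A d. f (map (\<lambda>g. g xs) ?P)) = restrict f (tuples A d)"
      by (intro restrict_ext) (simp add: map_projections)
    moreover have "restrict f (tuples A d) = f"
      using f by (intro extensional_restrict) (auto simp: ops_def PiE_def)
    ultimately have "recode B e' d f \<in> recode B e' d ` M" using pointwise_recode[of ?P d f] P sub by auto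
    then obtain g where g: "g \<in> M" "recode B e' d f = recode B e' d g" by blast
    then have "f = g" using recode_inj[of f d g] f sub by blast
    then show "f \<in> M" using g by simp
  qed
qed

end

lemma fragment_rrel_eq_recode:
  "fragment_rrel A e d M = ([({..<card A}, d)], recode {..<card A} (inv_into A e) d ` M)"
  by (simp add: fragment_rrel_def Let_def recode_def)

section \<open>Ordinary relations\<close>

definition rowwise :: "('a list \<Rightarrow> 'a) \<Rightarrow> 'a list list \<Rightarrow> 'a list" where
  "rowwise f rs = map (\<lambda>i. f (map (\<lambda>r. r ! i) rs)) [0..<length (hd rs)]"

lemma preserves_iff:
  "preserves (n, f) \<rho> \<longleftrightarrow> (\<forall>rs. length rs = n \<and> set rs \<subseteq> \<rho> \<longrightarrow> rowwise f rs \<in> \<rho>)"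
  by (simp add: preserves_def rowwise_def)

lemma rowwise_eq:
  "rs \<noteq> [] \<Longrightarrow> set rs \<subseteq> tuples A m \<Longrightarrow> rowwise f rs = map (\<lambda>i. f (map (\<lambda>r. r ! i) rs)) [0..<m]"
  by (cases rs) (auto simp: rowwise_def tuples_def)

lemma column_in_tuples:
  "set rs \<subseteq> tuples A m \<Longrightarrow> i < m \<Longrightarrow> length rs = n \<Longrightarrow> map (\<lambda>r. r ! i) rs \<in> tuples A n"
  by (fastforce simp: tuples_def)

lemma rowwise_in_tuples:
  assumes "f \<in> ops A (length rs)" "rs \<noteq> []" "set rs \<subseteq> tuples A m"
  shows "rowwise f rs \<in> tuples A m"
proof -
  have "f (map (\<lambda>r. r ! i) rs) \<in> A" if "i < m" for i
    using column_in_tuples[OF assms(3) that refl] assms(1) by (auto simp: ops_def)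
  then show ?thesis using assms(2,3) by (auto simp: rowwise_eq tuples_def)
qed

lemma rowwise_projection:
  assumes "set rs \<subseteq> tuples A m" "i < length rs"
  shows "rowwise (\<lambda>xs\<in>tuples A (length rs). xs ! i) rs = rs ! i"
proof -
  have "rs ! i \<in> tuples A m" "rs \<noteq> []" using assms by auto
  then show ?thesis
    using assms column_in_tuples[OF assms(1)] unfolding rowwise_eq[OF \<open>rs \<noteq> []\<close> assms(1)]
    by (intro nth_equalityI) (auto simp: tuples_def)
qed

lemma Pol_clone:
  assumes Q: "Q \<subseteq> Rel A"
  shows "clone A (Pol A Q)"
proof (rule cloneI)
  show "Pol A Q \<subseteq> Op A" by (auto simp: Pol_def)
next
  fix n i :: nat assume i: "i < n"
  have "rowwise (\<lambda>xs\<in>tuples A n. xs ! i) rs \<in> \<rho>" if "\<rho> \<in> Q" "length rs = n" "set rs \<subseteq> \<rho>" for \<rho> rs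
  proof -
    obtain m where "\<rho> \<subseteq> tuples A m" using Q \<open>\<rho> \<in> Q\<close> by (auto simp: Rel_def)
    then have "rowwise (\<lambda>xs\<in>tuples A n. xs ! i) rs = rs ! i"
      using rowwise_projection[of rs A m i] that i by auto
    then show ?thesis using that i by (metis nth_mem subsetD)
  qed
  then show "(n, \<lambda>xs\<in>tuples A n. xs ! i) \<in> Pol A Q"
    using clone_projection[OF clone_Op i, of A] by (auto simp: Pol_def preserves_iff)
next
  fix m f and gs :: "('a list \<Rightarrow> 'a) list"
  assume f: "(length gs, f) \<in> Pol A Q" and g: "\<And>g. g \<in> set gs \<Longrightarrow> (m, g) \<in> Pol A Q" and ne: "gs \<noteq> []"
  let ?h = "\<lambda>xs\<in>tuples A m. f (map (\<lambda>g. g xs) gs)"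
  have h: "(m, ?h) \<in> Op A"
    by (rule clone_compose[OF clone_Op]) (use f g in \<open>auto simp: Pol_def\<close>)
  have "rowwise ?h rs \<in> \<rho>" if \<rho>: "\<rho> \<in> Q" and rs: "length rs = m" "set rs \<subseteq> \<rho>" for \<rho> rs
  proof -
    obtain k where k: "\<rho> \<subseteq> tuples A k" using Q \<rho> by (auto simp: Rel_def)
    then have sub: "set rs \<subseteq> tuples A k" and rs_ne: "rs \<noteq> []" using rs h by (auto simp: Op_def)
    have gs: "rowwise g rs \<in> \<rho>" if "g \<in> set gs" for g
      using g[OF that] \<rho> rs by (auto simp: Pol_def preserves_iff)
    then have "rowwise f (map (\<lambda>g. rowwise g rs) gs) \<in> \<rho>"
      using f \<rho> by (auto simp: Pol_def preserves_iff image_subset_iff)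
    moreover have "rowwise f (map (\<lambda>g. rowwise g rs) gs) = rowwise ?h rs"
    proof -
      have 1: "set (map (\<lambda>g. rowwise g rs) gs) \<subseteq> tuples A k" using gs k by auto
      have "rowwise f (map (\<lambda>g. rowwise g rs) gs)
          = map (\<lambda>i. f (map (\<lambda>r. r ! i) (map (\<lambda>g. rowwise g rs) gs))) [0..<k]"
        by (rule rowwise_eq[OF _ 1]) (use ne in simp)
      also have "\<dots> = map (\<lambda>i. ?h (map (\<lambda>r. r ! i) rs)) [0..<k]"
        using column_in_tuples[OF sub _ rs(1)]
        by (intro map_cong refl) (simp add: rowwise_eq[OF rs_ne sub] comp_def)
      also have "\<dots> = rowwise ?h rs" by (rule rowwise_eq[OF rs_ne sub, symmetric])
      finally show ?thesis .
    qed
    ultimately show ?thesis by simp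
  qed
  then show "(m, ?h) \<in> Pol A Q" using h by (auto simp: Pol_def preserves_iff)
qed

section \<open>Primitive positive formulas and their preservation\<close>

lemma sat_cong: "(\<And>i. i \<in> free_vars \<phi> \<Longrightarrow> v i = w i) \<Longrightarrow> sat A v \<phi> \<longleftrightarrow> sat A w \<phi>"
proof (induction \<phi> arbitrary: v w)
  case (PRel \<sigma> "is")
  then have "map v is = map w is" by simp
  then show ?case by (simp only: sat.simps)
next
  case (PAnd \<phi> \<psi>)
  have "sat A v \<phi> \<longleftrightarrow> sat A w \<phi>" by (rule PAnd.IH(1)) (use PAnd.prems in simp)
  moreover have "sat A v \<psi> \<longleftrightarrow> sat A w \<psi>" by (rule PAnd.IH(2)) (use PAnd.prems in simp)
  ultimately show ?case by simp
next
  case (PEx i \<phi>)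
  have "sat A (v(i := a)) \<phi> \<longleftrightarrow> sat A (w(i := a)) \<phi>" for a
    by (rule PEx.IH) (use PEx.prems in auto)
  then show ?case by simp
qed simp

text \<open>Formulas of this kind contain neither negation nor disjunction, so \<open>f\<close> can
  be applied to satisfying assignments pointwise. For a quantifier, \<open>f\<close> applied to the
  chosen witnesses is a witness again.\<close>

lemma sat_preserved:
  assumes f: "(n, f) \<in> Pol A Q"
  shows "pp_over A Q \<phi> \<Longrightarrow> length vs = n \<Longrightarrow> (\<And>v. v \<in> set vs \<Longrightarrow> sat A v \<phi>) \<Longrightarrow>
    sat A (\<lambda>i. f (map (\<lambda>v. v i) vs)) \<phi>"
proof (induction \<phi> arbitrary: vs)
  case (PRel \<sigma> "is")
  have "vs \<noteq> []" using f PRel.prems(2) by (auto simp: Pol_def Op_def)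
  moreover have "rowwise f (map (\<lambda>v. map v is) vs) \<in> \<sigma>"
  proof -
    have "set (map (\<lambda>v. map v is) vs) \<subseteq> \<sigma>" using PRel.prems(3) by auto
    moreover have "preserves (n, f) \<sigma>" using f PRel.prems(1) by (auto simp: Pol_def)
    ultimately show ?thesis using PRel.prems(2) by (simp add: preserves_iff)
  qed
  moreover have "rowwise f (map (\<lambda>v. map v is) vs) = map (\<lambda>k. f (map (\<lambda>v. v (is ! k)) vs)) [0..<length is]"
  proof -
    have "length (hd (map (\<lambda>v. map v is) vs)) = length is" using \<open>vs \<noteq> []\<close> by (cases vs) auto
    then show ?thesis unfolding rowwise_def by (intro map_cong) (auto simp: comp_def)
  qed
  moreover have "map (\<lambda>k. f (map (\<lambda>v. v (is ! k)) vs)) [0..<length is] = map (\<lambda>i. f (map (\<lambda>v. v i) vs)) is"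
    by (intro nth_equalityI) auto
  ultimately show ?case by simp
next
  case (PEq i j)
  then have "map (\<lambda>v. v i) vs = map (\<lambda>v. v j) vs" by simp
  then show ?case by (simp only: sat.simps)
next
  case (PEx j \<phi>)
  have "\<forall>v\<in>set vs. \<exists>a. a \<in> A \<and> sat A (v(j := a)) \<phi>" using PEx.prems by auto
  then obtain a where a: "\<forall>v\<in>set vs. a v \<in> A \<and> sat A (v(j := a v)) \<phi>" by metis
  have "map a vs \<in> tuples A n" using a PEx.prems(2) by (auto simp: tuples_def)
  then have "f (map a vs) \<in> A" using f by (auto simp: Pol_def Op_def ops_def)
  moreover have "sat A (\<lambda>i. f (map (\<lambda>v. v i) (map (\<lambda>v. v(j := a v)) vs))) \<phi>"
    by (rule PEx.IH) (use a PEx.prems in auto)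
  moreover have "(\<lambda>i. f (map (\<lambda>v. v i) (map (\<lambda>v. v(j := a v)) vs)))
      = (\<lambda>i. f (map (\<lambda>v. v i) vs))(j := f (map a vs))"
    by (auto simp: fun_eq_iff comp_def)
  ultimately show ?case by auto
qed auto

lemma rel_clone_preserved:
  assumes f: "(n, f) \<in> Pol A Q" and \<sigma>: "\<sigma> \<in> rel_clone A Q"
  shows "preserves (n, f) \<sigma>"
  unfolding preserves_iff
proof (intro allI impI, elim conjE)
  fix rs assume rs: "length rs = n" "set rs \<subseteq> \<sigma>"
  have ne: "rs \<noteq> []" using f rs by (auto simp: Pol_def Op_def)
  \<comment> \<open>This rules out the empty relation, which belongs to \<open>rel_clone\<close> by
    convention and need not come from a formula.\<close>
  then have "\<sigma> \<noteq> {}" using rs by auto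
  then obtain m \<phi> where \<sigma>: "\<sigma> = {xs \<in> tuples A m. sat A (\<lambda>i. xs ! i) \<phi>}"
    and \<phi>: "pp_over A Q \<phi>" "free_vars \<phi> \<subseteq> {..<m}"
    using \<sigma> by (auto simp: rel_clone_def)
  have sub: "set rs \<subseteq> tuples A m" using rs \<sigma> by auto
  have "rowwise f rs \<in> tuples A m"
    using f rs ne sub by (intro rowwise_in_tuples) (auto simp: Pol_def Op_def)
  moreover have "sat A (\<lambda>i. f (map (\<lambda>v. v i) (map nth rs))) \<phi>"
    by (rule sat_preserved[OF f \<phi>(1)]) (use rs \<sigma> in auto)
  moreover have "sat A (\<lambda>i. rowwise f rs ! i) \<phi> \<longleftrightarrow> sat A (\<lambda>i. f (map (\<lambda>v. v i) (map nth rs))) \<phi>"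
  proof (rule sat_cong)
    fix i assume "i \<in> free_vars \<phi>"
    then have "i < m" using \<phi>(2) by auto
    then show "rowwise f rs ! i = f (map (\<lambda>v. v i) (map nth rs))"
      by (simp add: rowwise_eq[OF ne sub] comp_def)
  qed
  ultimately show "rowwise f rs \<in> \<sigma>" unfolding \<sigma> by simp
qed

lemma sat_conj: "sat A v (foldr PAnd \<phi>s (PEq i i)) \<longleftrightarrow> (\<forall>\<phi>\<in>set \<phi>s. sat A v \<phi>)"
  by (induction \<phi>s) auto

lemma pp_over_conj: "pp_over A Q (foldr PAnd \<phi>s (PEq i i)) \<longleftrightarrow> (\<forall>\<phi>\<in>set \<phi>s. pp_over A Q \<phi>)"
  by (induction \<phi>s) auto

lemma free_vars_conj: "free_vars (foldr PAnd \<phi>s (PEq i i)) = insert i (\<Union>\<phi>\<in>set \<phi>s. free_vars \<phi>)"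
  by (induction \<phi>s) auto

lemma sat_foldr_PEx:
  "sat A v (foldr PEx is \<phi>) \<longleftrightarrow>
     (\<exists>w. (\<forall>i\<in>set is. w i \<in> A) \<and> (\<forall>i. i \<notin> set is \<longrightarrow> w i = v i) \<and> sat A w \<phi>)"
proof (induction "is" arbitrary: v)
  case Nil
  have "w = v" if "\<forall>i. w i = v i" for w using that by (simp add: fun_eq_iff)
  then show ?case by auto
next
  case (Cons j "is")
  show ?case
  proof
    assume "sat A v (foldr PEx (j # is) \<phi>)"
    then obtain a w where "a \<in> A" "\<forall>i\<in>set is. w i \<in> A" "\<forall>i. i \<notin> set is \<longrightarrow> w i = (v(j := a)) i" "sat A w \<phi>"
      using Cons.IH by auto
    then show "\<exists>w. (\<forall>i\<in>set (j # is). w i \<in> A) \<and> (\<forall>i. i \<notin> set (j # is) \<longrightarrow> w i = v i) \<and> sat A w \<phi>"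
      by (intro exI[of _ w]) (cases "j \<in> set is"; auto)
  next
    assume "\<exists>w. (\<forall>i\<in>set (j # is). w i \<in> A) \<and> (\<forall>i. i \<notin> set (j # is) \<longrightarrow> w i = v i) \<and> sat A w \<phi>"
    then obtain w where w: "\<forall>i\<in>set (j # is). w i \<in> A" "\<forall>i. i \<notin> set (j # is) \<longrightarrow> w i = v i" "sat A w \<phi>"
      by blast
    then have "sat A (v(j := w j)) (foldr PEx is \<phi>)"
      unfolding Cons.IH by (intro exI[of _ w]) auto
    then show "sat A v (foldr PEx (j # is) \<phi>)" using w(1) by auto
  qed
qed

lemma pp_over_foldr_PEx: "pp_over A Q (foldr PEx is \<phi>) \<longleftrightarrow> pp_over A Q \<phi>"
  by (induction "is") auto

lemma free_vars_foldr_PEx: "free_vars (foldr PEx is \<phi>) = free_vars \<phi> - set is"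
  by (induction "is") auto

section \<open>Orbits of tuples and the operator d-LOC\<close>

lemma finite_tuples: "finite A \<Longrightarrow> finite (tuples A n)"
  using finite_lists_length_eq[of A n] by (simp add: tuples_def)

text \<open>The variables \<open>m, \<dots>, m + |A|\<^sup>d - 1\<close> of the formula hold the value table of a \<open>d\<close>-ary operation.
  As there are only finitely many such operations, finitely many atoms suffice to exclude those that
  do not preserve \<open>Q\<close>, even if \<open>Q\<close> is infinite.\<close>

lemma orbit_in_rel_clone:
  assumes A: "finite A" and Q: "Q \<subseteq> Rel A" and d: "1 \<le> d" and m: "1 \<le> m"
    and rs: "length rs = d" "set rs \<subseteq> tuples A m"
  shows "(\<lambda>f. rowwise f rs) ` ary_part d (Pol A Q) \<in> rel_clone A Q"
proof -
  define M where "M = ary_part d (Pol A Q)"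
  obtain ts where ts: "set ts = tuples A d" "distinct ts"
    using finite_distinct_list[OF finite_tuples[OF A]] by blast
  define N where "N = length ts"
  \<comment> \<open>With \<open>pos t\<close> the position of \<open>t\<close> in the enumeration,
    variable \<open>m + pos t\<close> holds the value at \<open>t\<close>.\<close>
  have "\<forall>t\<in>tuples A d. \<exists>k. k < N \<and> ts ! k = t" using ts(1) by (metis N_def in_set_conv_nth)
  then obtain pos where pos: "\<And>t. t \<in> tuples A d \<Longrightarrow> pos t < N \<and> ts ! pos t = t" by metis
  let ?col = "\<lambda>qs i. map (\<lambda>r. r ! i) qs"
  have "\<exists>p. fst p \<in> Q \<and> length (snd p) = d \<and> set (snd p) \<subseteq> fst p \<and> rowwise g (snd p) \<notin> fst p"
    if "g \<in> ops A d - M" for g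
    using that d by (auto simp: M_def ary_part_def Pol_def Op_def preserves_iff)
  then obtain p where p: "\<And>g. g \<in> ops A d - M \<Longrightarrow>
      fst (p g) \<in> Q \<and> length (snd (p g)) = d \<and> set (snd (p g)) \<subseteq> fst (p g) \<and> rowwise g (snd (p g)) \<notin> fst (p g)"
    by metis
  define \<tau> qs where "\<tau> = (\<lambda>g. fst (p g))" and "qs = (\<lambda>g. snd (p g))"
  have bad: "\<tau> g \<in> Q" "length (qs g) = d" "set (qs g) \<subseteq> \<tau> g" "rowwise g (qs g) \<notin> \<tau> g"
    if "g \<in> ops A d - M" for g
    using p[OF that] by (auto simp: \<tau>_def qs_def)
  have tuples_qs: "\<tau> g \<subseteq> tuples A (length (hd (qs g)))" if g: "g \<in> ops A d - M" for g
  proof -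
    obtain k where k: "\<tau> g \<subseteq> tuples A k" using bad(1)[OF g] Q by (auto simp: Rel_def)
    have "qs g \<noteq> []" using bad(2)[OF g] d by auto
    then have "hd (qs g) \<in> tuples A k" using bad(3)[OF g] k by (meson hd_in_set subsetD)
    then show ?thesis using k by (simp add: tuples_def)
  qed
  have col_qs: "?col (qs g) i \<in> tuples A d" if "g \<in> ops A d - M" "i < length (hd (qs g))" for g i
    using column_in_tuples[of "qs g" A "length (hd (qs g))" i d] bad(2,3)[OF that(1)] tuples_qs[OF that(1)] that(2)
    by blast
  have col_rs: "?col rs i \<in> tuples A d" if "i < m" for i
    using column_in_tuples[OF rs(2) that rs(1)] .
  \<comment> \<open>The atom says that the operation held in the table maps the rows
    \<open>qs g\<close>, on which \<open>g\<close> fails, into \<open>\<tau> g\<close>.\<close>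
  define atom where "atom g = PRel (\<tau> g) (map (\<lambda>i. m + pos (?col (qs g) i)) [0..<length (hd (qs g))])" for g
  obtain bs where bs: "set bs = ops A d - M"
    using finite_list[of "ops A d - M"] finite_PiE[OF finite_tuples[OF A], of d "\<lambda>_. A"] A by (auto simp: ops_def)
  \<comment> \<open>The equations force the free variables \<open>0, ..., m - 1\<close> to be the
    result of applying the tabulated operation to the columns of \<open>rs\<close>.\<close>
  define \<phi>s where "\<phi>s = map (\<lambda>i. PEq i (m + pos (?col rs i))) [0..<m] @ map atom bs"
  \<comment> \<open>\<open>PEq 0 0\<close> is the empty conjunction; it makes variable
    \<open>0\<close> free, which is allowed since \<open>1 \<le> m\<close>.\<close>
  define \<Phi> where "\<Phi> = foldr PEx [m..<m + N] (foldr PAnd \<phi>s (PEq 0 0))"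
  have over: "pp_over A Q \<Phi>"
    unfolding \<Phi>_def pp_over_foldr_PEx pp_over_conj
    using bad(1) tuples_qs bs by (auto simp: \<phi>s_def atom_def)
  have free: "free_vars \<Phi> \<subseteq> {..<m}"
  proof -
    have "\<not> N \<le> pos (?col rs i)" if "i < m" for i using pos[OF col_rs[OF that]] by simp
    moreover have "\<not> N \<le> pos (?col (qs g) i)" if "g \<in> ops A d" "g \<notin> M" "i < length (hd (qs g))" for g i
      using pos[OF col_qs[of g i]] that by simp
    ultimately show ?thesis
      unfolding \<Phi>_def free_vars_foldr_PEx free_vars_conj
      using m bs by (auto simp: \<phi>s_def atom_def not_less)
  qed
  have sat_\<Phi>: "sat A v \<Phi> \<longleftrightarrow> (\<exists>w. (\<forall>i. m \<le> i \<and> i < m + N \<longrightarrow> w i \<in> A) \<and> (\<forall>i. i < m \<or> m + N \<le> i \<longrightarrow> w i = v i)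
      \<and> (\<forall>i<m. w i = w (m + pos (?col rs i))) \<and> (\<forall>g\<in>ops A d - M.
        map (\<lambda>i. w (m + pos (?col (qs g) i))) [0..<length (hd (qs g))] \<in> \<tau> g))" for v
    unfolding \<Phi>_def \<phi>s_def sat_foldr_PEx sat_conj using bs
    by (simp add: atom_def ball_Un comp_def not_le not_less imp_conjL de_Morgan_conj) (simp add: Ball_def imp_conjL)
  have ne: "rs \<noteq> []" using rs(1) d by auto
  have "(\<lambda>f. rowwise f rs) ` M = {xs \<in> tuples A m. sat A (\<lambda>i. xs ! i) \<Phi>}"
  proof (intro equalityI subsetI)
    fix xs assume "xs \<in> (\<lambda>f. rowwise f rs) ` M"
    then obtain f where f: "f \<in> M" and xs: "xs = rowwise f rs" by blast
    have f_ops: "f \<in> ops A d" using f by (auto simp: M_def ary_part_def Pol_def Op_def)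
    have xs_mem: "xs \<in> tuples A m" unfolding xs using f_ops ne rs by (intro rowwise_in_tuples) auto
    \<comment> \<open>The quantified variables are witnessed by the value table of
      \<open>f\<close>.\<close>
    define w where "w i = (if m \<le> i \<and> i < m + N then f (ts ! (i - m)) else xs ! i)" for i
    have w_pos: "w (m + pos t) = f t" if "t \<in> tuples A d" for t using pos[OF that] by (simp add: w_def)
    have "w i \<in> A" if "m \<le> i" "i < m + N" for i
    proof -
      have "ts ! (i - m) \<in> tuples A d" using that ts(1) N_def by (metis add.commute less_diff_conv2 nth_mem)
      then show ?thesis using that f_ops by (auto simp: w_def ops_def)
    qed
    moreover have "w i = w (m + pos (?col rs i))" if "i < m" for i
      using that w_pos[OF col_rs[OF that]] by (simp add: w_def xs rowwise_eq[OF ne rs(2)])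
    moreover have "map (\<lambda>i. w (m + pos (?col (qs g) i))) [0..<length (hd (qs g))] \<in> \<tau> g"
      if g: "g \<in> ops A d - M" for g
    proof -
      have "rowwise f (qs g) \<in> \<tau> g"
        using f bad(1-3)[OF g] by (auto simp: M_def ary_part_def Pol_def preserves_iff)
      moreover have "rowwise f (qs g) = map (\<lambda>i. w (m + pos (?col (qs g) i))) [0..<length (hd (qs g))]"
        unfolding rowwise_def using w_pos col_qs[OF g] by (intro map_cong refl) auto
      ultimately show ?thesis by simp
    qed
    moreover have "w i = xs ! i" if "i < m \<or> m + N \<le> i" for i using that by (auto simp: w_def)
    ultimately have "sat A (\<lambda>i. xs ! i) \<Phi>" unfolding sat_\<Phi> by (intro exI[of _ w]) blast
    then show "xs \<in> {xs \<in> tuples A m. sat A (\<lambda>i. xs ! i) \<Phi>}" using xs_mem by blast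
  next
    fix xs assume "xs \<in> {xs \<in> tuples A m. sat A (\<lambda>i. xs ! i) \<Phi>}"
    then have xs: "xs \<in> tuples A m" and "sat A (\<lambda>i. xs ! i) \<Phi>" by auto
    then obtain w where w1: "\<forall>i. m \<le> i \<and> i < m + N \<longrightarrow> w i \<in> A"
      and w2: "\<forall>i. i < m \<or> m + N \<le> i \<longrightarrow> w i = xs ! i"
      and w3: "\<forall>i<m. w i = w (m + pos (?col rs i))"
      and w4: "\<forall>g\<in>ops A d - M.
        map (\<lambda>i. w (m + pos (?col (qs g) i))) [0..<length (hd (qs g))] \<in> \<tau> g"
      unfolding sat_\<Phi> by (elim exE conjE)
    define f where "f = (\<lambda>t\<in>tuples A d. w (m + pos t))"
    have f_ops: "f \<in> ops A d" using w1 pos by (auto simp: f_def ops_def)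
    have "f \<in> M"
    \<comment> \<open>If the operation read off the table were outside \<open>M\<close>, the formula
      would contain its own atom, contrary to the choice of \<open>qs f\<close>.\<close>
    proof (rule ccontr)
      assume "f \<notin> M"
      then have g: "f \<in> ops A d - M" using f_ops by blast
      have "rowwise f (qs f) = map (\<lambda>i. w (m + pos (?col (qs f) i))) [0..<length (hd (qs f))]"
        unfolding rowwise_def using col_qs[OF g] by (intro map_cong refl) (auto simp: f_def)
      then show False using bspec[OF w4 g] bad(4)[OF g] by simp
    qed
    moreover have "xs = rowwise f rs"
      unfolding rowwise_eq[OF ne rs(2)]
    proof (rule nth_equalityI)
      show "length xs = length (map (\<lambda>i. f (?col rs i)) [0..<m])" using xs by (simp add: tuples_def)
      fix i assume "i < length xs"
      then have i: "i < m" using xs by (simp add: tuples_def)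
      have "xs ! i = w (m + pos (?col rs i))" using w2 w3 i by metis
      then show "xs ! i = map (\<lambda>i. f (?col rs i)) [0..<m] ! i" using i col_rs[OF i] by (simp add: f_def)
    qed
    ultimately show "xs \<in> (\<lambda>f. rowwise f rs) ` M" by blast
  qed
  then show ?thesis using over free m unfolding rel_clone_def M_def by blast
qed

text \<open>The right-hand side is the set of relations invariant under the \<open>d\<close>-ary
  polymorphisms. At most \<open>d\<close> tuples of \<rho> can be listed as the rows of one
  application of a \<open>d\<close>-ary operation; their orbit contains them, stays inside an
  invariant \<rho>, and is definable by \<open>orbit_in_rel_clone\<close>.\<close>

lemma LOC_rel_clone:
  assumes A: "finite A" and Q: "Q \<subseteq> Rel A" and d: "1 \<le> d"
  shows "LOC A d (rel_clone A Q) = {\<rho> \<in> Rel A. \<forall>f\<in>ary_part d (Pol A Q). preserves (d, f) \<rho>}"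
proof (intro equalityI subsetI)
  fix \<rho> assume \<rho>: "\<rho> \<in> LOC A d (rel_clone A Q)"
  have "rowwise f rs \<in> \<rho>" if f: "f \<in> ary_part d (Pol A Q)" and rs: "length rs = d" "set rs \<subseteq> \<rho>" for f rs
  proof -
    have "card (set rs) \<le> d" using card_length[of rs] rs by simp
    then obtain \<sigma> where "\<sigma> \<in> rel_clone A Q" "set rs \<subseteq> \<sigma>" "\<sigma> \<subseteq> \<rho>"
      using \<rho> rs(2) unfolding LOC_def by blast
    then show ?thesis using rel_clone_preserved[of d f A Q \<sigma>] f rs(1) by (auto simp: ary_part_def preserves_iff)
  qed
  then show "\<rho> \<in> {\<rho> \<in> Rel A. \<forall>f\<in>ary_part d (Pol A Q). preserves (d, f) \<rho>}"
    using \<rho> by (auto simp: LOC_def preserves_iff)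
next
  fix \<rho> assume "\<rho> \<in> {\<rho> \<in> Rel A. \<forall>f\<in>ary_part d (Pol A Q). preserves (d, f) \<rho>}"
  then have \<rho>: "\<rho> \<in> Rel A" "\<And>f. f \<in> ary_part d (Pol A Q) \<Longrightarrow> preserves (d, f) \<rho>" by auto
  obtain m where m: "1 \<le> m" "\<rho> \<subseteq> tuples A m" using \<rho>(1) by (auto simp: Rel_def)
  have "\<exists>\<sigma>\<in>rel_clone A Q. S \<subseteq> \<sigma> \<and> \<sigma> \<subseteq> \<rho>" if S: "S \<subseteq> \<rho>" "finite S" "card S \<le> d" for S
  proof (cases "S = {}")
    \<comment> \<open>There is no tuple to list as a row, and the empty relation takes the place of
      the orbit.\<close>
    case True
    then show ?thesis by (intro bexI[of _ "{}"]) (auto simp: rel_clone_def)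
  next
    case False
    obtain xs where xs: "set xs = S" "distinct xs" using finite_distinct_list[OF S(2)] by blast
    \<comment> \<open>Repeating a tuple brings the list to the exact length
      \<open>d\<close>.\<close>
    define rs where "rs = xs @ replicate (d - length xs) (hd xs)"
    have "xs \<noteq> []" "length xs \<le> d" using xs False S(3) distinct_card[of xs] by auto
    then have rs: "length rs = d" "set rs = S" using xs by (auto simp: rs_def)
    have sub: "set rs \<subseteq> tuples A m" using rs S m by blast
    let ?\<sigma> = "(\<lambda>f. rowwise f rs) ` ary_part d (Pol A Q)"
    have "S \<subseteq> ?\<sigma>"
    proof
      fix r assume "r \<in> S"
      then obtain i where i: "i < d" "r = rs ! i" using rs by (metis in_set_conv_nth)
      then have "r = rowwise (\<lambda>xs\<in>tuples A d. xs ! i) rs" using rowwise_projection[OF sub] rs(1) by simp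
      moreover have "(\<lambda>xs\<in>tuples A d. xs ! i) \<in> ary_part d (Pol A Q)"
        using clone_projection[OF Pol_clone[OF Q] i(1)] by (simp add: ary_part_def)
      ultimately show "r \<in> ?\<sigma>" by blast
    qed
    moreover have "?\<sigma> \<subseteq> \<rho>" using \<rho>(2) rs S(1) by (auto simp: preserves_iff)
    ultimately show ?thesis using orbit_in_rel_clone[OF A Q d m(1) rs(1) sub] by blast
  qed
  then show "\<rho> \<in> LOC A d (rel_clone A Q)" using \<rho>(1) by (auto simp: LOC_def)
qed

text \<open>Each side determines the other: the closures consist of the invariant relations of the
  \<open>d\<close>-ary polymorphisms, and the relations of \<open>Q\<close> are among them, which
  recovers these polymorphisms.\<close>

lemma LOC_rel_clone_eq_iff:
  assumes "finite A" "Q \<subseteq> Rel A" "Q' \<subseteq> Rel A" "1 \<le> d"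
  shows "LOC A d (rel_clone A Q) = LOC A d (rel_clone A Q') \<longleftrightarrow> ary_part d (Pol A Q) = ary_part d (Pol A Q')"
proof
  have "ary_part d (Pol A Q1) \<subseteq> ary_part d (Pol A Q2)"
    if eq: "{\<rho> \<in> Rel A. \<forall>f\<in>ary_part d (Pol A Q1). preserves (d, f) \<rho>}
      = {\<rho> \<in> Rel A. \<forall>f\<in>ary_part d (Pol A Q2). preserves (d, f) \<rho>}" and Q2: "Q2 \<subseteq> Rel A" for Q1 Q2
  proof
    fix f assume f: "f \<in> ary_part d (Pol A Q1)"
    have "preserves (d, f) \<rho>" if \<rho>: "\<rho> \<in> Q2" for \<rho>
    proof -
      have "\<rho> \<in> {\<rho> \<in> Rel A. \<forall>f\<in>ary_part d (Pol A Q2). preserves (d, f) \<rho>}"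
        using \<rho> Q2 by (auto simp: ary_part_def Pol_def)
      then have "\<rho> \<in> {\<rho> \<in> Rel A. \<forall>f\<in>ary_part d (Pol A Q1). preserves (d, f) \<rho>}" by (simp only: eq)
      then show ?thesis using f by blast
    qed
    then show "f \<in> ary_part d (Pol A Q2)" using f by (auto simp: ary_part_def Pol_def)
  qed
  note * = this
  show "ary_part d (Pol A Q) = ary_part d (Pol A Q')"
    if "LOC A d (rel_clone A Q) = LOC A d (rel_clone A Q')"
  proof -
    note eq = that[unfolded LOC_rel_clone[OF assms(1,2,4)] LOC_rel_clone[OF assms(1,3,4)]]
    show ?thesis by (intro subset_antisym *[OF eq assms(3)] *[OF eq[symmetric] assms(2)])
  qed
  show "LOC A d (rel_clone A Q) = LOC A d (rel_clone A Q')" if "ary_part d (Pol A Q) = ary_part d (Pol A Q')"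
    unfolding LOC_rel_clone[OF assms(1,2,4)] LOC_rel_clone[OF assms(1,3,4)] that ..
qed

text \<open>Listing the values of a function on \<alpha> is injective and commutes with the
  application of \<open>f\<close>. Since \<open>1 \<le> n\<close>, there is a first row from which
  \<open>rowwise\<close> reads the length.\<close>

lemma preserves_ordinary_rel:
  assumes b: "bij_betw (b \<alpha>) {..<card (points \<alpha>)} (points \<alpha>)" and \<rho>: "\<rho> \<subseteq> points \<alpha> \<rightarrow>\<^sub>E A"
    and f: "f \<in> ops A n" "1 \<le> n"
  shows "preserves (n, f) (ordinary_rel b (\<alpha>, \<rho>)) \<longleftrightarrow> preserves_rrel (n, f) (\<alpha>, \<rho>)"
proof -
  let ?N = "card (points \<alpha>)"
  define r where "r g = map (\<lambda>i. g (b \<alpha> i)) [0..<?N]" for g :: "_ \<Rightarrow> 'b"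
  have ord: "ordinary_rel b (\<alpha>, \<rho>) = r ` \<rho>" by (simp add: ordinary_rel_def r_def)
  have inj: "g = g'" if "g \<in> points \<alpha> \<rightarrow>\<^sub>E A" "g' \<in> points \<alpha> \<rightarrow>\<^sub>E A" "r g = r g'" for g g'
  proof (rule PiE_ext[OF that(1,2)])
    fix X assume "X \<in> points \<alpha>"
    then obtain i where "i < ?N" "X = b \<alpha> i" using b by (auto simp: bij_betw_def)
    then show "g X = g' X" using arg_cong[OF that(3), of "\<lambda>xs. xs ! i"] by (simp add: r_def)
  qed
  have rowwise: "rowwise f (map r gs) = r (pointwise \<alpha> f gs)" if "gs \<noteq> []" for gs
  proof -
    have "b \<alpha> i \<in> points \<alpha>" if "i < ?N" for i using b that by (auto simp: bij_betw_def)
    moreover have "length (hd (map r gs)) = ?N" using that by (cases gs) (auto simp: r_def)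
    ultimately show ?thesis
      unfolding rowwise_def r_def pointwise_def by (intro nth_equalityI) (auto simp: r_def comp_def)
  qed
  have "rowwise f (map r gs) \<in> r ` \<rho> \<longleftrightarrow> pointwise \<alpha> f gs \<in> \<rho>" if gs: "length gs = n" "set gs \<subseteq> \<rho>" for gs
  proof -
    have "pointwise \<alpha> f gs \<in> points \<alpha> \<rightarrow>\<^sub>E A" using pointwise_mem[OF f(1) gs(1)] gs \<rho> by blast
    moreover have "gs \<noteq> []" using gs f(2) by auto
    ultimately have "r (pointwise \<alpha> f gs) \<in> r ` \<rho> \<longleftrightarrow> pointwise \<alpha> f gs \<in> \<rho>"
      using inj[OF _ subsetD[OF \<rho>]] by auto
    then show ?thesis using rowwise[OF \<open>gs \<noteq> []\<close>] by simp
  qed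
  then show ?thesis
    unfolding preserves_iff preserves_rrel_iff ord
  proof (intro iffI allI impI; elim conjE)
    fix gs assume "\<forall>rs. length rs = n \<and> set rs \<subseteq> r ` \<rho> \<longrightarrow> rowwise f rs \<in> r ` \<rho>" "length gs = n" "set gs \<subseteq> \<rho>"
    moreover have "set (map r gs) \<subseteq> r ` \<rho>" using \<open>set gs \<subseteq> \<rho>\<close> by auto
    ultimately show "pointwise \<alpha> f gs \<in> \<rho>"
      using \<open>\<And>gs. length gs = n \<Longrightarrow> set gs \<subseteq> \<rho> \<Longrightarrow> _\<close> by (metis length_map)
  next
    fix rs assume *: "\<forall>gs. length gs = n \<and> set gs \<subseteq> \<rho> \<longrightarrow> pointwise \<alpha> f gs \<in> \<rho>" "length rs = n" "set rs \<subseteq> r ` \<rho>"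
    have "rs \<in> map r ` lists \<rho>" using *(3) by (simp add: lists_image[symmetric] in_lists_conv_set subset_iff)
    then obtain gs where gs: "rs = map r gs" "set gs \<subseteq> \<rho>" by auto
    then show "rowwise f rs \<in> r ` \<rho>"
      using *(1,2) \<open>\<And>gs. length gs = n \<Longrightarrow> set gs \<subseteq> \<rho> \<Longrightarrow> _\<close> by simp
  qed
qed

lemma Pol_ordinary_rel:
  assumes b: "\<And>\<alpha>. canonical \<alpha> \<Longrightarrow> bij_betw (b \<alpha>) {..<card (points \<alpha>)} (points \<alpha>)"
    and Q: "Q \<subseteq> GQuord A d"
  shows "Pol A (ordinary_rel b ` Q) = Pol_rrel A Q"
proof -
  have "preserves (n, f) (ordinary_rel b T) \<longleftrightarrow> preserves_rrel (n, f) T" if "(n, f) \<in> Op A" "T \<in> Q" for n f T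
  proof -
    obtain \<alpha> \<rho> where T: "T = (\<alpha>, \<rho>)" by (cases T)
    then have "(\<alpha>, \<rho>) \<in> GQuord A d" using Q \<open>T \<in> Q\<close> by blast
    note G = GQuordD[OF this]
    show ?thesis unfolding T
      by (rule preserves_ordinary_rel[of b \<alpha>, OF b[OF G(1)] G(4)]) (use that(1) in \<open>auto simp: Op_def\<close>)
  qed
  then show ?thesis by (auto simp: Pol_def Pol_rrel_def)
qed

lemma ordinary_rel_Rel:
  assumes b: "\<And>\<alpha>. canonical \<alpha> \<Longrightarrow> bij_betw (b \<alpha>) {..<card (points \<alpha>)} (points \<alpha>)"
    and T: "T \<in> GQuord A d"
  shows "ordinary_rel b T \<in> Rel A"
proof -
  obtain \<alpha> \<rho> where T': "T = (\<alpha>, \<rho>)" by (cases T)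
  note G = GQuordD[OF T[unfolded T']]
  \<comment> \<open>The enumeration itself shows finiteness; otherwise \<open>card\<close> would be
    \<open>0\<close> by default.\<close>
  have "finite (points \<alpha>)" using bij_betw_finite[OF b[OF G(1)]] by simp
  then have "1 \<le> card (points \<alpha>)" using points_nonempty[OF G(1)] by (simp add: Suc_le_eq card_gt_0_iff)
  moreover have "ordinary_rel b T \<subseteq> tuples A (card (points \<alpha>))"
    using b[OF G(1)] G(4) by (fastforce simp: T' ordinary_rel_def tuples_def bij_betw_def)
  ultimately show ?thesis unfolding Rel_def by blast
qed

section \<open>Characterizations of R-closed clone fragments\<close>

lemma fragment_rrel_properties:
  assumes e: "bij_betw e A {..<card A}" and A: "finite A" "A \<noteq> {}" and d: "1 \<le> d"
    and M: "clone_fragment A d M"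
  shows "ary_part d (Pol_rrel A {fragment_rrel A e d M}) = M"
    and "clone A (star A d M) \<Longrightarrow> fragment_rrel A e d M \<in> GQuord A d"
proof -
  have e1: "e a \<in> {..<card A} \<and> inv_into A e (e a) = a" if "a \<in> A" for a
    using e that by (auto simp: bij_betw_def)
  have e2: "inv_into A e k \<in> A \<and> e (inv_into A e k) = k" if "k \<in> {..<card A}" for k
    using e that by (metis bij_betw_imp_surj_on f_inv_into_f inv_into_into)
  show "ary_part d (Pol_rrel A {fragment_rrel A e d M}) = M"
    unfolding fragment_rrel_eq_recode by (rule Pol_recode[OF e1 e2 M d])
  show "fragment_rrel A e d M \<in> GQuord A d" if "clone A (star A d M)"
  proof -
    have "generalized_quasiorder A [({..<card A}, d)] (recode {..<card A} (inv_into A e) d ` M)"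
      by (rule generalized_quasiorder_recode[OF e1 e2 M that d A(2)])
    moreover have "1 \<le> card A" using A by (simp add: Suc_le_eq card_gt_0_iff)
    ultimately show ?thesis
      using d by (auto simp: fragment_rrel_eq_recode GQuord_def canonical_def dimension_def)
  qed
qed

text \<open>On the fragments concerned \<open>star\<close> and \<open>ary_part\<close> are inverse
  to each other. This is the reason why the same \<open>Q\<close> serves in (ii) and (iii).\<close>

lemma ary_part_Pol_eq_iff_star_eq:
  assumes M: "clone_fragment A d M" and Q: "Q \<subseteq> GQuord A d" and d: "1 \<le> d" and A: "A \<noteq> {}"
  shows "M = ary_part d (Pol_rrel A Q) \<longleftrightarrow> star A d M = Pol_rrel A Q"
proof
  show "star A d M = Pol_rrel A Q" if "M = ary_part d (Pol_rrel A Q)"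
    using star_ary_part_Pol_GQuord[OF Q d A] that by simp
  show "M = ary_part d (Pol_rrel A Q)" if eq: "star A d M = Pol_rrel A Q"
  proof -
    have "const_ops A d \<subseteq> M"
      by (rule const_ops_subset_of_clone_star) (simp add: eq clone_Pol_GQuord[OF Q])
    then show ?thesis using ary_part_star[OF M _ A d] eq by simp
  qed
qed

text \<open>The closure, coded as a relation, is a generalized quasiorder preserved by
  \<open>M\<close>, so every polymorphism of all these relations preserves it and lies in the star
  of the closure. Conversely, the \<open>d\<close>-ary part of these polymorphisms contains
  \<open>M\<close> and its star is a clone, so it contains the closure.\<close>

lemma star_R_closure:
  assumes e: "bij_betw e A {..<card A}" and A: "finite A" "A \<noteq> {}" and d: "1 \<le> d"
    and M: "M \<subseteq> ops A d"
  shows "star A d (R_closure A d M) = Pol_rrel A (GQuord_inv A d (Pair d ` M))"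
proof
  let ?N = "R_closure A d M" and ?Q = "GQuord_inv A d (Pair d ` M)"
  note N = R_closure_properties[OF M d]
  have Q: "?Q \<subseteq> GQuord A d" by (auto simp: GQuord_inv_def)
  note T = fragment_rrel_properties[OF e A d N(3)]
  have T_GQ: "fragment_rrel A e d ?N \<in> GQuord A d" using T(2) N(4) .
  have "preserves_rrel (d, f) (fragment_rrel A e d ?N)" if "f \<in> M" for f
  proof -
    have "f \<in> ary_part d (Pol_rrel A {fragment_rrel A e d ?N})" using T(1) N(1) that by blast
    then show ?thesis by (simp add: ary_part_def Pol_rrel_def)
  qed
  then have "fragment_rrel A e d ?N \<in> ?Q" using T_GQ by (auto simp: GQuord_inv_def)
  then have "Pol_rrel A ?Q \<subseteq> Pol_rrel A {fragment_rrel A e d ?N}" by (auto simp: Pol_rrel_def)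
  also have "\<dots> = star A d ?N"
    using ary_part_Pol_eq_iff_star_eq[OF N(3) _ d A(2), of "{fragment_rrel A e d ?N}"] T(1) T_GQ by simp
  finally show "Pol_rrel A ?Q \<subseteq> star A d ?N" .
  let ?K = "ary_part d (Pol_rrel A ?Q)"
  have K: "star A d ?K = Pol_rrel A ?Q" by (rule star_ary_part_Pol_GQuord[OF Q d A(2)])
  have "M \<subseteq> ?K" using M d by (auto simp: ary_part_def Pol_rrel_def GQuord_inv_def Op_def)
  then have "?N \<subseteq> ?K"
    by (rule R_closure_least) (simp_all add: K clone_Pol_GQuord[OF Q] clone_fragment_ary_part)
  then show "star A d ?N \<subseteq> Pol_rrel A ?Q" using star_mono K by metis
qed

text \<open>All existence statements have the same witness, the coding of \<open>M\<close> itself;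
  hence one relation does as well as a set of relations.\<close>

lemma R_closed_iff:
  assumes e: "bij_betw e A {..<card A}" and A: "finite A" "A \<noteq> {}" and d: "1 \<le> d"
    and M: "clone_fragment A d M"
  shows "R_closed A d M \<longleftrightarrow> fragment_rrel A e d M \<in> GQuord A d"
    and "R_closed A d M \<longleftrightarrow> (\<exists>Q \<subseteq> GQuord A d. M = ary_part d (Pol_rrel A Q))"
    and "R_closed A d M \<longleftrightarrow> (\<exists>T \<in> GQuord A d. M = ary_part d (Pol_rrel A {T}))"
proof -
  note T = fragment_rrel_properties[OF e A d M]
  have closed: "R_closed A d M" if Q: "Q \<subseteq> GQuord A d" and eq: "M = ary_part d (Pol_rrel A Q)" for Q
  proof -
    have "star A d M = Pol_rrel A Q" using ary_part_Pol_eq_iff_star_eq[OF M Q d A(2)] eq by blast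
    then show ?thesis using R_closed_iff_clone_star[OF M d] clone_Pol_GQuord[OF Q] by simp
  qed
  have GQ: "fragment_rrel A e d M \<in> GQuord A d" if "R_closed A d M"
    using T(2) R_closed_iff_clone_star[OF M d] that by blast
  show "R_closed A d M \<longleftrightarrow> fragment_rrel A e d M \<in> GQuord A d"
    using GQ closed[of "{fragment_rrel A e d M}"] T(1) by auto
  show "R_closed A d M \<longleftrightarrow> (\<exists>Q \<subseteq> GQuord A d. M = ary_part d (Pol_rrel A Q))"
    using GQ closed T(1) by (metis empty_subsetI insert_subset)
  show "R_closed A d M \<longleftrightarrow> (\<exists>T \<in> GQuord A d. M = ary_part d (Pol_rrel A {T}))"
    using GQ closed T(1) by (metis empty_subsetI insert_subset)
qed

theorem corollary7p4:
  fixes A :: "'a set" and d :: nat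
    and e :: "'a \<Rightarrow> nat"
    and b :: "nat arity \<Rightarrow> nat \<Rightarrow> nat list list"
  assumes "1 \<le> d" and "finite A" and "A \<noteq> {}"
    and "bij_betw e A {..<card A}"
    and "\<And>\<alpha>. canonical \<alpha> \<Longrightarrow> bij_betw (b \<alpha>) {..<card (points \<alpha>)} (points \<alpha>)"
  shows
    "(\<forall>M \<subseteq> ops A d. star A d (R_closure A d M) = Pol_rrel A (GQuord_inv A d (Pair d ` M)))
   \<and>
     (\<forall>M. clone_fragment A d M \<longrightarrow>
        (R_closed A d M \<longleftrightarrow> clone A (star A d M))
      \<and> (R_closed A d M \<longleftrightarrow> fragment_rrel A e d M \<in> GQuord A d)
      \<and> (R_closed A d M \<longleftrightarrow> (\<exists>Q \<subseteq> GQuord A d. M = ary_part d (Pol_rrel A Q)))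
      \<and> (R_closed A d M \<longleftrightarrow> (\<exists>Q \<subseteq> GQuord A d. star A d M = Pol_rrel A Q))
      \<and> (\<forall>Q \<subseteq> GQuord A d. M = ary_part d (Pol_rrel A Q) \<longleftrightarrow> star A d M = Pol_rrel A Q))
   \<and>
     (\<forall>Q \<subseteq> Rel A. \<forall>M. M = ary_part d (Pol A Q) \<longrightarrow>
        (R_closed A d M \<longleftrightarrow> clone A (star A d M))
      \<and> (R_closed A d M \<longleftrightarrow> fragment_rrel A e d M \<in> GQuord A d)
      \<and> (R_closed A d M \<longleftrightarrow> (\<exists>Q' \<subseteq> GQuord A d. M = ary_part d (Pol_rrel A Q')))
      \<and> (R_closed A d M \<longleftrightarrow> (\<exists>Q' \<subseteq> GQuord A d.
            LOC A d (rel_clone A Q) = LOC A d (rel_clone A (ordinary_rel b ` Q'))))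
      \<and> (R_closed A d M \<longleftrightarrow> (\<exists>Q' \<subseteq> GQuord A d. star A d M = Pol_rrel A Q'))
      \<and> (\<forall>Q' \<subseteq> GQuord A d. M = ary_part d (Pol_rrel A Q') \<longleftrightarrow> star A d M = Pol_rrel A Q')
      \<and> (R_closed A d M \<longleftrightarrow> (\<exists>\<rho> \<in> GQuord A d. M = ary_part d (Pol_rrel A {\<rho>})))
      \<and> (R_closed A d M \<longleftrightarrow> (\<exists>\<rho> \<in> GQuord A d.
            LOC A d (rel_clone A Q) = LOC A d (rel_clone A (ordinary_rel b ` {\<rho>}))))
      \<and> (R_closed A d M \<longleftrightarrow> (\<exists>\<rho> \<in> GQuord A d. star A d M = Pol_rrel A {\<rho>})))"
proof (intro conjI allI impI)
  note A = assms(2,3) and d = assms(1) and e = assms(4) and b = assms(5)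
  show "star A d (R_closure A d M) = Pol_rrel A (GQuord_inv A d (Pair d ` M))" if "M \<subseteq> ops A d" for M
    by (rule star_R_closure[OF e A d that])
  have star_iff: "M = ary_part d (Pol_rrel A Q) \<longleftrightarrow> star A d M = Pol_rrel A Q"
    if "clone_fragment A d M" "Q \<subseteq> GQuord A d" for M Q
    by (rule ary_part_Pol_eq_iff_star_eq[OF that d A(2)])
  {
    fix M assume M: "clone_fragment A d M"
    note closed = R_closed_iff[OF e A d M]
    show "R_closed A d M \<longleftrightarrow> clone A (star A d M)" by (rule R_closed_iff_clone_star[OF M d])
    show "R_closed A d M \<longleftrightarrow> fragment_rrel A e d M \<in> GQuord A d" by (rule closed(1))
    show "R_closed A d M \<longleftrightarrow> (\<exists>Q \<subseteq> GQuord A d. M = ary_part d (Pol_rrel A Q))" by (rule closed(2))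
    show "R_closed A d M \<longleftrightarrow> (\<exists>Q \<subseteq> GQuord A d. star A d M = Pol_rrel A Q)"
      unfolding closed(2) using star_iff[OF M] by blast
    show "M = ary_part d (Pol_rrel A Q) \<longleftrightarrow> star A d M = Pol_rrel A Q" if "Q \<subseteq> GQuord A d" for Q
      by (rule star_iff[OF M that])
  }
  fix Q M assume Q: "Q \<subseteq> Rel A" and MQ: "M = ary_part d (Pol A Q)"
  \<comment> \<open>The \<open>d\<close>-ary polymorphisms of any set of relations form a fragment,
    so the characterizations for fragments apply.\<close>
  have M: "clone_fragment A d M" unfolding MQ by (rule clone_fragment_ary_part[OF Pol_clone[OF Q]])
  note closed = R_closed_iff[OF e A d M]
  \<comment> \<open>Condition (ii)' is a restatement of (ii) for each single \<open>Q'\<close>,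
    since equality of the closures means equality of the \<open>d\<close>-ary polymorphisms.\<close>
  have LOC_iff: "LOC A d (rel_clone A Q) = LOC A d (rel_clone A (ordinary_rel b ` Q'))
      \<longleftrightarrow> M = ary_part d (Pol_rrel A Q')" if Q': "Q' \<subseteq> GQuord A d" for Q'
  proof -
    have "ordinary_rel b ` Q' \<subseteq> Rel A" using ordinary_rel_Rel[OF b] Q' by blast
    then show ?thesis
      using LOC_rel_clone_eq_iff[OF A(1) Q _ d] Pol_ordinary_rel[OF b Q'] MQ by simp
  qed
  have LOC_iff_single: "LOC A d (rel_clone A Q) = LOC A d (rel_clone A (ordinary_rel b ` {\<rho>}))
      \<longleftrightarrow> M = ary_part d (Pol_rrel A {\<rho>})" if "\<rho> \<in> GQuord A d" for \<rho>
    by (rule LOC_iff) (use that in simp)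
  have star_iff_single: "M = ary_part d (Pol_rrel A {\<rho>}) \<longleftrightarrow> star A d M = Pol_rrel A {\<rho>}"
    if "\<rho> \<in> GQuord A d" for \<rho>
    by (rule star_iff[OF M]) (use that in simp)
  show "R_closed A d M \<longleftrightarrow> clone A (star A d M)" by (rule R_closed_iff_clone_star[OF M d])
  show "R_closed A d M \<longleftrightarrow> fragment_rrel A e d M \<in> GQuord A d" by (rule closed(1))
  show "R_closed A d M \<longleftrightarrow> (\<exists>Q' \<subseteq> GQuord A d. M = ary_part d (Pol_rrel A Q'))" by (rule closed(2))
  show "R_closed A d M \<longleftrightarrow> (\<exists>Q' \<subseteq> GQuord A d.
      LOC A d (rel_clone A Q) = LOC A d (rel_clone A (ordinary_rel b ` Q')))"
    unfolding closed(2) using LOC_iff by blast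
  show "R_closed A d M \<longleftrightarrow> (\<exists>Q' \<subseteq> GQuord A d. star A d M = Pol_rrel A Q')"
    unfolding closed(2) using star_iff[OF M] by blast
  show "M = ary_part d (Pol_rrel A Q') \<longleftrightarrow> star A d M = Pol_rrel A Q'" if "Q' \<subseteq> GQuord A d" for Q'
    by (rule star_iff[OF M that])
  show "R_closed A d M \<longleftrightarrow> (\<exists>\<rho> \<in> GQuord A d. M = ary_part d (Pol_rrel A {\<rho>}))" by (rule closed(3))
  show "R_closed A d M \<longleftrightarrow> (\<exists>\<rho> \<in> GQuord A d.
      LOC A d (rel_clone A Q) = LOC A d (rel_clone A (ordinary_rel b ` {\<rho>})))"
    unfolding closed(3) by (rule bex_cong[OF refl LOC_iff_single[symmetric]])
  show "R_closed A d M \<longleftrightarrow> (\<exists>\<rho> \<in> GQuord A d. star A d M = Pol_rrel A {\<rho>})"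
    unfolding closed(3) by (rule bex_cong[OF refl star_iff_single])
qed

end
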